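(* Let $\ell\ge3$ be an integer and $q$ a fixed prime power with $q\equiv1\pmod{2\ell}$. Let $\lambda(N)$ be a family of complex numbers indexed by monic polynomials $N\in\mathbb{F}_q[t]$. Then for every $\varepsilon>0$ and all integers $m,n\ge0$, $$\sum_{M\in\mathcal{M}_m}\left|\sum_{N\in\mathcal{H}_n}\lambda(N)\left(\frac{M}{N}\right)_\ell\right|^2\ll q^{\varepsilon(m+n)}\left(q^m+q^{n+m/3}+q^{2(m+n)/3}\right)\sum_{N\in\mathcal{H}_n}|\lambda(N)|^2,$$ where the implied constant depends at most on $\varepsilon,q,\ell$ (not on $m,n,\lambda$).
   Context: $\mathcal{M}_d$ denotes the set of monic polynomials of degree $d$ in $\mathbb{F}_q[t]$ and $\mathcal{H}_d\subset\mathcal{M}_d$ the subset of square-free ones. Residue symbol: fix an isomorphism $\Omega$ from the group of $\ell$-th roots of unity in $\mathbb{F}_q^*$ to the group $\mu_\ell\subset\mathbb{C}^*$ of complex $\ell$-th roots of unity. For a monic irreducible $\pi\in\mathbb{F}_q[t]$ and $a\in\mathbb{F}_q[t]$, put $\left(\frac{a}{\pi}\right)_\ell=0$ if $\pi\mid a$, and otherwise $\left(\frac{a}{\pi}\right)_\ell$ is the unique $\alpha\in\mu_\ell$ with $a^{(q^{\deg \pi}-1)/\ell}\equiv\Omega^{-1}(\alpha)\pmod\pi$. For $c=\pi_1^{e_1}\cdots\pi_k^{e_k}$ monic put $\left(\frac{a}{c}\right)_\ell=\prod_i\left(\frac{a}{\pi_i}\right)_\ell^{e_i}$. *)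

theory Defs
  imports
    Complex_Main
    "HOL-Library.Cardinality"
    "HOL-Computational_Algebra.Computational_Algebra"
    "HOL-Number_Theory.Cong"
begin

text \<open>
  The field with \<open>q\<close> elements is a type \<open>'a :: {field, finite}\<close> with \<open>CARD('a) = q\<close>.
\<close>

definition monic_polys :: "nat \<Rightarrow> 'a::field poly set" where
  "monic_polys d = {f. lead_coeff f = 1 \<and> degree f = d}"

definition squarefree_monic_polys :: "nat \<Rightarrow> 'a::field poly set" where
  "squarefree_monic_polys d = {f \<in> monic_polys d. squarefree f}"

definition unity_roots :: "nat \<Rightarrow> 'a::field set" where
  "unity_roots l = {x. x ^ l = 1}"

definition unity_roots_iso :: "nat \<Rightarrow> ('a::field \<Rightarrow> complex) \<Rightarrow> bool" where
  "unity_roots_iso l \<Omega> \<longleftrightarrow>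
     bij_betw \<Omega> (unity_roots l) (unity_roots l) \<and>
     (\<forall>x\<in>unity_roots l. \<forall>y\<in>unity_roots l. \<Omega> (x * y) = \<Omega> x * \<Omega> y)"

text \<open>
  The division in the exponent is exact and \<open>\<alpha>\<close> exists uniquely when \<open>l\<close> divides \<open>CARD('a) - 1\<close>,
  \<open>unity_roots_iso l \<Omega>\<close> holds and \<open>\<pi>\<close> is irreducible.
\<close>

definition prime_residue_symbol ::
    "nat \<Rightarrow> ('a::{field,finite} \<Rightarrow> complex) \<Rightarrow> 'a poly \<Rightarrow> 'a poly \<Rightarrow> complex" where
  "prime_residue_symbol l \<Omega> a \<pi> =
     (if \<pi> dvd a then 0
      else THE \<alpha>. \<alpha> \<in> unity_roots l \<and>
             [a ^ ((CARD('a) ^ degree \<pi> - 1) div l) =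
                [:inv_into (unity_roots l) \<Omega> \<alpha>:]] (mod \<pi>))"

text \<open>
  The library's \<open>multiplicity\<close> needs \<open>'a poly\<close> to be in class \<open>factorial_semiring\<close>, which
  holds for \<open>'a :: field_gcd\<close> but not for a bare \<open>'a :: field\<close>; this is its value for
  non-constant \<open>\<pi>\<close> and non-zero \<open>c\<close>.
\<close>

definition poly_multiplicity :: "'a::field poly \<Rightarrow> 'a poly \<Rightarrow> nat" where
  "poly_multiplicity \<pi> c = Max {e. \<pi> ^ e dvd c}"

definition residue_symbol ::
    "nat \<Rightarrow> ('a::{field,finite} \<Rightarrow> complex) \<Rightarrow> 'a poly \<Rightarrow> 'a poly \<Rightarrow> complex" where
  "residue_symbol l \<Omega> a c =
     (\<Prod>\<pi> | lead_coeff \<pi> = 1 \<and> irreducible \<pi> \<and> \<pi> dvd c.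
        prime_residue_symbol l \<Omega> a \<pi> ^ poly_multiplicity \<pi> c)"

end

theory Submission
  imports
    "HOL-Algebra.Algebraic_Closure_Type"
    "HOL-Analysis.L2_Norm"
    Defs
begin

text \<open>
  Write \<open>B(m, n)\<close> for the best constant in the inequality. Expanding the square, separating the
  greatest common divisor of the two square-free moduli and applying Fourier inversion modulo
  the product of the cofactors bounds \<open>B(m, n)\<close> by \<open>q\<^sup>m\<close> plus multiples of \<open>q\<^sup>m\<^sup>-\<^sup>n B(k, n)\<close> with
  \<open>k \<le> 2n - m\<close>: by reciprocity the Gauss sums of the product split as \<open>g(N\<^sub>1)\<close> times the conjugate of
  \<open>g(N\<^sub>2)\<close> and are absorbed into the coefficients. For \<open>k \<le> n\<close> write
  \<open>M = M\<^sub>1 M\<^sub>2\<^sup>2 T\<^sup>3\<close> with \<open>M\<^sub>1, M\<^sub>2\<close> square-free. Fixing \<open>M\<^sub>2, T\<close> leaves a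
  sieve over square-free \<open>M\<^sub>1\<close>, which by duality and reciprocity is bounded by \<open>B(n, deg M\<^sub>1)\<close>; fixing
  \<open>M\<^sub>1, T\<close> leaves squares of symbols, which are orthogonal because \<open>l \<ge> 3\<close> and \<open>2 deg M\<^sub>2 \<le> n\<close>.
  This turns the bound in the range \<open>m / n \<ge> (j + 1) / j\<close> into the bound in the range
  \<open>m / n \<ge> (j + 2) / (j + 1)\<close>. The case \<open>n \<le> m\<close> follows by enlarging \<open>m\<close> slightly, and then the case
  \<open>m < n\<close> by the decomposition of \<open>M\<close>.
\<close>


section \<open>Polynomials over a finite field\<close>

text \<open>The exponent \<open>2 / 3\<close> comes from one balance. For degrees
  \<open>a + 2 b + 3 c = k\<close> of \<open>M\<^sub>1, M\<^sub>2, T\<close> the two ways of fixing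
  variables cost about \<open>q^(n + b + c)\<close> and \<open>q^(n + a + c)\<close>. The cheaper
  one is at most \<open>q^(n + k / 3)\<close>, the worst case being \<open>a = b\<close>; cubes may
  be summed trivially because \<open>c \<le> k / 3\<close>. Inserting \<open>k = 2 n - m\<close>
  into \<open>q^(m - n) q^(n + k / 3)\<close> gives exactly \<open>q^(2 (m + n) / 3)\<close>. The
  ranges come from \<open>n / (2 n - m) = 1 / (2 - m / n)\<close>. Their thresholds approach
  \<open>1\<close> without reaching it while the constants depend on \<open>j\<close>, so one
  \<open>j\<close> depending on \<open>\<epsilon>\<close> is fixed and the remaining gap is paid for
  by \<open>q^\<epsilon>\<close>. The obstacle in expanding the square is that the common divisor
  \<open>S \<inter> T\<close> links the two moduli, so the double sum is not itself a square.
  Inclusion-exclusion replaces it by divisibility conditions on each modulus separately, at the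
  price of a divisor function.\<close>

text \<open>Phrased through coefficients because \<open>degree 0 = 0\<close>: the zero polynomial
  has to belong to the set for \<open>n = 0\<close> too. For \<open>n = degree R\<close> this is the
  standard system of residues modulo \<open>R\<close>.\<close>

definition polys_below :: "nat \<Rightarrow> 'a::zero poly set" where
  "polys_below n = {p. \<forall>i\<ge>n. coeff p i = 0}"

lemma polys_below_iff: "p \<in> polys_below n \<longleftrightarrow> p = 0 \<or> degree p < n"
proof
  assume "p \<in> polys_below n"
  then show "p = 0 \<or> degree p < n"
    by (metis (mono_tags, lifting) leading_coeff_0_iff linorder_not_le mem_Collect_eq polys_below_def)
next
  assume "p = 0 \<or> degree p < n"
  then show "p \<in> polys_below n"
    by (auto simp: polys_below_def intro: coeff_eq_0)
qed

lemma polys_below_0 [simp]: "polys_below 0 = {0}"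
  by (auto simp: polys_below_iff)

lemma zero_in_polys_below [simp]: "0 \<in> polys_below n"
  by (simp add: polys_below_iff)

lemma polys_below_Suc: "polys_below (Suc n) = (\<lambda>(c,p). pCons c p) ` (UNIV \<times> polys_below n)"
proof (intro equalityI subsetI)
  fix p :: "'a poly" assume "p \<in> polys_below (Suc n)"
  moreover obtain c p' where "p = pCons c p'" by (cases p)
  ultimately show "p \<in> (\<lambda>(c,p). pCons c p) ` (UNIV \<times> polys_below n)"
    by (force simp: polys_below_def)
next
  fix p :: "'a poly" assume "p \<in> (\<lambda>(c,p). pCons c p) ` (UNIV \<times> polys_below n)"
  then show "p \<in> polys_below (Suc n)"
    by (auto simp: polys_below_def coeff_pCons split: nat.splits)
qed

lemma finite_card_polys_below:
  "finite (polys_below n :: 'a::{zero,finite} poly set)"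
  "card (polys_below n :: 'a poly set) = CARD('a) ^ n"
proof (induction n)
  case 0
  { case 1 show ?case by simp next case 2 show ?case by simp }
next
  case (Suc n)
  have inj: "inj_on (\<lambda>(c,p). pCons c p) (UNIV \<times> polys_below n :: ('a \<times> 'a poly) set)"
    by (auto simp: inj_on_def)
  { case 1 show ?case using Suc by (simp add: polys_below_Suc) }
  { case 2 show ?case using Suc by (simp add: polys_below_Suc card_image[OF inj] card_cartesian_product) }
qed

lemmas finite_polys_below [simp] = finite_card_polys_below(1)
  and card_polys_below = finite_card_polys_below(2)

lemma polys_below_add: "p \<in> polys_below n \<Longrightarrow> p' \<in> polys_below n \<Longrightarrow> p + p' \<in> polys_below n"
  and polys_below_diff: "r \<in> polys_below n \<Longrightarrow> r' \<in> polys_below n \<Longrightarrow> r - r' \<in> polys_below n"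
  and polys_below_uminus: "r \<in> polys_below n \<Longrightarrow> - r \<in> polys_below n"
  for p p' :: "'a::comm_monoid_add poly" and r r' :: "'b::ab_group_add poly"
  by (auto simp: polys_below_def)

lemma monic_polys_eq: "monic_polys m = (\<lambda>p. monom 1 m + p) ` polys_below m"
proof (intro equalityI subsetI)
  fix p :: "'a poly" assume p: "p \<in> monic_polys m"
  have "p - monom 1 m \<in> polys_below m"
    using p by (auto simp: polys_below_def monic_polys_def coeff_eq_0 not_less_iff_gr_or_eq)
  then show "p \<in> (\<lambda>p. monom 1 m + p) ` polys_below m"
    by (intro image_eqI[of _ _ "p - monom 1 m"]) auto
next
  fix p :: "'a poly" assume "p \<in> (\<lambda>p. monom 1 m + p) ` polys_below m"
  then obtain r where r: "r \<in> polys_below m" "p = monom 1 m + r" by auto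
  have c: "coeff p m = 1" using r by (auto simp: polys_below_def)
  have "degree p \<le> m" using r
    by (auto intro!: degree_add_le degree_monom_le simp: polys_below_iff)
  moreover have "m \<le> degree p" using c by (simp add: le_degree)
  ultimately show "p \<in> monic_polys m" using c by (auto simp: monic_polys_def)
qed

lemma finite_monic_polys [simp]: "finite (monic_polys m :: 'a::{field,finite} poly set)"
  by (simp add: monic_polys_eq)

lemma card_monic_polys: "card (monic_polys m :: 'a::{field,finite} poly set) = CARD('a) ^ m"
  by (simp add: monic_polys_eq card_image inj_on_def card_polys_below)

lemma monic_polys_nz: "A \<in> monic_polys a \<Longrightarrow> A \<noteq> 0"
  by (auto simp: monic_polys_def)

lemma monic_polys_mult: "A \<in> monic_polys a \<Longrightarrow> B \<in> monic_polys b \<Longrightarrow> A * B \<in> monic_polys (a + b)"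
  using monic_polys_nz[of A a] monic_polys_nz[of B b]
  by (auto simp: monic_polys_def degree_mult_eq lead_coeff_mult)

lemma mod_in_polys_below: "R \<noteq> 0 \<Longrightarrow> a mod R \<in> polys_below (degree R)"
  for R :: "'a::field poly"
  using degree_mod_less[of R a] by (auto simp: polys_below_iff)

lemma mod_polys_below: "a \<in> polys_below (degree R) \<Longrightarrow> a mod R = a"
  for R :: "'a::field poly"
  by (auto simp: polys_below_iff mod_poly_less)

lemma polys_below_cong_eq:
  fixes R :: "'a::field poly"
  assumes "a \<in> polys_below (degree R)" "b \<in> polys_below (degree R)" "R dvd a - b"
  shows "a = b"
  using assms mod_polys_below by (metis mod_eq_dvd_iff)

text \<open>Division with remainder by \<open>R\<close>: the quotient of a monic polynomial of
  degree \<open>m\<close> runs through \<open>monic_polys (m - r)\<close> and, independently, the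
  remainder through all residues.\<close>

lemma sum_monic_polys_periodic:
  fixes f :: "'a::{field,finite} poly \<Rightarrow> complex"
  assumes R: "R \<in> monic_polys r" and "r \<le> m"
    and per: "\<And>a b. f (a + R * b) = f a"
  shows "(\<Sum>M\<in>monic_polys m. f M) = of_nat (CARD('a)) ^ (m - r) * (\<Sum>a\<in>polys_below r. f a)"
proof -
  have dR: "degree R = r" "lead_coeff R = 1" using R by (auto simp: monic_polys_def)
  have R0: "R \<noteq> 0" using R monic_polys_nz by blast
  let ?g = "\<lambda>(A,a). a + R * A"
  have "bij_betw ?g (monic_polys (m - r) \<times> polys_below r) (monic_polys m)"
  proof (rule bij_betwI'; clarify?)
    fix A a B b :: "'a poly" assume h: "A \<in> monic_polys (m - r)" "a \<in> polys_below r" "B \<in> monic_polys (m - r)" "b \<in> polys_below r"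
    show "(a + R * A = b + R * B) = ((A,a) = (B,b))"
    proof
      assume e: "a + R * A = b + R * B"
      have "a - b = R * (B - A)" using e by (simp add: algebra_simps)
      then have "a = b" using polys_below_cong_eq[of a R b] h dR by auto
      then show "(A,a) = (B,b)" using e R0 by simp
    qed auto
  next
    fix A a :: "'a poly" assume h: "A \<in> monic_polys (m - r)" "a \<in> polys_below r"
    have "R * A \<in> monic_polys m" using monic_polys_mult[OF R h(1)] \<open>r \<le> m\<close> by simp
    then obtain p where p: "p \<in> polys_below m" "R * A = monom 1 m + p" by (auto simp: monic_polys_eq)
    have "a \<in> polys_below m" using h \<open>r \<le> m\<close> by (auto simp: polys_below_iff)
    then have "a + p \<in> polys_below m" using p polys_below_add by blast
    then show "a + R * A \<in> monic_polys m"
      unfolding monic_polys_eq p(2) by (intro image_eqI[of _ _ "a+p"]) auto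
  next
    fix M :: "'a poly" assume M: "M \<in> monic_polys m"
    have Mm: "degree M = m" "lead_coeff M = 1" using M by (auto simp: monic_polys_def)
    have 1: "M = M mod R + R * (M div R)" by simp
    have 2: "M mod R \<in> polys_below r" using mod_in_polys_below[OF R0] dR by metis
    have "M div R \<in> monic_polys (m - r)"
    proof (cases "r = 0")
      case True
      then have "R = 1" using R by (auto simp: monic_polys_eq)
      then show ?thesis using M True by simp
    next
      case False
      have "M div R \<noteq> 0" using Mm dR \<open>r \<le> m\<close> R0
        by (metis M div_poly_eq_0_iff linorder_not_le monic_polys_nz)
      have "R * (M div R) = M - M mod R" by (simp add: minus_mod_eq_mult_div)
      moreover have "M - M mod R \<in> monic_polys m"
      proof -
        obtain p where p: "p \<in> polys_below m" "M = monom 1 m + p" using M by (auto simp: monic_polys_eq)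
        have "M mod R \<in> polys_below m" using 2 \<open>r \<le> m\<close> by (auto simp: polys_below_iff)
        then have "p - M mod R \<in> polys_below m" using p polys_below_diff by blast
        moreover have "M - M mod R = monom 1 m + (p - M mod R)" using p by simp
        ultimately show ?thesis unfolding monic_polys_eq by blast
      qed
      ultimately have "R * (M div R) \<in> monic_polys m" by simp
      then show ?thesis using dR R0 \<open>M div R \<noteq> 0\<close>
        by (auto simp: monic_polys_def degree_mult_eq coeff_mult_degree_sum)
    qed
    then show "\<exists>x\<in>monic_polys (m - r) \<times> polys_below r. M = (case x of (A, a) \<Rightarrow> a + R * A)"
      using 1 2 by (intro bexI[of _ "(M div R, M mod R)"]) auto
  qed
  then have "(\<Sum>M\<in>monic_polys m. f M) = (\<Sum>x\<in>monic_polys (m - r) \<times> polys_below r. f (?g x))"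
    by (rule sum.reindex_bij_betw[symmetric])
  also have "\<dots> = (\<Sum>A\<in>monic_polys (m - r). \<Sum>a\<in>polys_below r. f (a + R * A))"
    by (simp add: sum.cartesian_product case_prod_unfold)
  also have "\<dots> = of_nat (CARD('a)) ^ (m - r) * (\<Sum>a\<in>polys_below r. f a)"
    by (simp add: per card_monic_polys)
  finally show ?thesis .
qed

text \<open>A square-free monic polynomial is represented by the set of its monic prime factors.\<close>

definition monic_primes :: "'a::field poly set" where
  "monic_primes = {\<pi>. lead_coeff \<pi> = 1 \<and> irreducible \<pi>}"

definition pdeg :: "'a::field poly set \<Rightarrow> nat" where
  "pdeg S = (\<Sum>\<pi>\<in>S. degree \<pi>)"

definition psets :: "nat \<Rightarrow> 'a::field poly set set" where
  "psets n = {S. finite S \<and> S \<subseteq> monic_primes \<and> pdeg S = n}"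

lemma monic_primes_nz: "\<pi> \<in> monic_primes \<Longrightarrow> \<pi> \<noteq> 0"
  and monic_primes_not_unit: "\<pi> \<in> monic_primes \<Longrightarrow> \<not> is_unit \<pi>"
  by (auto simp: monic_primes_def irreducible_def)

lemma monic_primes_degree: "\<pi> \<in> monic_primes \<Longrightarrow> 0 < degree \<pi>"
  using monic_primes_nz monic_primes_not_unit by (metis gr0I is_unit_iff_degree)

lemma monic_primes_dvd_mult:
  "\<pi> \<in> monic_primes \<Longrightarrow> \<pi> dvd a * b \<longleftrightarrow> \<pi> dvd a \<or> \<pi> dvd b"
  by (auto simp: monic_primes_def dest: field_poly_irreducible_imp_prime prime_elem_dvd_multD)

lemma monic_primes_dvd_power: "\<pi> \<in> monic_primes \<Longrightarrow> \<pi> dvd a ^ k \<Longrightarrow> \<pi> dvd a"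
  by (induction k) (auto simp: monic_primes_dvd_mult dest: monic_primes_not_unit)

lemma monic_primes_dvd_eq:
  assumes "\<pi> \<in> monic_primes" "\<rho> \<in> monic_primes" "\<pi> dvd \<rho>"
  shows "\<pi> = \<rho>"
proof -
  obtain c where c: "\<rho> = \<pi> * c" using assms by auto
  have "is_unit c" using c assms irreducibleD monic_primes_not_unit
    by (metis (no_types, lifting) mem_Collect_eq monic_primes_def)
  then obtain k where k: "c = [:k:]" by (metis is_unit_polyE)
  have "lead_coeff \<rho> = lead_coeff \<pi> * k" using c k by (simp add: lead_coeff_mult)
  then show ?thesis using assms c k by (auto simp: monic_primes_def)
qed

lemma prod_monic_primes:
  assumes "finite S" "S \<subseteq> monic_primes"
  shows "\<Prod>S \<in> monic_polys (pdeg S)"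
  using assms
proof (induction S)
  case (insert p S)
  then have "p \<in> monic_polys (degree p)" by (auto simp: monic_primes_def monic_polys_def)
  then show ?case using insert monic_polys_mult[of p "degree p" "\<Prod>S" "pdeg S"] by (simp add: pdeg_def)
qed (auto simp: pdeg_def monic_polys_def)

lemma prod_psets: "S \<in> psets n \<Longrightarrow> \<Prod>S \<in> monic_polys n"
  using prod_monic_primes by (auto simp: psets_def)

lemma monic_primes_dvd_prod_iff:
  assumes "finite S" "S \<subseteq> monic_primes" "\<pi> \<in> monic_primes"
  shows "\<pi> dvd \<Prod>S \<longleftrightarrow> \<pi> \<in> S"
  using assms
proof (induction S)
  case (insert p S)
  then show ?case by (auto simp: monic_primes_dvd_mult dest: monic_primes_dvd_eq)
qed (auto dest: monic_primes_not_unit)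

text \<open>This plays the role of the Chinese remainder theorem: congruences modulo
  \<open>\<Prod>S\<close> are checked one prime at a time.\<close>

lemma prod_dvd_iff:
  assumes "finite S" "S \<subseteq> monic_primes"
  shows "\<Prod>S dvd x \<longleftrightarrow> (\<forall>\<pi>\<in>S. \<pi> dvd x)"
  using assms
proof (induction S)
  case (insert p S)
  show ?case
  proof
    assume "\<Prod>(insert p S) dvd x"
    then show "\<forall>\<pi>\<in>insert p S. \<pi> dvd x" using insert
      by (metis dvd_prodI dvd_trans finite.insertI)
  next
    assume h: "\<forall>\<pi>\<in>insert p S. \<pi> dvd x"
    then obtain y where y: "x = \<Prod>S * y" using insert by auto
    have "\<not> p dvd \<Prod>S" using insert monic_primes_dvd_prod_iff[of S p] by auto
    then have "p dvd y" using h y monic_primes_dvd_mult[of p "\<Prod>S" y] insert by auto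
    then show "\<Prod>(insert p S) dvd x" using insert y
      by (auto simp: mult.commute intro: mult_dvd_mono)
  qed
qed auto

lemma inj_on_prod_psets: "inj_on (\<lambda>S. \<Prod>S) (psets n)"
proof (rule inj_onI)
  fix S T assume h: "S \<in> psets n" "T \<in> psets n" "\<Prod>S = \<Prod>T"
  then have "\<pi> \<in> S \<longleftrightarrow> \<pi> \<in> T" if "\<pi> \<in> monic_primes" for \<pi>
    using monic_primes_dvd_prod_iff[of S \<pi>] monic_primes_dvd_prod_iff[of T \<pi>] that
    by (auto simp: psets_def)
  then show "S = T" using h by (auto simp: psets_def)
qed

lemma finite_psets [simp]: "finite (psets n :: 'a::{field,finite} poly set set)"
proof -
  have "(\<lambda>S. \<Prod>S) ` psets n \<subseteq> (monic_polys n :: 'a poly set)" using prod_psets by auto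
  then show ?thesis using finite_subset[OF _ finite_monic_polys] finite_imageD[OF _ inj_on_prod_psets] by blast
qed

lemma exists_monic_prime_factor:
  assumes "degree c > 0"
  shows "\<exists>\<pi>\<in>monic_primes. \<pi> dvd (c :: 'a::field poly)"
  using assms
proof (induction "degree c" arbitrary: c rule: less_induct)
  case less
  show ?case
  proof (cases "irreducible c")
    case True
    let ?p = "smult (inverse (lead_coeff c)) c"
    have c0: "lead_coeff c \<noteq> 0" using less by auto
    have u: "?p = [:inverse (lead_coeff c):] * c" by simp
    have "irreducible ?p" unfolding u
      using True c0 by (subst irreducible_mult_unit_left) (auto simp: is_unit_const_poly_iff dvd_field_iff)
    moreover have "lead_coeff ?p = 1" using c0 by simp
    moreover have "?p dvd c" using c0 by (simp add: smult_dvd_iff)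
    ultimately show ?thesis unfolding monic_primes_def by blast
  next
    case False
    have "c \<noteq> 0" using less by auto
    then have c0: "c \<noteq> 0" "\<not> is_unit c" using less by (simp_all add: is_unit_iff_degree)
    then obtain a b where ab: "c = a * b" "\<not> is_unit a" "\<not> is_unit b"
      using False by (auto simp: irreducible_def)
    have "a \<noteq> 0" "b \<noteq> 0" using ab c0 by auto
    then have "degree a < degree c" "0 < degree a"
      using ab by (auto simp: degree_mult_eq is_unit_iff_degree)
    then obtain \<pi> where "\<pi> \<in> monic_primes" "\<pi> dvd a" using less.hyps by blast
    then show ?thesis using ab(1) dvd_mult2 by blast
  qed
qed

lemma monic_polys_dvd_cofactor:
  assumes "A \<in> monic_polys a" "M \<in> monic_polys m" "M = A * c"
  shows "c \<in> monic_polys (m - a) \<and> a \<le> m"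
proof -
  have "A \<noteq> 0" using assms monic_polys_nz by blast
  moreover have "c \<noteq> 0" using assms monic_polys_nz[of M m] by auto
  ultimately show ?thesis using assms by (auto simp: monic_polys_def degree_mult_eq coeff_mult_degree_sum)
qed

lemma monic_degree_0: "A \<in> monic_polys 0 \<Longrightarrow> A = 1"
  by (auto simp: monic_polys_eq)

text \<open>For surjectivity \<open>S\<close> consists of all monic primes dividing
  \<open>N\<close>. The cofactor of \<open>\<Prod>S\<close> is constant, since a prime factor of it
  would divide \<open>N\<close> twice.\<close>

lemma bij_betw_prod_psets:
  "bij_betw (\<lambda>S. \<Prod>S) (psets n) (squarefree_monic_polys n :: 'a::{field,finite} poly set)"
  unfolding bij_betw_def
proof (intro conjI inj_on_prod_psets equalityI subsetI)
  fix N :: "'a poly" assume "N \<in> (\<lambda>S. \<Prod>S) ` psets n"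
  then obtain S where S: "S \<in> psets n" "N = \<Prod>S" by auto
  have Sf: "finite S" "S \<subseteq> monic_primes" using S by (auto simp: psets_def)
  have "squarefree N"
    unfolding squarefree_def
  proof (rule ccontr)
    assume "\<not> (\<forall>x. x\<^sup>2 dvd N \<longrightarrow> is_unit x)"
    then obtain x where x: "x^2 dvd N" "\<not> is_unit x" by auto
    have N0: "N \<noteq> 0" using prod_psets[OF S(1)] S(2) monic_polys_nz by auto
    then have "x \<noteq> 0" using x by auto
    then have "degree x > 0" using x by (auto simp: is_unit_iff_degree)
    then obtain \<pi> where p: "\<pi> \<in> monic_primes" "\<pi> dvd x" using exists_monic_prime_factor by blast
    have pp: "\<pi>^2 dvd N" using p x by (meson dvd_power_same dvd_trans)
    then have "\<pi> dvd N" by (metis dvd_def dvd_trans power2_eq_square)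
    then have pS: "\<pi> \<in> S" using monic_primes_dvd_prod_iff Sf p S by auto
    then have "N = \<pi> * \<Prod>(S - {\<pi>})" using S Sf by (simp add: prod.remove)
    then have "\<pi> dvd \<Prod>(S - {\<pi>})" using pp monic_primes_nz[OF p(1)] by (simp add: power2_eq_square)
    then show False using monic_primes_dvd_prod_iff[of "S - {\<pi>}" \<pi>] Sf p by auto
  qed
  then show "N \<in> squarefree_monic_polys n"
    using S prod_psets by (auto simp: squarefree_monic_polys_def)
next
  fix N :: "'a poly" assume N: "N \<in> squarefree_monic_polys n"
  then have Nm: "N \<in> monic_polys n" "squarefree N" by (auto simp: squarefree_monic_polys_def)
  have N0: "N \<noteq> 0" using Nm monic_polys_nz by auto
  define S where "S = {\<pi>\<in>monic_primes. \<pi> dvd N}"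
  have "S \<subseteq> (\<Union>d\<in>{..n}. monic_polys d)"
    using N0 Nm by (auto simp: S_def monic_primes_def monic_polys_def dest: dvd_imp_degree_le)
  then have Sf: "finite S" by (rule finite_subset) auto
  have Sp: "S \<subseteq> monic_primes" by (auto simp: S_def)
  have "\<Prod>S dvd N" using prod_dvd_iff[OF Sf Sp] by (auto simp: S_def)
  then obtain c where c: "N = \<Prod>S * c" by auto
  have c1: "c \<in> monic_polys (n - pdeg S)" using monic_polys_dvd_cofactor[OF prod_monic_primes[OF Sf Sp] Nm(1) c] by blast
  have "degree c = 0"
  proof (rule ccontr)
    assume "degree c \<noteq> 0"
    then obtain \<pi> where p: "\<pi> \<in> monic_primes" "\<pi> dvd c" using exists_monic_prime_factor by blast
    then have "\<pi> dvd N" using c by (metis dvd_mult)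
    then have "\<pi> \<in> S" using p by (simp add: S_def)
    then have "\<pi> dvd \<Prod>S" using Sf by blast
    then have "\<pi>^2 dvd N" using p c by (simp add: power2_eq_square mult_dvd_mono)
    then show False using Nm p monic_primes_not_unit by (auto simp: squarefree_def)
  qed
  then have "c = 1" using c1 by (auto intro!: monic_degree_0 simp: monic_polys_def)
  then have "N = \<Prod>S" using c by simp
  moreover have "pdeg S = n" using prod_monic_primes[OF Sf Sp] Nm calculation by (auto simp: monic_polys_def)
  ultimately show "N \<in> (\<lambda>S. \<Prod>S) ` psets n" using Sf Sp by (auto simp: psets_def)
qed

section \<open>Extraction of squares and cubes\<close>

text \<open>Take \<open>A\<close> of greatest degree among the monic polynomials whose
  \<open>k\<close>-th power divides \<open>M\<close>: a non-unit \<open>x\<close> with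
  \<open>x ^ k dvd c\<close> would have a monic prime factor that could be multiplied into
  \<open>A\<close>.\<close>

lemma monic_maximal_power_divisor:
  fixes M :: "'a::field poly"
  assumes M: "M \<in> monic_polys m" and "k > 0"
  shows "\<exists>a A c. A \<in> monic_polys a \<and> c \<in> monic_polys (m - k * a) \<and> k * a \<le> m \<and> M = A ^ k * c \<and>
           (\<forall>x. x ^ k dvd c \<longrightarrow> is_unit x)"
proof -
  define P where "P a = (\<exists>A. A \<in> monic_polys a \<and> A ^ k dvd M)" for a
  have pow: "A ^ j \<in> monic_polys (j * a)" if "A \<in> monic_polys a" for A :: "'a poly" and a j
  proof (induction j)
    case (Suc j)
    then show ?case using monic_polys_mult[OF that Suc] by simp
  qed (simp add: monic_polys_def)
  have bd: "k * a \<le> m" if Pa: "P a" for a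
  proof -
    obtain A c where "A \<in> monic_polys a" "M = A ^ k * c" using Pa unfolding P_def dvd_def by blast
    then show ?thesis using monic_polys_dvd_cofactor[OF pow M] by blast
  qed
  have "P 0" unfolding P_def by (rule exI[of _ 1]) (auto simp: monic_polys_def)
  moreover have le_m: "a \<le> m" if "P a" for a
  proof -
    have "a \<le> k * a" using \<open>k > 0\<close> by (cases k) auto
    then show ?thesis using bd[OF that] by (rule le_trans)
  qed
  ultimately obtain a where a: "P a" "\<And>b. P b \<Longrightarrow> b \<le> a"
    using GreatestI_nat[of P 0 m] Greatest_le_nat[of P _ m] by metis
  then obtain A where A: "A \<in> monic_polys a" "A ^ k dvd M" by (auto simp: P_def)
  then obtain c where c: "M = A ^ k * c" by auto
  have c1: "c \<in> monic_polys (m - k * a)" "k * a \<le> m"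
    using monic_polys_dvd_cofactor[OF pow[OF A(1)] M c] by auto
  have "is_unit x" if x: "x ^ k dvd c" for x
  proof (rule ccontr)
    assume nu: "\<not> is_unit x"
    have "c \<noteq> 0" using c1 monic_polys_nz by blast
    then have "x \<noteq> 0" using x \<open>k > 0\<close> by (auto simp: zero_power)
    then have "degree x > 0" using nu by (auto simp: is_unit_iff_degree)
    then obtain \<pi> where p: "\<pi> \<in> monic_primes" "\<pi> dvd x" using exists_monic_prime_factor by blast
    have "\<pi> ^ k dvd c" using p x by (meson dvd_power_same dvd_trans)
    then have "(A * \<pi>) ^ k dvd M" using c by (simp add: power_mult_distrib)
    moreover have "\<pi> \<in> monic_polys (degree \<pi>)" using p by (auto simp: monic_primes_def monic_polys_def)
    ultimately have "P (a + degree \<pi>)" using A monic_polys_mult unfolding P_def by blast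
    then show False using a(2)[of "a + degree \<pi>"] monic_primes_degree[OF p(1)] by simp
  qed
  then show ?thesis using A c c1 by blast
qed

text \<open>Cubes are taken out before squares. The rest \<open>M'\<close> is then cube-free, and
  this makes \<open>B\<close> square-free: \<open>x^2 dvd B\<close> would give
  \<open>x^4 dvd B^2\<close> and so \<open>x^3 dvd M'\<close>.\<close>

lemma cube_decomposition:
  assumes M: "M \<in> monic_polys k"
  shows "\<exists>a b c A B T. a + 2 * b + 3 * c = k \<and> A \<in> squarefree_monic_polys a \<and>
     B \<in> squarefree_monic_polys b \<and> T \<in> monic_polys c \<and> M = A * B ^ 2 * T ^ 3"
proof -
  obtain c T M' where T: "T \<in> monic_polys c" "M' \<in> monic_polys (k - 3 * c)" "3 * c \<le> k" "M = T ^ 3 * M'"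
     "\<And>x. x ^ 3 dvd M' \<Longrightarrow> is_unit x"
    using monic_maximal_power_divisor[OF M, of 3] by auto
  obtain b B A where B: "B \<in> monic_polys b" "A \<in> monic_polys (k - 3 * c - 2 * b)" "2 * b \<le> k - 3 * c" "M' = B ^ 2 * A"
     "\<And>x. x ^ 2 dvd A \<Longrightarrow> is_unit x"
    using monic_maximal_power_divisor[OF T(2), of 2] by auto
  have "squarefree A" using B by (auto simp: squarefree_def)
  moreover have "squarefree B" unfolding squarefree_def
  proof (intro allI impI)
    fix x assume "x\<^sup>2 dvd B"
    then have "(x\<^sup>2)\<^sup>2 dvd B\<^sup>2" by (rule dvd_power_same)
    moreover have "(x\<^sup>2)\<^sup>2 = x ^ 3 * x" by (simp add: power2_eq_square power3_eq_cube ac_simps)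
    ultimately have "x ^ 3 dvd M'" using B(4) by (metis dvd_mult2 dvd_mult_left)
    then show "is_unit x" using T by blast
  qed
  ultimately show ?thesis
    using T(1,3,4) B(1-4) by (intro exI[of _ "k - 3 * c - 2 * b"] exI[of _ b] exI[of _ c] exI[of _ A] exI[of _ B] exI[of _ T])
      (simp add: squarefree_monic_polys_def ac_simps)
qed

section \<open>The residue symbol\<close>

lemma card_field_ge_2: "2 \<le> CARD('a::{field,finite})"
  using card_mono[of UNIV "{0, 1 :: 'a}"] by simp

text \<open>Fermat's argument: multiplication by \<open>z\<close> permutes \<open>L - {0}\<close>,
  so it leaves the product of these elements unchanged. It is applied to the field itself and to the
  finite range of an evaluation map.\<close>

lemma finite_mult_closed_pow_card:
  fixes L :: "'b::idom set"
  assumes "finite L" and closed: "\<And>x y. x \<in> L \<Longrightarrow> y \<in> L \<Longrightarrow> x * y \<in> L" and "z \<in> L" "z \<noteq> 0"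
  shows "z ^ card (L - {0}) = 1"
proof -
  have inj: "inj_on ((*) z) (L - {0})" using \<open>z \<noteq> 0\<close> by (auto simp: inj_on_def)
  have "(*) z ` (L - {0}) = L - {0}"
    using assms by (intro card_subset_eq card_image inj) auto
  then have "(\<Prod>x\<in>L - {0}. x) = (\<Prod>x\<in>L - {0}. z * x)"
    by (metis inj prod.reindex_cong)
  also have "\<dots> = z ^ card (L - {0}) * (\<Prod>x\<in>L - {0}. x)" by (simp add: prod.distrib)
  finally show ?thesis using \<open>finite L\<close> by simp
qed

lemma finite_card_roots_of_unity:
  assumes "n > 0"
  shows "finite {x :: 'b::idom. x ^ n = 1}" "card {x :: 'b. x ^ n = 1} \<le> n"
proof -
  define P :: "'b poly" where "P = monom 1 n - 1"
  have "coeff P n = 1" using assms by (simp add: P_def)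
  then have P0: "P \<noteq> 0" by auto
  have e: "{x. x ^ n = 1} = {x. poly P x = 0}" by (auto simp: P_def poly_monom)
  have "degree P \<le> n" unfolding P_def by (intro degree_diff_le degree_monom_le) simp
  then show "finite {x :: 'b. x ^ n = 1}" "card {x :: 'b. x ^ n = 1} \<le> n"
    unfolding e using poly_roots_finite[OF P0] card_poly_roots_bound[OF P0] by auto
qed

lemma finite_field_pow_card: "x ^ CARD('a) = (x :: 'a::{field,finite})"
proof (cases "x = 0")
  case False
  have "x ^ card (UNIV - {0 :: 'a}) = 1"
    by (rule finite_mult_closed_pow_card) (use False in auto)
  then have "x ^ (CARD('a) - 1) = 1" by (simp add: card_Diff_singleton)
  then show ?thesis by (metis One_nat_def Suc_pred mult.right_neutral power_Suc zero_less_card_finite)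
qed (simp add: zero_power)

lemma finite_field_pow_card_power: "x ^ (CARD('a) ^ i) = (x :: 'a::{field,finite})"
  by (induction i) (simp_all add: power_mult finite_field_pow_card)

text \<open>\<open>(t + 1)\<^sup>q - t\<^sup>q - 1\<close> has degree less than \<open>q\<close> and vanishes on the whole field.\<close>

lemma finite_field_binomial_eq_0:
  assumes "0 < i" "i < CARD('a::{field,finite})"
  shows "of_nat (CARD('a) choose i) = (0 :: 'a)"
proof -
  let ?q = "CARD('a)"
  define D :: "'a poly" where "D = [:1, 1:] ^ ?q - monom 1 ?q - 1"
  have lc: "coeff ([:1, 1:] ^ ?q) ?q = (1::'a)"
    using lead_coeff_power[of "[:1, 1::'a:]" ?q] by (simp add: degree_power_eq)
  have q1: "0 < ?q" by simp
  have "degree D < ?q \<or> D = 0"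
  proof -
    have "coeff D j = 0" if "j \<ge> ?q" for j
    proof (cases "j = ?q")
      case True
      then show ?thesis using lc q1 by (simp add: D_def)
    next
      case False
      then show ?thesis using that by (simp add: D_def coeff_eq_0 degree_power_eq)
    qed
    then show ?thesis using polys_below_iff[of D ?q] by (auto simp: polys_below_def)
  qed
  moreover have "D = 0" if "degree D < ?q"
  proof (rule ccontr)
    assume "D \<noteq> 0"
    have "poly D x = 0" for x
      using finite_field_pow_card[of x] finite_field_pow_card[of "1 + x"]
      by (simp add: D_def poly_monom)
    then have "{x. poly D x = 0} = UNIV" by auto
    then show False using card_poly_roots_bound[OF \<open>D \<noteq> 0\<close>] that by simp
  qed
  ultimately have "D = 0" by blast
  then have "coeff ([:1, 1:] ^ ?q) i = (0 :: 'a)"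
  proof -
    have "coeff D i = 0" using \<open>D = 0\<close> by simp
    then show ?thesis using assms by (simp add: D_def)
  qed
  moreover have "coeff ([:1, 1:] ^ ?q) i = (of_nat (?q choose i) :: 'a)"
    using assms by (simp add: coeff_linear_poly_power)
  ultimately show ?thesis by simp
qed

text \<open>The inner binomial coefficients vanish in the base field, hence in its closure. This
  treats the exponent \<open>CARD('a)\<close> directly, without writing it as a power of the
  characteristic.\<close>

lemma frobenius_add:
  fixes x y :: "'a::{field,finite} alg_closure"
  shows "(x + y) ^ CARD('a) = x ^ CARD('a) + y ^ CARD('a)"
proof -
  let ?q = "CARD('a)"
  have z: "of_nat (?q choose k) = (0 :: 'a alg_closure)" if "0 < k" "k < ?q" for k
    using finite_field_binomial_eq_0[OF that] by (metis to_ac_0 to_ac_of_nat)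
  have "(x + y) ^ ?q = (\<Sum>k\<le>?q. of_nat (?q choose k) * x ^ k * y ^ (?q - k))"
    by (rule binomial_ring)
  also have "\<dots> = (\<Sum>k\<in>{0, ?q}. of_nat (?q choose k) * x ^ k * y ^ (?q - k))"
    by (intro sum.mono_neutral_right) (auto simp: z)
  finally show ?thesis by simp
qed

section \<open>Residue fields inside the algebraic closure\<close>

text \<open>At a root \<open>z\<close> of a monic prime \<open>\<pi>\<close> this is reduction
  modulo \<open>\<pi>\<close>: the range is a copy of the residue field. Residues modulo different
  primes thus live in one field, as the proof of reciprocity requires.\<close>

definition ev :: "'a::field alg_closure \<Rightarrow> 'a poly \<Rightarrow> 'a alg_closure" where
  "ev z f = poly (map_poly to_ac f) z"

lemma ev_0 [simp]: "ev z 0 = 0"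
  and ev_pCons [simp]: "ev z (pCons c p) = to_ac c + z * ev z p"
  by (simp_all add: ev_def map_poly_pCons)

lemma ev_1 [simp]: "ev z 1 = 1"
  by (simp add: one_pCons)

lemma ev_add [simp]: "ev z (p + r) = ev z p + ev z r"
  by (induction p r rule: poly_induct2) (simp_all add: algebra_simps)

lemma ev_smult [simp]: "ev z (smult c p) = to_ac c * ev z p"
  by (induction p) (simp_all add: algebra_simps)

lemma ev_mult [simp]: "ev z (p * r) = ev z p * ev z r"
  by (induction p) (simp_all add: algebra_simps)

lemma ev_uminus [simp]: "ev z (- p) = - ev z p"
  by (induction p) simp_all

lemma ev_diff [simp]: "ev z (p - r) = ev z p - ev z r"
  using ev_add[of z p "- r"] by simp

lemma ev_power [simp]: "ev z (p ^ n) = ev z p ^ n"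
  by (induction n) simp_all

lemma ev_frobenius: "ev z f ^ CARD('a) = ev (z ^ CARD('a)) f"
  for z :: "'a::{field,finite} alg_closure"
proof (induction f)
  case (pCons c f)
  have "to_ac c ^ CARD('a) = to_ac c" by (metis finite_field_pow_card to_ac_power)
  then show ?case using pCons by (simp add: frobenius_add power_mult_distrib)
qed (simp add: zero_power)

lemma ev_frobenius_power: "ev z f ^ (CARD('a) ^ i) = ev (z ^ (CARD('a) ^ i)) f"
  for z :: "'a::{field,finite} alg_closure"
  by (induction i) (simp_all add: power_mult ev_frobenius mult.commute[of "CARD('a)"])

lemma degree_map_poly_to_ac [simp]: "degree (map_poly to_ac f) = degree f"
  by (rule degree_map_poly) simp

lemma exists_root_in_closure:
  assumes "\<pi> \<in> monic_primes"
  shows "\<exists>z. ev z \<pi> = 0"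
  using alg_closed_imp_poly_has_root[of "map_poly to_ac \<pi>"] monic_primes_degree[OF assms]
  unfolding ev_def by simp

text \<open>A polynomial \<open>g\<close> of least degree vanishing at \<open>z\<close> divides
  every polynomial vanishing there. It divides the irreducible \<open>\<pi>\<close> and is no unit,
  so it is \<open>\<pi>\<close> up to a constant.\<close>

lemma ev_eq_0_iff:
  assumes p: "\<pi> \<in> monic_primes" and z: "ev z \<pi> = 0"
  shows "ev z f = 0 \<longleftrightarrow> \<pi> dvd f"
proof
  assume f: "ev z f = 0"
  define g where "g = (ARG_MIN degree g. g \<noteq> 0 \<and> ev z g = 0)"
  have g: "g \<noteq> 0 \<and> ev z g = 0" "\<And>h. h \<noteq> 0 \<and> ev z h = 0 \<Longrightarrow> degree g \<le> degree h"
    using arg_min_natI[of "\<lambda>g. g \<noteq> 0 \<and> ev z g = 0" \<pi> degree]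
      arg_min_nat_le[of "\<lambda>g. g \<noteq> 0 \<and> ev z g = 0" _ degree] z monic_primes_nz[OF p]
    unfolding g_def by blast+
  have dvd: "g dvd h" if "ev z h = 0" for h
  proof (rule ccontr)
    assume "\<not> g dvd h"
    then have m: "h mod g \<noteq> 0" by (simp add: dvd_eq_mod_eq_0)
    have "h mod g = h - g * (h div g)" by (simp add: minus_mult_div_eq_mod)
    then have "ev z (h mod g) = 0" using that g by simp
    then have "degree g \<le> degree (h mod g)" using g(2) m by blast
    then show False using degree_mod_less[of g h] g(1) m by auto
  qed
  obtain c where c: "\<pi> = g * c" using dvd[OF z] by auto
  have "\<not> is_unit g"
  proof
    assume "is_unit g"
    then obtain k where "g = [:k:]" "k \<noteq> 0" by (metis g(1) is_unit_polyE pCons_eq_0_iff)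
    then show False using g by simp
  qed
  then have "is_unit c" using c p by (auto simp: monic_primes_def dest: irreducibleD)
  then have "\<pi> dvd g" using c by (metis dvd_refl mult_unit_dvd_iff)
  then show "\<pi> dvd f" using dvd[OF f] by (rule dvd_trans)
qed (use z in auto)

lemma inj_on_ev:
  assumes p: "\<pi> \<in> monic_primes" and z: "ev z \<pi> = 0"
  shows "inj_on (ev z) (polys_below (degree \<pi>))"
proof (rule inj_onI)
  fix a b assume h: "a \<in> polys_below (degree \<pi>)" "b \<in> polys_below (degree \<pi>)" "ev z a = ev z b"
  then have "\<pi> dvd a - b" using ev_eq_0_iff[OF p z, of "a - b"] by simp
  then show "a = b" using polys_below_cong_eq h by blast
qed

lemma range_ev:
  assumes p: "\<pi> \<in> monic_primes" and z: "ev z \<pi> = 0"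
  shows "range (ev z) = ev z ` polys_below (degree \<pi>)"
proof -
  have "ev z f = ev z (f mod \<pi>)" for f
  proof -
    have "ev z f = ev z (\<pi> * (f div \<pi>) + f mod \<pi>)" by simp
    also have "\<dots> = ev z \<pi> * ev z (f div \<pi>) + ev z (f mod \<pi>)" by (simp only: ev_add ev_mult)
    finally show ?thesis using z by simp
  qed
  then show ?thesis using mod_in_polys_below[OF monic_primes_nz[OF p]] by (auto simp: image_iff)
qed

lemma finite_card_range_ev:
  fixes \<pi> :: "'a::{field,finite} poly"
  assumes p: "\<pi> \<in> monic_primes" and z: "ev z \<pi> = 0"
  shows "finite (range (ev z))" "card (range (ev z)) = CARD('a) ^ degree \<pi>"
  by (simp_all add: range_ev[OF assms] card_image[OF inj_on_ev[OF assms]] card_polys_below)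

lemma ev_pow_card_minus_1:
  fixes \<pi> :: "'a::{field,finite} poly"
  assumes p: "\<pi> \<in> monic_primes" and z: "ev z \<pi> = 0" and "ev z f \<noteq> 0"
  shows "ev z f ^ (CARD('a) ^ degree \<pi> - 1) = 1"
proof -
  have "ev z f ^ card (range (ev z) - {0}) = 1"
  proof (rule finite_mult_closed_pow_card)
    fix x y assume "x \<in> range (ev z)" "y \<in> range (ev z)"
    then obtain a b where "x = ev z a" "y = ev z b" by blast
    then have "x * y = ev z (a * b)" by simp
    then show "x * y \<in> range (ev z)" by blast
  qed (use finite_card_range_ev[OF p z] assms in auto)
  moreover have "0 \<in> range (ev z)" by (rule range_eqI[of _ _ 0]) simp
  ultimately show ?thesis by (simp add: card_Diff_singleton finite_card_range_ev[OF p z])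
qed

lemma root_frobenius_fixed:
  fixes \<pi> :: "'a::{field,finite} poly"
  assumes p: "\<pi> \<in> monic_primes" and z: "ev z \<pi> = 0"
  shows "z ^ (CARD('a) ^ degree \<pi>) = z"
proof (cases "z = 0")
  case False
  have e: "ev z [:0, 1:] = z" by simp
  have "z ^ (CARD('a) ^ degree \<pi> - 1) = 1"
    using ev_pow_card_minus_1[OF p z, of "[:0, 1:]"] False unfolding e by simp
  then show ?thesis by (metis power_eq_if False mult.right_neutral not_less_zero power_0 power_strict_mono zero_less_card_finite zero_less_power less_numeral_extra(3))
qed (simp add: zero_power)

text \<open>If the \<open>q^k\<close>-power fixed \<open>z\<close>, it would fix every value
  \<open>ev z f\<close>. These are \<open>q ^ degree \<pi>\<close> elements, too many for the roots
  of \<open>x^(q^k) - x\<close>.\<close>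

lemma root_frobenius_not_fixed:
  fixes \<pi> :: "'a::{field,finite} poly"
  assumes p: "\<pi> \<in> monic_primes" and z: "ev z \<pi> = 0" and k: "0 < k" "k < degree \<pi>"
  shows "z ^ (CARD('a) ^ k) \<noteq> z"
proof
  assume e: "z ^ (CARD('a) ^ k) = z"
  let ?q = "CARD('a)"
  have q2: "1 < ?q" using card_field_ge_2[where 'a='a] by simp
  define P :: "'a alg_closure poly" where "P = monom 1 (?q ^ k) - monom 1 1"
  have qk: "1 < ?q ^ k" by (rule one_less_power[OF q2 k(1)])
  have "coeff P (?q ^ k) = 1" using qk by (simp add: P_def)
  then have P0: "P \<noteq> 0" by auto
  have "degree P \<le> ?q ^ k" unfolding P_def using qk
    by (intro degree_diff_le) (auto intro: order_trans[OF degree_monom_le])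
  moreover have "range (ev z) \<subseteq> {x. poly P x = 0}"
  proof clarify
    fix f show "poly P (ev z f) = 0"
      using ev_frobenius_power[of z f k] e by (simp add: P_def poly_monom)
  qed
  then have "?q ^ degree \<pi> \<le> card {x. poly P x = 0}"
    using card_mono[OF poly_roots_finite[OF P0]] finite_card_range_ev[OF p z] by metis
  ultimately have "?q ^ degree \<pi> \<le> ?q ^ k" using card_poly_roots_bound[OF P0] by linarith
  then show False using q2 k power_strict_increasing[of k "degree \<pi>" ?q] by simp
qed

text \<open>An equality for \<open>i < j\<close>, raised to the power
  \<open>q ^ (degree \<pi> - i)\<close>, becomes \<open>z = z^(q^(j - i))\<close>, because the power
  \<open>q ^ degree \<pi>\<close> fixes \<open>z\<close>.\<close>

lemma root_conjugates_distinct: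
  fixes \<pi> :: "'a::{field,finite} poly"
  assumes p: "\<pi> \<in> monic_primes" and z: "ev z \<pi> = 0"
  shows "inj_on (\<lambda>i. z ^ (CARD('a) ^ i)) {..<degree \<pi>}"
proof (rule linorder_inj_onI)
  fix i j assume h: "i < j" "i \<in> {..<degree \<pi>}" "j \<in> {..<degree \<pi>}"
  let ?q = "CARD('a)" and ?d = "degree \<pi>"
  show "z ^ (?q ^ i) \<noteq> z ^ (?q ^ j)"
  proof
    assume "z ^ (?q ^ i) = z ^ (?q ^ j)"
    then have "(z ^ (?q ^ i)) ^ (?q ^ (?d - i)) = (z ^ (?q ^ j)) ^ (?q ^ (?d - i))" by simp
    moreover have "?q ^ i * ?q ^ (?d - i) = ?q ^ ?d" using h by (simp flip: power_add)
    moreover have "?q ^ j * ?q ^ (?d - i) = ?q ^ ?d * ?q ^ (j - i)"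
    proof -
      have "j + (?d - i) = ?d + (j - i)" using h by auto
      then show ?thesis by (metis power_add)
    qed
    ultimately have "z = z ^ (?q ^ (j - i))"
      using root_frobenius_fixed[OF p z] by (simp flip: power_mult) (simp add: power_mult)
    moreover have "0 < j - i" "j - i < ?d" using h by auto
    ultimately show False using root_frobenius_not_fixed[OF p z, of "j - i"] by metis
  qed
qed auto

text \<open>As polynomials in \<open>x\<close> both sides are monic of degree
  \<open>degree \<pi>\<close> and vanish at the \<open>degree \<pi>\<close> distinct conjugates of
  \<open>z\<close>; their difference has lower degree and as many roots, so it is zero.\<close>

lemma ev_monic_prime_eq_prod:
  fixes \<pi> :: "'a::{field,finite} poly"
  assumes p: "\<pi> \<in> monic_primes" and z: "ev z \<pi> = 0"
  shows "ev x \<pi> = (\<Prod>i<degree \<pi>. x - z ^ (CARD('a) ^ i))"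
proof -
  let ?q = "CARD('a)" and ?d = "degree \<pi>" and ?P = "map_poly to_ac \<pi>"
  define Q where "Q = (\<Prod>i<?d. [:- (z ^ (?q ^ i)), 1:])"
  have dQ: "degree Q = ?d" by (simp add: Q_def degree_prod_sum_eq)
  have lQ: "lead_coeff Q = 1" unfolding Q_def lead_coeff_prod by simp
  have cP: "coeff ?P ?d = 1" using p by (simp add: coeff_map_poly monic_primes_def)
  have "?P - Q = 0"
  proof (rule ccontr)
    assume nz: "?P - Q \<noteq> 0"
    have "coeff (?P - Q) j = 0" if "j \<ge> ?d" for j
      using that cP dQ lQ by (cases "j = ?d") (auto simp: coeff_eq_0)
    then have "degree (?P - Q) < ?d"
      using nz polys_below_iff[of "?P - Q" ?d] by (auto simp: polys_below_def)
    moreover have "(\<lambda>i. z ^ (?q ^ i)) ` {..<?d} \<subseteq> {x. poly (?P - Q) x = 0}"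
    proof clarify
      fix i assume "i < ?d"
      then have "poly Q (z ^ (?q ^ i)) = 0" by (auto simp: Q_def poly_prod intro!: bexI[of _ i])
      moreover have "poly ?P (z ^ (?q ^ i)) = 0"
        using ev_frobenius_power[of z \<pi> i] z by (simp add: ev_def zero_power)
      ultimately show "poly (?P - Q) (z ^ (?q ^ i)) = 0" by simp
    qed
    then have "card ((\<lambda>i. z ^ (?q ^ i)) ` {..<?d}) \<le> card {x. poly (?P - Q) x = 0}"
      by (rule card_mono[OF poly_roots_finite[OF nz]])
    then have "?d \<le> card {x. poly (?P - Q) x = 0}"
      unfolding card_image[OF root_conjugates_distinct[OF p z]] by simp
    ultimately show False using card_poly_roots_bound[OF nz] by linarith
  qed
  then show ?thesis by (simp add: ev_def Q_def poly_prod)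
qed

text \<open>All that the sieve uses about \<open>\<chi> \<pi> a = (a / \<pi>)\<^sub>l\<close>. Bounds proved for every symbol system are
  uniform in \<open>\<Omega>\<close>.\<close>

definition symbol_system :: "('a::{field,finite} poly \<Rightarrow> 'a poly \<Rightarrow> complex) \<Rightarrow> bool" where
  "symbol_system \<chi> \<longleftrightarrow>
     (\<forall>\<pi>\<in>monic_primes. \<forall>a b. \<chi> \<pi> (a * b) = \<chi> \<pi> a * \<chi> \<pi> b) \<and>
     (\<forall>\<pi>\<in>monic_primes. \<forall>a b. \<chi> \<pi> (a + \<pi> * b) = \<chi> \<pi> a) \<and>
     (\<forall>\<pi>\<in>monic_primes. \<forall>a. cmod (\<chi> \<pi> a) = (if \<pi> dvd a then 0 else 1)) \<and>
     (\<forall>\<pi>\<in>monic_primes. \<forall>\<rho>\<in>monic_primes. \<chi> \<pi> \<rho> = \<chi> \<rho> \<pi>) \<and>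
     (\<exists>w. (\<forall>c. c \<noteq> 0 \<longrightarrow> cmod (w c) = 1) \<and> w (-1) = 1 \<and>
        (\<forall>\<pi>\<in>monic_primes. \<forall>c. c \<noteq> 0 \<longrightarrow> \<chi> \<pi> [:c:] = w c ^ degree \<pi>)) \<and>
     (\<forall>\<pi>\<in>monic_primes. \<exists>u. \<not> \<pi> dvd u \<and> \<chi> \<pi> u ^ 2 \<noteq> 1)"

section \<open>The residue symbol is a symbol system\<close>

lemma geometric_sum_nat: "(q - 1) * (\<Sum>i<d. q ^ i) = q ^ d - (1::nat)"
proof (cases "q = 0")
  case False
  then show ?thesis
  proof (induction d)
    case (Suc d)
    have "q ^ d \<ge> 1" using Suc by (simp add: Suc_leI)
    then show ?case using Suc by (simp add: algebra_simps)
  qed simp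
qed (cases d; simp add: sum.lessThan_Suc_shift)

context
  fixes l s :: nat and \<Omega> :: "'a::{field,finite} \<Rightarrow> complex"
  assumes l3: "l \<ge> 3" and ql: "[CARD('a) = 1] (mod 2 * l)" and iso: "unity_roots_iso l \<Omega>"
    and s_def: "s = (CARD('a) - 1) div l"
begin

private abbreviation "symb \<equiv> prime_residue_symbol l \<Omega>"

text \<open>Evenness of \<open>s\<close> is what the factor \<open>2\<close> in the congruence for
  \<open>q\<close> provides. It gives \<open>(-1)^s = 1\<close>, so that the symbol of
  \<open>-1\<close> is \<open>1\<close> and reciprocity carries no sign.\<close>

lemma card_field_minus_1: "CARD('a) - 1 = l * s" "even s"
proof -
  have "2 * l dvd CARD('a) - 1"
    using ql by (metis Suc_leI cong_to_1_nat One_nat_def zero_less_card_finite cong_altdef_nat)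
  then obtain k where k: "CARD('a) - 1 = 2 * l * k" by auto
  then show "CARD('a) - 1 = l * s" "even s" using l3 by (auto simp: s_def)
qed

text \<open>The power \<open>\<Sum>i<d. q ^ i\<close> is the norm from the residue field of degree
  \<open>d\<close> to the base field; the symbol is therefore read off from the \<open>s\<close>-th
  power of a norm.\<close>

lemma symbol_exponent: "(CARD('a) ^ d - 1) div l = s * (\<Sum>i<d. CARD('a) ^ i)"
    "CARD('a) ^ d - 1 = l * (s * (\<Sum>i<d. CARD('a) ^ i))"
    "(CARD('a) ^ d - 1) div l * l = CARD('a) ^ d - 1"
proof -
  show e: "CARD('a) ^ d - 1 = l * (s * (\<Sum>i<d. CARD('a) ^ i))"
    using geometric_sum_nat[of "CARD('a)" d] card_field_minus_1(1) by (simp only: mult.assoc)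
  show "(CARD('a) ^ d - 1) div l = s * (\<Sum>i<d. CARD('a) ^ i)"
    unfolding e using l3 by simp
  show "(CARD('a) ^ d - 1) div l * l = CARD('a) ^ d - 1"
    unfolding e by simp
qed

lemma Omega_bij: "bij_betw \<Omega> (unity_roots l) (unity_roots l)"
  and Omega_mult: "x \<in> unity_roots l \<Longrightarrow> y \<in> unity_roots l \<Longrightarrow> \<Omega> (x * y) = \<Omega> x * \<Omega> y"
  using iso by (auto simp: unity_roots_iso_def)

lemma one_in_unity_roots: "1 \<in> unity_roots l"
  by (simp add: unity_roots_def)

lemma Omega_1: "\<Omega> 1 = 1"
proof -
  have "\<Omega> 1 = \<Omega> 1 * \<Omega> 1" using Omega_mult[of 1 1] by (simp add: unity_roots_def)
  moreover have "\<Omega> 1 ^ l = 1"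
    using Omega_bij one_in_unity_roots by (auto simp: bij_betw_def unity_roots_def)
  then have "\<Omega> 1 \<noteq> 0" using l3 by (auto simp: zero_power)
  ultimately show ?thesis by simp
qed

lemma unity_roots_power: "x \<in> unity_roots l \<Longrightarrow> x ^ n \<in> unity_roots l"
  for x :: "'b::field"
  by (simp add: unity_roots_def flip: power_mult) (simp add: power_mult mult.commute[of n])

lemma Omega_power: "x \<in> unity_roots l \<Longrightarrow> \<Omega> (x ^ n) = \<Omega> x ^ n"
  by (induction n) (simp_all add: Omega_1 Omega_mult unity_roots_power)

lemma Omega_norm: "x \<in> unity_roots l \<Longrightarrow> cmod (\<Omega> x) = 1"
proof -
  assume "x \<in> unity_roots l"
  then have "\<Omega> x ^ l = 1" using Omega_bij by (auto simp: bij_betw_def unity_roots_def)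
  then show ?thesis using l3 power_eq_1_iff[of "\<Omega> x" l] by simp
qed

text \<open>The bijection \<open>\<Omega>\<close> forces the base field to contain as many
  \<open>l\<close>-th roots of unity as there are complex ones, namely \<open>l\<close>. The closure
  cannot contain more.\<close>

lemma roots_of_unity_in_closure:
  fixes w :: "'a alg_closure"
  assumes "w ^ l = 1"
  shows "\<exists>\<zeta>\<in>unity_roots l. to_ac \<zeta> = w"
proof -
  have c: "card (unity_roots l :: 'a set) = l"
    using bij_betw_same_card[OF Omega_bij] card_roots_unity_eq[of l] l3
    by (simp add: unity_roots_def)
  have "to_ac ` unity_roots l = {w :: 'a alg_closure. w ^ l = 1}"
  proof (rule card_seteq)
    show "finite {w :: 'a alg_closure. w ^ l = 1}" using l3 by (intro finite_card_roots_of_unity) simp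
    show "to_ac ` unity_roots l \<subseteq> {w :: 'a alg_closure. w ^ l = 1}"
      by (auto simp: unity_roots_def simp flip: to_ac_power)
    have inj: "inj_on to_ac (unity_roots l :: 'a set)" by (rule inj_on_subset[OF inj_to_ac subset_UNIV])
    have "card {w :: 'a alg_closure. w ^ l = 1} \<le> l"
      using l3 by (intro finite_card_roots_of_unity) simp
    then show "card {w :: 'a alg_closure. w ^ l = 1} \<le> card (to_ac ` unity_roots l :: 'a alg_closure set)"
      unfolding card_image[OF inj] c .
  qed
  then have "w \<in> to_ac ` unity_roots l" using assms by simp
  then show ?thesis by (auto simp: image_iff)
qed

text \<open>This removes the definite description: at a root of \<open>\<pi>\<close> the defining
  congruence is an equation in the closure, and only one constant satisfies it.\<close>

lemma prime_residue_symbol_eq: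
  assumes p: "\<pi> \<in> monic_primes" and z: "ev z \<pi> = 0" and nd: "\<not> \<pi> dvd a"
    and zt: "\<zeta> \<in> unity_roots l" "to_ac \<zeta> = ev z a ^ ((CARD('a) ^ degree \<pi> - 1) div l)"
  shows "symb a \<pi> = \<Omega> \<zeta>"
proof -
  have cong_iff: "[a ^ ((CARD('a) ^ degree \<pi> - 1) div l) = [:c:]] (mod \<pi>) \<longleftrightarrow> c = \<zeta>" for c
  proof -
    have "[a ^ ((CARD('a) ^ degree \<pi> - 1) div l) = [:c:]] (mod \<pi>) \<longleftrightarrow>
       ev z (a ^ ((CARD('a) ^ degree \<pi> - 1) div l) - [:c:]) = 0"
      unfolding ev_eq_0_iff[OF p z] cong_def mod_eq_dvd_iff ..
    also have "\<dots> \<longleftrightarrow> to_ac c = to_ac \<zeta>" using zt(2) by auto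
    finally show ?thesis by simp
  qed
  have inv: "inv_into (unity_roots l) \<Omega> (\<Omega> x) = x" if "x \<in> unity_roots l" for x
    using Omega_bij that by (auto simp: bij_betw_def)
  have "(THE \<alpha>. \<alpha> \<in> unity_roots l \<and> inv_into (unity_roots l) \<Omega> \<alpha> = \<zeta>) = \<Omega> \<zeta>"
  proof (rule the_equality)
    show "\<Omega> \<zeta> \<in> unity_roots l \<and> inv_into (unity_roots l) \<Omega> (\<Omega> \<zeta>) = \<zeta>"
      using zt(1) inv Omega_bij by (auto simp: bij_betw_def)
  next
    fix \<alpha> assume "\<alpha> \<in> unity_roots l \<and> inv_into (unity_roots l) \<Omega> \<alpha> = \<zeta>"
    then show "\<alpha> = \<Omega> \<zeta>" using Omega_bij by (auto simp: bij_betw_def f_inv_into_f)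
  qed
  then show ?thesis unfolding prime_residue_symbol_def cong_iff using nd by simp
qed

lemma prime_residue_symbol_ex:
  assumes p: "\<pi> \<in> monic_primes" and z: "ev z \<pi> = 0" and nd: "\<not> \<pi> dvd a"
  shows "\<exists>\<zeta>\<in>unity_roots l. to_ac \<zeta> = ev z a ^ ((CARD('a) ^ degree \<pi> - 1) div l) \<and> symb a \<pi> = \<Omega> \<zeta>"
proof -
  have "ev z a \<noteq> 0" using ev_eq_0_iff[OF p z] nd by blast
  then have "(ev z a ^ ((CARD('a) ^ degree \<pi> - 1) div l)) ^ l = 1"
    using ev_pow_card_minus_1[OF p z] by (simp only: power_mult[symmetric] symbol_exponent(3))
  then show ?thesis using roots_of_unity_in_closure prime_residue_symbol_eq[OF assms] by blast
qed

lemma prime_residue_symbol_mult: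
  assumes p: "\<pi> \<in> monic_primes"
  shows "symb (a * b) \<pi> = symb a \<pi> * symb b \<pi>"
proof (cases "\<pi> dvd a \<or> \<pi> dvd b")
  case True
  then show ?thesis using p by (auto simp: prime_residue_symbol_def monic_primes_dvd_mult)
next
  case False
  then have nd: "\<not> \<pi> dvd a * b" using p monic_primes_dvd_mult by blast
  obtain z where z: "ev z \<pi> = 0" using exists_root_in_closure[OF p] by blast
  obtain x where x: "x \<in> unity_roots l" "to_ac x = ev z a ^ ((CARD('a) ^ degree \<pi> - 1) div l)" "symb a \<pi> = \<Omega> x"
    using prime_residue_symbol_ex[OF p z] False by blast
  obtain y where y: "y \<in> unity_roots l" "to_ac y = ev z b ^ ((CARD('a) ^ degree \<pi> - 1) div l)" "symb b \<pi> = \<Omega> y"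
    using prime_residue_symbol_ex[OF p z] False by blast
  have "symb (a * b) \<pi> = \<Omega> (x * y)"
    using x y by (intro prime_residue_symbol_eq[OF p z nd]) (auto simp: unity_roots_def power_mult_distrib)
  then show ?thesis using x y Omega_mult by simp
qed

lemma prime_residue_symbol_periodic:
  assumes p: "\<pi> \<in> monic_primes"
  shows "symb (a + \<pi> * b) \<pi> = symb a \<pi>"
proof (cases "\<pi> dvd a")
  case True
  then show ?thesis by (simp add: prime_residue_symbol_def)
next
  case False
  then have nd: "\<not> \<pi> dvd a + \<pi> * b" by (simp add: dvd_add_left_iff)
  obtain z where z: "ev z \<pi> = 0" using exists_root_in_closure[OF p] by blast
  obtain x where x: "x \<in> unity_roots l" "to_ac x = ev z a ^ ((CARD('a) ^ degree \<pi> - 1) div l)" "symb a \<pi> = \<Omega> x"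
    using prime_residue_symbol_ex[OF p z] False by blast
  then show ?thesis using prime_residue_symbol_eq[OF p z nd x(1)] z by simp
qed

lemma prime_residue_symbol_norm:
  assumes p: "\<pi> \<in> monic_primes"
  shows "cmod (symb a \<pi>) = (if \<pi> dvd a then 0 else 1)"
proof (cases "\<pi> dvd a")
  case False
  obtain z where z: "ev z \<pi> = 0" using exists_root_in_closure[OF p] by blast
  show ?thesis using prime_residue_symbol_ex[OF p z False] False Omega_norm by auto
qed (simp add: prime_residue_symbol_def)

text \<open>All \<open>q\<close>-powers fix a constant, so its norm to the base field is its power
  with exponent \<open>degree \<pi>\<close>.\<close>

lemma prime_residue_symbol_const:
  assumes p: "\<pi> \<in> monic_primes" and c: "c \<noteq> 0"
  shows "c ^ s \<in> unity_roots l" "symb [:c:] \<pi> = \<Omega> (c ^ s) ^ degree \<pi>"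
proof -
  have "c * c ^ (CARD('a) - 1) = c" using finite_field_pow_card[of c]
    by (metis Suc_diff_1 power_Suc zero_less_card_finite)
  then have "c ^ (CARD('a) - 1) = 1" using c by simp
  then show u: "c ^ s \<in> unity_roots l"
    unfolding unity_roots_def by (simp only: card_field_minus_1(1) mult.commute[of l] power_mult mem_Collect_eq)
  obtain z where z: "ev z \<pi> = 0" using exists_root_in_closure[OF p] by blast
  have nd: "\<not> \<pi> dvd [:c:]" using ev_eq_0_iff[OF p z, of "[:c:]"] c by simp
  have "c ^ (s * (\<Sum>i<d. CARD('a) ^ i)) = (c ^ s) ^ d" for d
    by (induction d) (simp_all add: power_mult power_add finite_field_pow_card_power distrib_left)
  then have "(c ^ s) ^ degree \<pi> = c ^ ((CARD('a) ^ degree \<pi> - 1) div l)"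
    unfolding symbol_exponent(1) by (rule sym)
  then have "to_ac ((c ^ s) ^ degree \<pi>) = to_ac c ^ ((CARD('a) ^ degree \<pi> - 1) div l)"
    by (metis to_ac_power)
  then have "symb [:c:] \<pi> = \<Omega> ((c ^ s) ^ degree \<pi>)"
    by (intro prime_residue_symbol_eq[OF p z nd unity_roots_power[OF u]]) simp
  then show "symb [:c:] \<pi> = \<Omega> (c ^ s) ^ degree \<pi>" using Omega_power[OF u] by simp
qed

text \<open>Both symbols come from the \<open>s\<close>-th power of the resultant of the two primes,
  the product of all differences of their roots. Exchanging the primes changes the sign of every
  difference, and \<open>s\<close> is even.\<close>

lemma prime_residue_symbol_reciprocity:
  assumes p: "\<pi> \<in> monic_primes" "\<rho> \<in> monic_primes"
  shows "symb \<pi> \<rho> = symb \<rho> \<pi>"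
proof (cases "\<pi> = \<rho>")
  case False
  let ?q = "CARD('a)"
  have nd: "\<not> \<pi> dvd \<rho>" "\<not> \<rho> dvd \<pi>" using monic_primes_dvd_eq p False by blast+
  obtain z where z: "ev z \<pi> = 0" using exists_root_in_closure[OF p(1)] by blast
  obtain w where w: "ev w \<rho> = 0" using exists_root_in_closure[OF p(2)] by blast
  have formula: "ev y f ^ ((?q ^ d - 1) div l) = (\<Prod>j<d. ev (y ^ (?q ^ j)) f) ^ s" for y :: "'a alg_closure" and d f
  proof -
    have "ev y f ^ (\<Sum>i<d. ?q ^ i) = (\<Prod>j<d. ev (y ^ (?q ^ j)) f)"
      by (simp add: power_sum ev_frobenius_power)
    then show ?thesis unfolding symbol_exponent(1) by (simp add: power_mult mult.commute[of s])
  qed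
  have even_swap: "(x - y) ^ s = (y - x) ^ s" for x y :: "'a alg_closure"
    using card_field_minus_1(2) by (metis minus_diff_eq power_minus_even)
  have "ev w \<pi> ^ ((?q ^ degree \<rho> - 1) div l) =
      (\<Prod>j<degree \<rho>. \<Prod>i<degree \<pi>. (w ^ (?q ^ j) - z ^ (?q ^ i)) ^ s)"
    unfolding formula unfolding ev_monic_prime_eq_prod[OF p(1) z] by (simp add: prod_power_distrib)
  also have "\<dots> = (\<Prod>i<degree \<pi>. \<Prod>j<degree \<rho>. (z ^ (?q ^ i) - w ^ (?q ^ j)) ^ s)"
    by (subst prod.swap) (simp add: even_swap)
  also have "\<dots> = ev z \<rho> ^ ((?q ^ degree \<pi> - 1) div l)"
    unfolding formula unfolding ev_monic_prime_eq_prod[OF p(2) w] by (simp add: prod_power_distrib)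
  finally have e: "ev w \<pi> ^ ((?q ^ degree \<rho> - 1) div l) = ev z \<rho> ^ ((?q ^ degree \<pi> - 1) div l)" .
  obtain x where x: "x \<in> unity_roots l" "to_ac x = ev z \<rho> ^ ((?q ^ degree \<pi> - 1) div l)" "symb \<rho> \<pi> = \<Omega> x"
    using prime_residue_symbol_ex[OF p(1) z nd(1)] by blast
  then show ?thesis using prime_residue_symbol_eq[OF p(2) w nd(2) x(1)] e by simp
qed simp

text \<open>Otherwise all \<open>q^d - 1 = l * e\<close> non-zero residues,
  \<open>d = degree \<pi>\<close>, would be roots of \<open>x^(2 * e) - 1\<close>, which contradicts
  \<open>l \<ge> 3\<close>. The square is there because squares of symbols have to be orthogonal
  too.\<close>

lemma prime_residue_symbol_nontrivial:
  assumes p: "\<pi> \<in> monic_primes"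
  shows "\<exists>u. \<not> \<pi> dvd u \<and> symb u \<pi> ^ 2 \<noteq> 1"
proof (rule ccontr)
  assume n: "\<not> ?thesis"
  let ?q = "CARD('a)" and ?d = "degree \<pi>"
  obtain z where z: "ev z \<pi> = 0" using exists_root_in_closure[OF p] by blast
  define e where "e = (?q ^ ?d - 1) div l"
  have le: "l * e = ?q ^ ?d - 1" unfolding e_def using symbol_exponent[of ?d] by simp
  have q2: "2 \<le> ?q" using card_field_ge_2[where 'a='a] by simp
  have "?q ^ 1 \<le> ?q ^ ?d" using monic_primes_degree[OF p] q2 by (intro power_increasing) auto
  then have e0: "e > 0" using le q2 by (cases e) auto
  have "range (ev z) - {0} \<subseteq> {x. x ^ (2 * e) = 1}"
  proof clarify
    fix u assume "ev z u \<noteq> 0"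
    then have nd: "\<not> \<pi> dvd u" using ev_eq_0_iff[OF p z] by blast
    then obtain x where x: "x \<in> unity_roots l" "to_ac x = ev z u ^ e" "symb u \<pi> = \<Omega> x"
      using prime_residue_symbol_ex[OF p z] unfolding e_def by blast
    then have "\<Omega> (x ^ 2) = \<Omega> 1" using n nd Omega_power[OF x(1), of 2] Omega_1 by auto
    then have "x ^ 2 = 1" using Omega_bij unity_roots_power[OF x(1)] one_in_unity_roots
      by (auto simp: bij_betw_def inj_on_def)
    then have "(to_ac x) ^ 2 = 1" by (metis to_ac_1 to_ac_power)
    then show "ev z u ^ (2 * e) = 1" using x(2) by (simp add: power_mult mult.commute[of 2])
  qed
  then have "card (range (ev z) - {0}) \<le> card {x :: 'a alg_closure. x ^ (2 * e) = 1}"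
    using e0 by (intro card_mono finite_card_roots_of_unity) auto
  also have "\<dots> \<le> 2 * e" using e0 by (intro finite_card_roots_of_unity) auto
  finally have "card (range (ev z) - {0}) \<le> 2 * e" .
  moreover have "card (range (ev z) - {0}) = ?q ^ ?d - 1"
  proof -
    have "0 \<in> range (ev z)" by (rule range_eqI[of _ _ 0]) simp
    then show ?thesis by (simp add: card_Diff_singleton finite_card_range_ev[OF p z])
  qed
  moreover have "3 * e \<le> l * e" using l3 by simp
  ultimately show False using le e0 by linarith
qed

lemma symbol_system_prime_residue_symbol:
  "symbol_system (\<lambda>\<pi> a. prime_residue_symbol l \<Omega> a \<pi>)"
  unfolding symbol_system_def
proof (intro conjI)
  let ?w = "\<lambda>c. if c = 0 then 0 else \<Omega> (c ^ s)"
  \<comment> \<open>\<open>prime_residue_symbol_const(1)\<close> is stated in the presence of a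
    monic prime; the polynomial \<open>t\<close> supplies one.\<close>
  have "t \<in> (monic_primes :: 'a poly set)" if "t = [:0,1:]" for t
    unfolding that monic_primes_def using irreducible_linear_field_poly[of 1 "0::'a"] by simp
  then have u: "c ^ s \<in> unity_roots l" if "c \<noteq> 0" for c :: 'a
    using prime_residue_symbol_const(1) that by blast
  show "\<exists>w. (\<forall>c. c \<noteq> 0 \<longrightarrow> cmod (w c) = 1) \<and> w (-1) = 1 \<and>
        (\<forall>\<pi>\<in>monic_primes. \<forall>c. c \<noteq> 0 \<longrightarrow> symb [:c:] \<pi> = w c ^ degree \<pi>)"
    using u card_field_minus_1(2) Omega_1
    by (intro exI[of _ ?w]) (simp add: Omega_norm prime_residue_symbol_const(2) power_minus_even)
qed (use prime_residue_symbol_mult prime_residue_symbol_periodic prime_residue_symbol_norm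
      prime_residue_symbol_reciprocity prime_residue_symbol_nontrivial in blast)+

end

section \<open>Additive characters\<close>

definition additive_character :: "('a::{field,finite} \<Rightarrow> complex) \<Rightarrow> bool" where
  "additive_character \<psi> \<longleftrightarrow>
     (\<forall>x y. \<psi> (x + y) = \<psi> x * \<psi> y) \<and> (\<forall>x. cmod (\<psi> x) = 1) \<and> (\<exists>x. \<psi> x \<noteq> 1)"

lemma cis_int_cong:
  assumes "int n dvd i - j" "n > 0"
  shows "cis (2 * pi * real_of_int i / real n) = cis (2 * pi * real_of_int j / real n)"
proof -
  obtain k where "i - j = int n * k" using assms by auto
  then have "i = j + int n * k" by simp
  then have "2 * pi * real_of_int i / real n = 2 * pi * real_of_int j / real n + 2 * pi * real_of_int k"
    using assms by (simp add: field_simps)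
  then show ?thesis by (simp add: cis_multiple_2pi flip: cis_mult)
qed

text \<open>A character of order \<open>n\<close> of the cyclic quotient of the field by a maximal additive subgroup.\<close>

lemma exists_additive_character: "\<exists>\<psi> :: 'a::{field,finite} \<Rightarrow> complex. additive_character \<psi>"
proof -
  define sub where "sub H \<longleftrightarrow> 0 \<in> H \<and> (\<forall>x\<in>H. \<forall>y\<in>H. x - y \<in> H)" for H :: "'a set"
  have add: "x + y \<in> H" if "sub H" "x \<in> H" "y \<in> H" for H x y
  proof -
    have "0 - y \<in> H" using that unfolding sub_def by blast
    then have "x - (0 - y) \<in> H" using that unfolding sub_def by blast
    then show ?thesis by simp
  qed
  define P where "P H \<longleftrightarrow> sub H \<and> H \<noteq> UNIV" for H :: "'a set"
  have "P {0}" unfolding P_def sub_def by (auto dest: arg_cong[of _ _ "\<lambda>A. 1 \<in> A"])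
  moreover have "\<forall>H. P H \<longrightarrow> card H < Suc CARD('a)" by (simp add: card_mono less_Suc_eq_le)
  ultimately obtain H where H: "P H" "\<And>H'. P H' \<Longrightarrow> card H' \<le> card H"
    using ex_has_greatest_nat[of P "{0}" card "Suc CARD('a)"] by blast
  then have subH: "sub H" by (simp add: P_def)
  obtain x where x: "x \<notin> H" using H by (auto simp: P_def)
  have mulH: "of_int k * y \<in> H" if "y \<in> H" for y k
  proof -
    have n: "of_nat j * y \<in> H" for j
      by (induction j) (use subH that add in \<open>auto simp: sub_def distrib_right\<close>)
    have "0 - of_nat j * y \<in> H" for j using n[of j] subH unfolding sub_def by blast
    then show ?thesis using n by (cases k rule: int_cases2) auto
  qed
  \<comment> \<open>\<open>G\<close> is the subgroup generated by \<open>H\<close> and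
    \<open>x\<close>. As \<open>H\<close> is a proper subgroup of greatest cardinality,
    \<open>G\<close> is the whole field.\<close>
  define G where "G = {h + of_int i * x | h i. h \<in> H}"
  have "sub G" unfolding sub_def
  proof (intro conjI ballI)
    show "0 \<in> G" unfolding G_def using subH by (auto simp: sub_def intro!: exI[of _ 0])
  next
    fix a b assume "a \<in> G" "b \<in> G"
    then obtain h i h' i' where "a = h + of_int i * x" "b = h' + of_int i' * x" "h \<in> H" "h' \<in> H"
      by (auto simp: G_def)
    then have "a - b = (h - h') + of_int (i - i') * x" "h - h' \<in> H"
      using subH by (auto simp: sub_def algebra_simps)
    then show "a - b \<in> G" unfolding G_def by blast
  qed
  moreover have "H \<subseteq> G" unfolding G_def by (force intro: exI[of _ 0])
  moreover have "x \<in> G" unfolding G_def using subH by (force simp: sub_def intro: exI[of _ 0] exI[of _ 1])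
  ultimately have "G = UNIV" using H(2)[of G] x psubset_card_mono[of G H] unfolding P_def
    by (metis finite_code linorder_not_le psubsetI)
  \<comment> \<open>The order of \<open>x\<close> modulo \<open>H\<close>; the characteristic of the
    field shows that it is finite.\<close>
  define n where "n = (LEAST n. 0 < n \<and> of_nat n * x \<in> H)"
  have "0 < CHAR('a) \<and> of_nat CHAR('a) * x \<in> H"
    using finite_imp_CHAR_pos[where 'a='a] subH by (simp add: sub_def)
  then have "0 < n \<and> of_nat n * x \<in> H" unfolding n_def by (rule LeastI)
  then have n: "0 < n" "of_nat n * x \<in> H" by auto
  have n_min: "j = 0" if "j < n" "of_nat j * x \<in> H" for j
    using not_less_Least[of j "\<lambda>n. 0 < n \<and> of_nat n * x \<in> H"] that unfolding n_def by auto
  have dvd: "int n dvd i" if "of_int i * x \<in> H" for i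
  proof -
    have "of_int (i mod int n) * x = of_int i * x - of_int (i div int n) * (of_nat n * x)"
      by (simp add: minus_mult_div_eq_mod[symmetric] algebra_simps)
    also have "\<dots> \<in> H" using that mulH[OF n(2)] subH unfolding sub_def by blast
    finally have "of_nat (nat (i mod int n)) * x \<in> H" using n by simp
    moreover have "nat (i mod int n) < n" using n by (simp add: nat_less_iff)
    ultimately have "nat (i mod int n) = 0" using n_min by blast
    then have "i mod int n = 0" using n by (simp add: order_antisym)
    then show ?thesis by auto
  qed
  have "n \<noteq> 1" using n(2) x by auto
  then have n2: "n \<ge> 2" using n by linarith
  \<comment> \<open>A discrete logarithm to the base \<open>x\<close> modulo \<open>H\<close>. It is
    determined only modulo \<open>n\<close>, an ambiguity that \<open>cis_int_cong\<close> makes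
    harmless.\<close>
  define I where "I y = (SOME i. y - of_int i * x \<in> H)" for y
  have I: "y - of_int (I y) * x \<in> H" for y
  proof -
    obtain h i where "y = h + of_int i * x" "h \<in> H" using \<open>G = UNIV\<close> unfolding G_def by blast
    then have "y - of_int i * x \<in> H" by simp
    then show ?thesis unfolding I_def by (rule someI)
  qed
  define \<psi> where "\<psi> y = cis (2 * pi * real_of_int (I y) / real n)" for y
  have "\<psi> (y + z) = \<psi> y * \<psi> z" for y z
  proof -
    have "(y - of_int (I y) * x) + (z - of_int (I z) * x) - ((y + z) - of_int (I (y + z)) * x) \<in> H"
      using I[of y] I[of z] I[of "y + z"] add[OF subH] subH unfolding sub_def by blast
    then have "of_int (I (y + z) - (I y + I z)) * x \<in> H" by (simp add: algebra_simps)
    then have "\<psi> (y + z) = cis (2 * pi * real_of_int (I y + I z) / real n)"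
      unfolding \<psi>_def using dvd n by (intro cis_int_cong) auto
    also have "2 * pi * real_of_int (I y + I z) / real n = 2 * pi * real_of_int (I y) / real n + 2 * pi * real_of_int (I z) / real n"
      by (simp add: add_divide_distrib distrib_left)
    finally show ?thesis by (simp add: \<psi>_def cis_mult)
  qed
  moreover have "\<psi> x \<noteq> 1"
  proof
    assume "\<psi> x = 1"
    have "(x - of_int (I x) * x) \<in> H" by (rule I)
    then have "0 - (x - of_int (I x) * x) \<in> H" using subH unfolding sub_def by blast
    then have "of_int (I x - 1) * x \<in> H" by (simp add: algebra_simps)
    then have "\<psi> x = cis (2 * pi * real_of_int 1 / real n)"
      unfolding \<psi>_def using dvd n by (intro cis_int_cong) auto
    then have "cis (2 * pi / real n) = 1" using \<open>\<psi> x = 1\<close> by simp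
    then have "cos (2 * pi / real n) = 1" by (metis cis.sel(1) one_complex.sel(1))
    then obtain k :: int where "2 * pi / real n = real_of_int k * 2 * pi" using cos_one_2pi_int by auto
    then have "1 = real_of_int k * real n" using n by (simp add: field_simps)
    then have "real_of_int 1 = real_of_int (k * int n)" by simp
    then have "1 = k * int n" by (simp only: of_int_eq_iff)
    then have "int n dvd 1" by (metis dvd_triv_right)
    then show False using n2 by (simp add: zdvd1_eq)
  qed
  ultimately show ?thesis unfolding additive_character_def by (intro exI[of _ \<psi>]) (auto simp: \<psi>_def)
qed

lemma coeff_mult_degree_le_sum:
  fixes p r :: "'a::idom poly"
  assumes "degree p \<le> m" "degree r \<le> n"
  shows "coeff (p * r) (m + n) = coeff p m * coeff r n"
proof (cases "degree p = m \<and> degree r = n")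
  case True
  then show ?thesis using coeff_mult_degree_sum[of p r] by auto
next
  case False
  then have "degree p + degree r < m + n" using assms by auto
  then have "coeff (p * r) (m + n) = 0" using degree_mult_le[of p r] by (intro coeff_eq_0) auto
  moreover have "coeff p m = 0 \<or> coeff r n = 0" using False assms by (auto intro: coeff_eq_0)
  ultimately show ?thesis by auto
qed

text \<open>The additive character \<open>a \<mapsto> \<psi> (res (a / R))\<close> of the residues modulo a monic \<open>R\<close>: the
  coefficient below is that of \<open>t\<^sup>-\<^sup>1\<close> in the expansion of \<open>a / R\<close> at infinity.\<close>

definition echar :: "('a::field \<Rightarrow> complex) \<Rightarrow> 'a poly \<Rightarrow> 'a poly \<Rightarrow> complex" where
  "echar \<psi> R a = \<psi> (coeff (a mod R) (degree R - 1))"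

context
  fixes \<psi> :: "'a::{field,finite} \<Rightarrow> complex"
  assumes psi: "additive_character \<psi>"
begin

lemma psi_add: "\<psi> (x + y) = \<psi> x * \<psi> y"
  and psi_norm: "cmod (\<psi> x) = 1"
  using psi by (auto simp: additive_character_def)

lemma psi_0: "\<psi> 0 = 1"
  using psi_add[of 0 0] psi_norm[of 0] by auto

lemma psi_uminus: "\<psi> (- x) = cnj (\<psi> x)"
proof -
  have "\<psi> x * \<psi> (- x) = 1" using psi_add[of x "- x"] psi_0 by simp
  moreover have "cnj (\<psi> x) * \<psi> x = 1"
    using psi_norm[of x] complex_norm_square[of "\<psi> x"] by (simp add: mult.commute)
  ultimately show ?thesis by (metis mult.assoc mult.right_neutral mult_1)
qed

lemma echar_add: "echar \<psi> R (a + b) = echar \<psi> R a * echar \<psi> R b"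
  by (simp add: echar_def poly_mod_add_left psi_add)

lemma echar_0 [simp]: "echar \<psi> R 0 = 1"
  by (simp add: echar_def psi_0)

lemma echar_uminus: "echar \<psi> R (- a) = cnj (echar \<psi> R a)"
  by (simp add: echar_def poly_mod_minus_left psi_uminus)

lemma echar_cong: "R dvd a - b \<Longrightarrow> echar \<psi> R a = echar \<psi> R b"
  by (simp add: echar_def flip: mod_eq_dvd_iff)

text \<open>Both sides belong to the same fraction \<open>a / R\<close>. Passing to the larger
  denominator moves the relevant coefficient up by \<open>r'\<close> without changing it, because
  \<open>R'\<close> is monic.\<close>

lemma echar_mult_monic:
  assumes "R \<in> monic_polys r" "R' \<in> monic_polys r'"
  shows "echar \<psi> (R * R') (a * R') = echar \<psi> R a"
proof -
  have d: "degree R = r" "degree R' = r'" "coeff R' r' = 1" "R \<noteq> 0" "R' \<noteq> 0"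
    using assms monic_polys_nz by (auto simp: monic_polys_def)
  have "coeff ((a mod R) * R') (r + r' - 1) = coeff (a mod R) (r - 1)"
  proof (cases "r = 0")
    case True
    then have "a mod R = 0" using mod_in_polys_below[OF d(4), of a] d by simp
    then show ?thesis by simp
  next
    case False
    have "degree (a mod R) \<le> r - 1" using mod_in_polys_below[OF d(4), of a] d False by (auto simp: polys_below_iff)
    then have "coeff ((a mod R) * R') (r - 1 + r') = coeff (a mod R) (r - 1) * coeff R' r'"
      using d by (intro coeff_mult_degree_le_sum) auto
    then show ?thesis using d False by simp
  qed
  then show ?thesis unfolding echar_def mod_mult_mult2 using d by (simp add: degree_mult_eq)
qed

text \<open>For \<open>a \<in> polys_below (r - s)\<close> the products \<open>a * b\<close> never
  reach degree \<open>r - 1\<close>. Otherwise \<open>b0\<close> is chosen so that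
  \<open>a * b0\<close> has coefficient \<open>x\<close> at \<open>t^(r - 1)\<close>, where
  \<open>\<psi> x \<noteq> 1\<close>; translation by \<open>b0\<close> multiplies the sum by
  \<open>\<psi> x\<close>.\<close>

lemma sum_echar:
  assumes R: "R \<in> monic_polys r" and "s \<le> r" and a: "a \<in> polys_below r"
  shows "(\<Sum>b\<in>polys_below s. echar \<psi> R (a * b)) = (if a \<in> polys_below (r - s) then of_nat (CARD('a)) ^ s else 0)"
proof (cases "a \<in> polys_below (r - s)")
  case True
  have "echar \<psi> R (a * b) = 1" if b: "b \<in> polys_below s" for b
  proof (cases "a = 0 \<or> b = 0")
    case True
    then show ?thesis by auto
  next
    case False
    then have db: "degree b < s" "degree a < r - s" using b \<open>a \<in> polys_below (r - s)\<close> by (auto simp: polys_below_iff)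
    then have dl: "degree (a * b) < r - 1" using degree_mult_le[of a b] by linarith
    then have "(a * b) mod R = a * b" using R by (intro mod_poly_less) (auto simp: monic_polys_def)
    then show ?thesis using dl R by (simp add: echar_def coeff_eq_0 psi_0 monic_polys_def)
  qed
  then show ?thesis using True by (simp add: card_polys_below)
next
  case False
  define \<delta> where "\<delta> = degree a"
  have a0: "a \<noteq> 0" "r - s \<le> \<delta>" "\<delta> < r" using False a by (auto simp: polys_below_iff \<delta>_def)
  obtain x where x: "\<psi> x \<noteq> 1" using psi by (auto simp: additive_character_def)
  define b0 where "b0 = monom (x / lead_coeff a) (r - 1 - \<delta>)"
  have db: "degree b0 \<le> r - 1 - \<delta>" by (simp add: b0_def degree_monom_le)
  then have b0: "b0 \<in> polys_below s" using a0 \<open>s \<le> r\<close> by (auto simp: polys_below_iff)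
  have "degree (a * b0) \<le> r - 1" using degree_mult_le[of a b0] db a0 unfolding \<delta>_def by linarith
  then have "(a * b0) mod R = a * b0" using R a0 by (intro mod_poly_less) (auto simp: monic_polys_def)
  moreover have "coeff (a * b0) (\<delta> + (r - 1 - \<delta>)) = lead_coeff a * (x / lead_coeff a)"
    using coeff_mult_degree_le_sum[of a \<delta> b0 "r - 1 - \<delta>"] db by (simp add: \<delta>_def b0_def)
  ultimately have e: "echar \<psi> R (a * b0) = \<psi> x" using R a0 by (simp add: echar_def monic_polys_def)
  let ?S = "\<Sum>b\<in>polys_below s. echar \<psi> R (a * b)"
  have "?S = (\<Sum>b\<in>polys_below s. echar \<psi> R (a * (b + b0)))"
    by (rule sum.reindex_bij_witness[of _ "\<lambda>b. b + b0" "\<lambda>b. b - b0"])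
      (auto intro: polys_below_add polys_below_diff b0)
  also have "\<dots> = ?S * \<psi> x" by (simp add: distrib_left echar_add e sum_distrib_right)
  finally have "?S * (1 - \<psi> x) = 0" by (simp add: algebra_simps)
  then show ?thesis using x False by simp
qed

end

lemma sum_polys_below_by_leading_term:
  fixes F :: "'a::{field,finite} poly \<Rightarrow> complex"
  assumes "F 0 = 0"
  shows "(\<Sum>b\<in>polys_below s. F b) = (\<Sum>k<s. \<Sum>c\<in>UNIV - {0}. \<Sum>B\<in>monic_polys k. F (smult c B))"
proof -
  have "(\<Sum>b\<in>polys_below s. F b) = (\<Sum>b\<in>polys_below s - {0}. F b)"
    using assms by (intro sum.mono_neutral_right) auto
  also have "\<dots> = (\<Sum>(k,c,B)\<in>(SIGMA k:{..<s}. (UNIV - {0}) \<times> monic_polys k). F (smult c B))"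
    by (rule sum.reindex_bij_witness[of _ "\<lambda>(k,c,B). smult c B"
          "\<lambda>b. (degree b, lead_coeff b, smult (inverse (lead_coeff b)) b)"])
      (auto simp: polys_below_iff monic_polys_def)
  also have "\<dots> = (\<Sum>k<s. \<Sum>c\<in>UNIV - {0}. \<Sum>B\<in>monic_polys k. F (smult c B))"
    by (subst sum.cartesian_product, subst sum.Sigma) (auto simp: case_prod_unfold)
  finally show ?thesis .
qed

section \<open>Gauss sums and the functional equation\<close>

definition psym :: "('a::field poly \<Rightarrow> 'a poly \<Rightarrow> complex) \<Rightarrow> 'a poly set \<Rightarrow> 'a poly \<Rightarrow> complex" where
  "psym \<chi> S M = (\<Prod>\<pi>\<in>S. \<chi> \<pi> M)"

text \<open>What remains of \<open>psym \<chi> S M * cnj (psym \<chi> T M)\<close> once the common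
  primes are removed; then \<open>A = S - T\<close> and \<open>B = T - S\<close>.\<close>

definition pair_char :: "('a::field poly \<Rightarrow> 'a poly \<Rightarrow> complex) \<Rightarrow> 'a poly set \<Rightarrow> 'a poly set \<Rightarrow> 'a poly \<Rightarrow> complex" where
  "pair_char \<chi> A B M = psym \<chi> A M * cnj (psym \<chi> B M)"

definition gauss_sum :: "('a::{field,finite} poly \<Rightarrow> 'a poly \<Rightarrow> complex) \<Rightarrow> ('a \<Rightarrow> complex) \<Rightarrow> 'a poly set \<Rightarrow> complex" where
  "gauss_sum \<chi> \<psi> S = (\<Sum>a\<in>polys_below (pdeg S). psym \<chi> S a * echar \<psi> (\<Prod>S) a)"

definition prime_set :: "'a::field poly set \<Rightarrow> bool" where
  "prime_set S \<longleftrightarrow> finite S \<and> S \<subseteq> monic_primes"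

text \<open>The sum of the additive twist over the leading coefficients of the dual variable of degree \<open>k\<close>:
  it is non-trivial only in the top degree \<open>s - 1\<close>.\<close>

definition dual_weight :: "('a::{field,finite} \<Rightarrow> complex) \<Rightarrow> nat \<Rightarrow> nat \<Rightarrow> complex" where
  "dual_weight \<psi> s k = (\<Sum>c\<in>UNIV - {0}. \<psi> (- (if k = s - 1 then c else 0)))"

lemma prime_setD: "prime_set S \<Longrightarrow> finite S" "prime_set S \<Longrightarrow> S \<subseteq> monic_primes"
  by (auto simp: prime_set_def)

lemma prime_set_Un: "prime_set A \<Longrightarrow> prime_set B \<Longrightarrow> prime_set (A \<union> B)"
  and prime_set_subset: "prime_set A \<Longrightarrow> B \<subseteq> A \<Longrightarrow> prime_set B"
  by (auto simp: prime_set_def intro: finite_subset)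

lemma pdeg_Un: "finite A \<Longrightarrow> finite B \<Longrightarrow> A \<inter> B = {} \<Longrightarrow> pdeg (A \<union> B) = pdeg A + pdeg B"
  by (simp add: pdeg_def sum.union_disjoint)

lemma unit_norm_cnj: "cmod x = 1 \<Longrightarrow> x * cnj x = 1"
  using complex_norm_square[of x] by simp

section \<open>Arithmetic of symbol systems\<close>

context
  fixes \<chi> :: "'a::{field,finite} poly \<Rightarrow> 'a poly \<Rightarrow> complex"
  assumes sys: "symbol_system \<chi>"
begin

lemma chi_mult: "\<pi> \<in> monic_primes \<Longrightarrow> \<chi> \<pi> (a * b) = \<chi> \<pi> a * \<chi> \<pi> b"
  using sys[unfolded symbol_system_def, THEN conjunct1] by blast

lemma chi_periodic: "\<pi> \<in> monic_primes \<Longrightarrow> \<chi> \<pi> (a + \<pi> * b) = \<chi> \<pi> a"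
  using sys[unfolded symbol_system_def, THEN conjunct2, THEN conjunct1] by blast

lemma chi_norm: "\<pi> \<in> monic_primes \<Longrightarrow> cmod (\<chi> \<pi> a) = (if \<pi> dvd a then 0 else 1)"
  using sys[unfolded symbol_system_def, THEN conjunct2, THEN conjunct2, THEN conjunct1] by blast

lemma chi_reciprocity: "\<pi> \<in> monic_primes \<Longrightarrow> \<rho> \<in> monic_primes \<Longrightarrow> \<chi> \<pi> \<rho> = \<chi> \<rho> \<pi>"
  using sys[unfolded symbol_system_def, THEN conjunct2, THEN conjunct2, THEN conjunct2, THEN conjunct1] by blast

lemma chi_nontrivial: "\<pi> \<in> monic_primes \<Longrightarrow> \<exists>u. \<not> \<pi> dvd u \<and> \<chi> \<pi> u ^ 2 \<noteq> 1"
  using sys[unfolded symbol_system_def, THEN conjunct2, THEN conjunct2, THEN conjunct2, THEN conjunct2, THEN conjunct2] by blast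

lemma chi_const:
  obtains w where "\<And>c. c \<noteq> 0 \<Longrightarrow> cmod (w c) = 1" "w (-1) = 1"
    "\<And>\<pi> c. \<pi> \<in> monic_primes \<Longrightarrow> c \<noteq> 0 \<Longrightarrow> \<chi> \<pi> [:c:] = w c ^ degree \<pi>"
proof -
  obtain w where "(\<forall>c. c \<noteq> 0 \<longrightarrow> cmod (w c) = 1) \<and> w (-1) = 1 \<and>
        (\<forall>\<pi>\<in>monic_primes. \<forall>c. c \<noteq> 0 \<longrightarrow> \<chi> \<pi> [:c:] = w c ^ degree \<pi>)"
    using sys[unfolded symbol_system_def, THEN conjunct2, THEN conjunct2, THEN conjunct2, THEN conjunct2, THEN conjunct1]
    by (rule exE)
  then show ?thesis by (intro that[of w]) blast+
qed

lemma chi_cong: "\<pi> \<in> monic_primes \<Longrightarrow> \<pi> dvd a - b \<Longrightarrow> \<chi> \<pi> a = \<chi> \<pi> b"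
  using chi_periodic[of \<pi> b] by (metis add.commute diff_add_cancel dvdE)

lemma chi_1: "\<pi> \<in> monic_primes \<Longrightarrow> \<chi> \<pi> 1 = 1"
  using chi_mult[of \<pi> 1 1] chi_norm[of \<pi> 1] monic_primes_not_unit[of \<pi>] by auto

lemma psym_empty [simp]: "psym \<chi> {} M = 1"
  by (simp add: psym_def)

lemma psym_mult: "prime_set S \<Longrightarrow> psym \<chi> S (a * b) = psym \<chi> S a * psym \<chi> S b"
  unfolding psym_def prod.distrib[symmetric]
  by (intro prod.cong refl) (use prime_setD chi_mult in blast)

lemma psym_1: "prime_set S \<Longrightarrow> psym \<chi> S 1 = 1"
  unfolding psym_def by (intro prod.neutral) (use prime_setD chi_1 in blast)

lemma psym_power: "prime_set S \<Longrightarrow> psym \<chi> S (a ^ n) = psym \<chi> S a ^ n"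
  by (induction n) (simp_all add: psym_1 psym_mult)

lemma psym_cong:
  assumes "prime_set S" "\<And>\<pi>. \<pi> \<in> S \<Longrightarrow> \<pi> dvd a - b"
  shows "psym \<chi> S a = psym \<chi> S b"
  unfolding psym_def by (intro prod.cong refl chi_cong) (use assms prime_setD in auto)

lemma psym_norm:
  assumes "prime_set S"
  shows "cmod (psym \<chi> S a) = (if \<exists>\<pi>\<in>S. \<pi> dvd a then 0 else 1)"
proof -
  have "cmod (psym \<chi> S a) = (\<Prod>\<pi>\<in>S. if \<pi> dvd a then 0 else 1)"
    unfolding psym_def prod_norm[symmetric]
    by (intro prod.cong refl) (use assms prime_setD chi_norm in blast)
  also have "\<dots> = (if \<exists>\<pi>\<in>S. \<pi> dvd a then 0 else 1)"
  proof (cases "\<exists>\<pi>\<in>S. \<pi> dvd a")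
    case True
    then have "(\<Prod>\<pi>\<in>S. if \<pi> dvd a then 0 else 1) = (0::real)"
      using assms by (intro prod_zero) (auto simp: prime_set_def)
    then show ?thesis using True by simp
  next
    case False
    then show ?thesis by (simp add: prod.neutral)
  qed
  finally show ?thesis .
qed

lemma psym_norm_le_1: "prime_set S \<Longrightarrow> cmod (psym \<chi> S a) \<le> 1"
  by (simp add: psym_norm)

lemma psym_Un:
  "prime_set A \<Longrightarrow> prime_set B \<Longrightarrow> A \<inter> B = {} \<Longrightarrow> psym \<chi> (A \<union> B) a = psym \<chi> A a * psym \<chi> B a"
  by (simp add: psym_def prod.union_disjoint prime_set_def)

lemma psym_prod_eq:
  assumes "prime_set S" "prime_set T"
  shows "psym \<chi> S (\<Prod>T) = (\<Prod>\<pi>\<in>S. \<Prod>\<rho>\<in>T. \<chi> \<pi> \<rho>)"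
proof -
  have "\<chi> \<pi> (\<Prod>T) = (\<Prod>\<rho>\<in>T. \<chi> \<pi> \<rho>)" if "\<pi> \<in> monic_primes" for \<pi>
    using prime_setD(1)[OF assms(2)]
    by (induction T rule: finite_induct) (simp_all add: chi_1 chi_mult that)
  then show ?thesis unfolding psym_def
    by (intro prod.cong refl) (use assms prime_setD in blast)
qed

lemma psym_reciprocity:
  assumes "prime_set S" "prime_set T"
  shows "psym \<chi> S (\<Prod>T) = psym \<chi> T (\<Prod>S)"
proof -
  have "psym \<chi> S (\<Prod>T) = (\<Prod>\<rho>\<in>T. \<Prod>\<pi>\<in>S. \<chi> \<pi> \<rho>)"
    unfolding psym_prod_eq[OF assms] by (rule prod.swap)
  also have "\<dots> = psym \<chi> T (\<Prod>S)" unfolding psym_prod_eq[OF assms(2,1)]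
    by (intro prod.cong refl chi_reciprocity) (use assms prime_setD in auto)
  finally show ?thesis .
qed

lemma psym_const:
  obtains w where "\<And>c. c \<noteq> 0 \<Longrightarrow> cmod (w c) = 1" "w (-1) = 1"
    "\<And>S c. prime_set S \<Longrightarrow> c \<noteq> 0 \<Longrightarrow> psym \<chi> S [:c:] = w c ^ pdeg S"
proof -
  obtain w where w: "\<And>c. c \<noteq> 0 \<Longrightarrow> cmod (w c) = 1" "w (-1) = 1"
    "\<And>\<pi> c. \<pi> \<in> monic_primes \<Longrightarrow> c \<noteq> 0 \<Longrightarrow> \<chi> \<pi> [:c:] = w c ^ degree \<pi>"
    using chi_const by blast
  have "psym \<chi> S [:c:] = w c ^ pdeg S" if "prime_set S" "c \<noteq> 0" for S c
    unfolding psym_def pdeg_def power_sum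
    by (intro prod.cong refl w(3)) (use that prime_setD in auto)
  then show ?thesis using that w by blast
qed

lemma psym_uminus: "prime_set S \<Longrightarrow> psym \<chi> S (- a) = psym \<chi> S a"
proof -
  assume S: "prime_set S"
  obtain w where w: "w (-1) = (1::complex)"
      "\<And>S c. prime_set S \<Longrightarrow> c \<noteq> 0 \<Longrightarrow> psym \<chi> S [:c:] = w c ^ pdeg S"
    using psym_const by metis
  have "psym \<chi> S [:-1:] = 1" using w(2)[OF S, of "-1"] w(1) by simp
  then show ?thesis using psym_mult[OF S, of "[:-1:]" a] by simp
qed

lemma pair_char_mult:
  "prime_set A \<Longrightarrow> prime_set B \<Longrightarrow> pair_char \<chi> A B (a * b) = pair_char \<chi> A B a * pair_char \<chi> A B b"
  by (simp add: pair_char_def psym_mult)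

lemma pair_char_cong:
  "prime_set A \<Longrightarrow> prime_set B \<Longrightarrow> \<Prod>(A \<union> B) dvd a - b \<Longrightarrow> pair_char \<chi> A B a = pair_char \<chi> A B b"
  for a b
  unfolding pair_char_def using prod_dvd_iff[of "A \<union> B" "a - b"] prime_setD[OF prime_set_Un, of A B]
  by (intro arg_cong2[of _ _ _ _ "(*)"] arg_cong[of _ _ cnj] psym_cong) auto

lemma pair_char_norm:
  "prime_set A \<Longrightarrow> prime_set B \<Longrightarrow> cmod (pair_char \<chi> A B a) = (if \<exists>\<pi>\<in>A \<union> B. \<pi> dvd a then 0 else 1)"
  by (auto simp: pair_char_def norm_mult psym_norm)

text \<open>The values at a constant are \<open>w c ^ pdeg A\<close> and the conjugate of
  \<open>w c ^ pdeg B\<close>, which cancel for equal degrees. In the functional equation this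
  reduces the dual sum to monic polynomials.\<close>

lemma pair_char_smult:
  assumes "prime_set A" "prime_set B" "pdeg A = pdeg B" "c \<noteq> 0"
  shows "pair_char \<chi> A B (smult c a) = pair_char \<chi> A B a"
proof -
  obtain w where w: "\<And>c. c \<noteq> 0 \<Longrightarrow> cmod (w c) = 1"
      "\<And>S c. prime_set S \<Longrightarrow> c \<noteq> 0 \<Longrightarrow> psym \<chi> S [:c:] = w c ^ pdeg S"
    using psym_const by metis
  have "pair_char \<chi> A B [:c:] = w c ^ pdeg B * cnj (w c ^ pdeg B)"
    using assms by (simp add: pair_char_def w(2))
  also have "\<dots> = 1" using w(1)[OF assms(4)] by (intro unit_norm_cnj) (simp add: norm_power)
  finally show ?thesis using pair_char_mult[of A B "[:c:]" a] assms by simp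
qed

text \<open>A case of the Chinese remainder theorem by counting: modulo \<open>\<pi>\<close> the
  values \<open>1 + \<Prod>S * a\<close> are distinct for distinct residues \<open>a\<close>, hence
  they exhaust all residues.\<close>

lemma exists_residue:
  fixes S :: "'a poly set"
  assumes S: "prime_set S" and p: "\<pi> \<in> monic_primes" "\<pi> \<notin> S"
  shows "\<exists>u. \<pi> dvd u - w \<and> (\<forall>\<rho>\<in>S. \<rho> dvd u - 1)"
proof -
  let ?P = "\<Prod>S"
  have nd: "\<not> \<pi> dvd ?P" using monic_primes_dvd_prod_iff[OF prime_setD[OF S] p(1)] p(2) by blast
  let ?f = "\<lambda>a. (1 + ?P * a) mod \<pi>"
  have pi0: "\<pi> \<noteq> 0" using p monic_primes_nz by blast
  have "inj_on ?f (polys_below (degree \<pi>))"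
  proof (rule inj_onI)
    fix a b assume h: "a \<in> polys_below (degree \<pi>)" "b \<in> polys_below (degree \<pi>)" "?f a = ?f b"
    then have "\<pi> dvd (1 + ?P * a) - (1 + ?P * b)" by (simp only: mod_eq_dvd_iff)
    moreover have "(1 + ?P * a) - (1 + ?P * b) = ?P * (a - b)" by (simp add: algebra_simps)
    ultimately have "\<pi> dvd a - b" using nd monic_primes_dvd_mult[OF p(1)] by metis
    then show "a = b" using polys_below_cong_eq h by blast
  qed
  then have "?f ` polys_below (degree \<pi>) = polys_below (degree \<pi>)"
    using mod_in_polys_below[OF pi0] by (intro card_seteq) (auto simp: card_image)
  then have "w mod \<pi> \<in> ?f ` polys_below (degree \<pi>)" using mod_in_polys_below[OF pi0] by simp
  then obtain a where "w mod \<pi> = ?f a" by auto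
  then have "\<pi> dvd (1 + ?P * a) - w" by (metis mod_eq_dvd_iff)
  moreover have "\<forall>\<rho>\<in>S. \<rho> dvd (1 + ?P * a) - 1"
    using prime_setD(1)[OF S] by (auto intro: dvd_mult2 dvd_prodI)
  ultimately show ?thesis by blast
qed

text \<open>A residue congruent to \<open>1\<close> at all primes but one leaves only the symbol at
  \<open>\<pi>\<close>, possibly conjugated. A square different from \<open>1\<close> serves the
  character and its square at once.\<close>

lemma exists_nontrivial_residue:
  assumes A: "prime_set A" and B: "prime_set B" and disj: "A \<inter> B = {}" and p: "\<pi> \<in> A \<union> B"
  shows "\<exists>u. (\<forall>\<rho>\<in>A \<union> B - {\<pi>}. \<rho> dvd u - 1) \<and> (\<forall>\<rho>\<in>A \<union> B. \<not> \<rho> dvd u) \<and> pair_char \<chi> A B u ^ 2 \<noteq> 1"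
proof -
  have pm: "\<pi> \<in> monic_primes" using A B p prime_setD by blast
  obtain w where w: "\<not> \<pi> dvd w" "\<chi> \<pi> w ^ 2 \<noteq> 1" using chi_nontrivial[OF pm] by blast
  obtain u where u: "\<pi> dvd u - w" "\<forall>\<rho>\<in>A \<union> B - {\<pi>}. \<rho> dvd u - 1"
  proof -
    have "prime_set (A \<union> B - {\<pi>})" by (rule prime_set_subset[OF prime_set_Un[OF A B]]) blast
    then show ?thesis using that exists_residue[OF _ pm, of "A \<union> B - {\<pi>}" w] by (metis DiffD2 singletonI)
  qed
  have "\<not> \<rho> dvd u" if r: "\<rho> \<in> A \<union> B" for \<rho>
  proof
    assume d: "\<rho> dvd u"
    show False
    proof (cases "\<rho> = \<pi>")
      case True
      then have "\<pi> dvd u - (u - w)" using d u by (metis dvd_diff)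
      then show False using w by simp
    next
      case False
      then have "\<rho> dvd u - (u - 1)" using d u r by (metis DiffI dvd_diff singletonD)
      moreover have "\<rho> \<in> monic_primes" using r A B prime_setD by blast
      ultimately show False using monic_primes_not_unit by auto
    qed
  qed
  moreover have chi1: "\<chi> \<rho> u = 1" if "\<rho> \<in> A \<union> B - {\<pi>}" for \<rho>
  proof -
    have "\<rho> \<in> monic_primes" using that A B prime_setD by blast
    moreover have "\<rho> dvd u - 1" using u(2) that by (rule bspec)
    ultimately show ?thesis using chi_cong chi_1 by metis
  qed
  have chiw: "\<chi> \<pi> u = \<chi> \<pi> w" using chi_cong[OF pm u(1)] .
  have "pair_char \<chi> A B u ^ 2 \<noteq> 1"
  proof (cases "\<pi> \<in> A")
    case True
    then have "psym \<chi> A u = \<chi> \<pi> w"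
      unfolding psym_def using prime_setD(1)[OF A] chi1 chiw by (simp add: prod.remove prod.neutral)
    moreover have "psym \<chi> B u = 1" unfolding psym_def using True disj chi1 by (intro prod.neutral) auto
    ultimately show ?thesis using w by (simp add: pair_char_def)
  next
    case False
    then have "psym \<chi> B u = \<chi> \<pi> w"
      unfolding psym_def using prime_setD(1)[OF B] chi1 chiw p by (simp add: prod.remove prod.neutral)
    moreover have "psym \<chi> A u = 1" unfolding psym_def using False chi1 by (intro prod.neutral) auto
    ultimately show ?thesis using w by (simp add: pair_char_def flip: complex_cnj_power)
  qed
  ultimately show ?thesis using u by blast
qed

section \<open>Complete character sums modulo two disjoint prime sets\<close>

context
  fixes \<psi> :: "'a \<Rightarrow> complex" and A B :: "'a poly set" and r :: nat
  assumes psi: "additive_character \<psi>"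
    and A: "prime_set A" and B: "prime_set B" and disj: "A \<inter> B = {}"
    and r_def: "r = pdeg A + pdeg B"
begin

lemma prime_set_modulus: "prime_set (A \<union> B)"
  by (rule prime_set_Un[OF A B])

lemma pdeg_modulus: "pdeg (A \<union> B) = r"
  using pdeg_Un[OF prime_setD(1)[OF A] prime_setD(1)[OF B] disj] r_def by simp

lemma modulus_monic: "\<Prod>(A \<union> B) \<in> monic_polys r"
  using prod_monic_primes[OF prime_setD[OF prime_set_modulus]] pdeg_modulus by simp

lemma degree_modulus: "degree (\<Prod>(A \<union> B)) = r"
  using modulus_monic by (simp add: monic_polys_def)

lemma modulus_nz: "\<Prod>(A \<union> B) \<noteq> 0"
  using modulus_monic monic_polys_nz by blast

lemma bij_residue_mult:
  assumes u: "\<forall>\<rho>\<in>A \<union> B. \<not> \<rho> dvd u"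
  shows "bij_betw (\<lambda>a. (u * a) mod \<Prod>(A \<union> B)) (polys_below r) (polys_below r)"
proof -
  let ?R = "\<Prod>(A \<union> B)"
  have inj: "inj_on (\<lambda>a. (u * a) mod ?R) (polys_below r)"
  proof (rule inj_onI)
    fix a b assume h: "a \<in> polys_below r" "b \<in> polys_below r" "(u * a) mod ?R = (u * b) mod ?R"
    then have "?R dvd u * (a - b)" by (simp add: mod_eq_dvd_iff right_diff_distrib)
    then have "\<forall>\<rho>\<in>A \<union> B. \<rho> dvd u * (a - b)" using prod_dvd_iff[OF prime_setD[OF prime_set_modulus]] by blast
    then have "\<forall>\<rho>\<in>A \<union> B. \<rho> dvd a - b"
      using u monic_primes_dvd_mult prime_setD(2)[OF prime_set_modulus] by blast
    then have "?R dvd a - b" using prod_dvd_iff[OF prime_setD[OF prime_set_modulus]] by blast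
    then show "a = b" using polys_below_cong_eq[of a ?R b] h degree_modulus by simp
  qed
  moreover have "(\<lambda>a. (u * a) mod ?R) ` polys_below r = polys_below r"
    using inj mod_in_polys_below[OF modulus_nz] degree_modulus
    by (intro card_seteq) (auto simp: card_image)
  ultimately show ?thesis by (simp add: bij_betw_def)
qed

lemma sum_residue_mult:
  fixes F :: "'a poly \<Rightarrow> complex"
  assumes "\<forall>\<rho>\<in>A \<union> B. \<not> \<rho> dvd u"
    and per: "\<And>a b. \<Prod>(A \<union> B) dvd a - b \<Longrightarrow> F a = F b"
  shows "(\<Sum>a\<in>polys_below r. F (u * a)) = (\<Sum>a\<in>polys_below r. F a)"
proof -
  have "(\<Sum>a\<in>polys_below r. F (u * a)) = (\<Sum>a\<in>polys_below r. F ((u * a) mod \<Prod>(A \<union> B)))"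
    by (intro sum.cong refl per) (simp flip: mod_eq_dvd_iff)
  also have "\<dots> = (\<Sum>a\<in>polys_below r. F a)"
    by (rule sum.reindex_bij_betw[OF bij_residue_mult[OF assms(1)]])
  finally show ?thesis .
qed

text \<open>Replace \<open>a\<close> by \<open>u * a\<close> with \<open>u\<close> congruent to
  \<open>1\<close> outside \<open>\<pi>\<close>. The additive character does not notice, since
  \<open>\<pi> dvd b\<close>, whereas the multiplicative one gains a factor different from
  \<open>1\<close>. The case \<open>b = 0\<close> is plain orthogonality.\<close>

lemma twisted_sum_eq_0:
  assumes p: "\<pi> \<in> A \<union> B" "\<pi> dvd b" and k: "k = 1 \<or> k = 2"
  shows "(\<Sum>a\<in>polys_below r. pair_char \<chi> A B a ^ k * echar \<psi> (\<Prod>(A \<union> B)) (a * b)) = 0"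
proof -
  let ?R = "\<Prod>(A \<union> B)" and ?f = "pair_char \<chi> A B"
  obtain u where u: "\<forall>\<rho>\<in>A \<union> B - {\<pi>}. \<rho> dvd u - 1" "\<forall>\<rho>\<in>A \<union> B. \<not> \<rho> dvd u" "?f u ^ 2 \<noteq> 1"
    using exists_nontrivial_residue[OF A B disj p(1)] by blast
  have e: "echar \<psi> ?R ((u * a) * b) = echar \<psi> ?R (a * b)" for a
  proof (rule echar_cong[OF psi])
    have "\<rho> dvd (u * a) * b - a * b" if r: "\<rho> \<in> A \<union> B" for \<rho>
    proof -
      have e: "(u * a) * b - a * b = (u - 1) * (a * b)" by (simp add: algebra_simps)
      show ?thesis
      proof (cases "\<rho> = \<pi>")
        case True then show ?thesis using p by simp
      next
        case False then show ?thesis unfolding e using u r by auto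
      qed
    qed
    then show "?R dvd (u * a) * b - a * b" using prod_dvd_iff[OF prime_setD[OF prime_set_modulus]] by blast
  qed
  let ?F = "\<lambda>a. ?f a ^ k * echar \<psi> ?R (a * b)"
  have "(\<Sum>a\<in>polys_below r. ?F a) = (\<Sum>a\<in>polys_below r. ?F (u * a))"
  proof (rule sum_residue_mult[OF u(2), symmetric])
    fix x y assume xy: "?R dvd x - y"
    then have "?R dvd x * b - y * b" by (metis dvd_mult2 left_diff_distrib)
    then show "?F x = ?F y" using pair_char_cong[OF A B xy] echar_cong[OF psi] by metis
  qed
  also have "\<dots> = ?f u ^ k * (\<Sum>a\<in>polys_below r. ?F a)"
    unfolding e by (simp add: pair_char_mult[OF A B] power_mult_distrib sum_distrib_left mult.assoc)
  finally have "(1 - ?f u ^ k) * (\<Sum>a\<in>polys_below r. ?F a) = 0" by (simp add: algebra_simps)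
  moreover have "?f u ^ k \<noteq> 1" using k u(3) by auto
  ultimately show ?thesis by simp
qed

lemma sum_pair_char_eq_0:
  assumes ne: "A \<union> B \<noteq> {}" and "r \<le> m" and k: "k = 1 \<or> k = 2"
  shows "(\<Sum>M\<in>monic_polys m. pair_char \<chi> A B M ^ k) = 0"
proof -
  obtain \<pi> where "\<pi> \<in> A \<union> B" using ne by blast
  from twisted_sum_eq_0[OF this _ k, of 0]
  have "(\<Sum>a\<in>polys_below r. pair_char \<chi> A B a ^ k) = 0" using echar_0[OF psi] by simp
  moreover have "pair_char \<chi> A B (a + \<Prod>(A \<union> B) * b) = pair_char \<chi> A B a" for a b
    by (intro pair_char_cong A B) simp
  ultimately show ?thesis
    using sum_monic_polys_periodic[OF modulus_monic \<open>r \<le> m\<close>, of "\<lambda>a. pair_char \<chi> A B a ^ k"] by simp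
qed

text \<open>Separability of the Gauss sum of a primitive character: substitution when
  \<open>b\<close> is coprime to the modulus; otherwise both sides vanish.\<close>

lemma twisted_sum:
  "(\<Sum>a\<in>polys_below r. pair_char \<chi> A B a * echar \<psi> (\<Prod>(A \<union> B)) (a * b)) =
     cnj (pair_char \<chi> A B b) * (\<Sum>a\<in>polys_below r. pair_char \<chi> A B a * echar \<psi> (\<Prod>(A \<union> B)) a)"
proof (cases "\<exists>\<pi>\<in>A \<union> B. \<pi> dvd b")
  case True
  then have "pair_char \<chi> A B b = 0" using pair_char_norm[OF A B, of b] by simp
  then show ?thesis using twisted_sum_eq_0[of _ b 1] True by auto
next
  case False
  let ?f = "pair_char \<chi> A B" and ?R = "\<Prod>(A \<union> B)"
  have "?f b * (\<Sum>a\<in>polys_below r. ?f a * echar \<psi> ?R (a * b)) =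
      (\<Sum>a\<in>polys_below r. ?f (b * a) * echar \<psi> ?R (b * a))"
    by (simp add: pair_char_mult[OF A B] sum_distrib_left mult.assoc mult.commute[of b])
      (simp add: ac_simps)
  also have "\<dots> = (\<Sum>a\<in>polys_below r. ?f a * echar \<psi> ?R a)"
  proof (rule sum_residue_mult)
    fix x y assume "?R dvd x - y"
    then show "?f x * echar \<psi> ?R x = ?f y * echar \<psi> ?R y"
      using pair_char_cong[OF A B] echar_cong[OF psi] by metis
  qed (use False in blast)
  finally have e: "?f b * (\<Sum>a\<in>polys_below r. ?f a * echar \<psi> ?R (a * b)) =
      (\<Sum>a\<in>polys_below r. ?f a * echar \<psi> ?R a)" .
  have "cmod (?f b) = 1" using pair_char_norm[OF A B, of b] False by simp
  then have "?f b * cnj (?f b) = 1" by (rule unit_norm_cnj)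
  then show ?thesis unfolding e[symmetric] by (simp add: mult.assoc[symmetric] mult.commute[of "cnj _"])
qed

text \<open>Residues are written as \<open>x * \<Prod>B + y * \<Prod>A\<close>. The cross factors
  \<open>psym \<chi> A (\<Prod>B)\<close> and \<open>cnj (psym \<chi> B (\<Prod>A))\<close> cancel
  by reciprocity, so each remaining factor depends on one of the two sets only.\<close>

lemma twisted_sum_factor:
  "(\<Sum>a\<in>polys_below r. pair_char \<chi> A B a * echar \<psi> (\<Prod>(A \<union> B)) a) =
     gauss_sum \<chi> \<psi> A * cnj (gauss_sum \<chi> \<psi> B)"
proof -
  let ?P = "\<Prod>A" and ?Q = "\<Prod>B" and ?R = "\<Prod>(A \<union> B)"
  let ?a = "pdeg A" and ?b = "pdeg B" and ?f = "pair_char \<chi> A B"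
  have P: "?P \<in> monic_polys ?a" and Q: "?Q \<in> monic_polys ?b"
    using prod_monic_primes prime_setD A B by blast+
  have PQ: "?R = ?P * ?Q" using A B disj by (simp add: prod.union_disjoint prime_set_def)
  have dP: "degree ?P = ?a" and dQ: "degree ?Q = ?b" using P Q by (auto simp: monic_polys_def)
  let ?h = "\<lambda>(x, y). x * ?Q + y * ?P"
  have ndA: "\<not> \<pi> dvd ?Q" if "\<pi> \<in> A" for \<pi>
    using monic_primes_dvd_prod_iff[OF prime_setD[OF B], of \<pi>] that disj prime_setD(2)[OF A] by blast
  have ndB: "\<not> \<pi> dvd ?P" if "\<pi> \<in> B" for \<pi>
    using monic_primes_dvd_prod_iff[OF prime_setD[OF A], of \<pi>] that disj prime_setD(2)[OF B] by blast
  have cancelA: "?P dvd x" if "?P dvd x * ?Q" for x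
  proof -
    have "\<forall>\<pi>\<in>A. \<pi> dvd x * ?Q" using that prod_dvd_iff[OF prime_setD[OF A]] by blast
    then have "\<forall>\<pi>\<in>A. \<pi> dvd x" using ndA monic_primes_dvd_mult prime_setD(2)[OF A] by blast
    then show ?thesis using prod_dvd_iff[OF prime_setD[OF A]] by blast
  qed
  have cancelB: "?Q dvd x" if "?Q dvd x * ?P" for x
  proof -
    have "\<forall>\<pi>\<in>B. \<pi> dvd x * ?P" using that prod_dvd_iff[OF prime_setD[OF B]] by blast
    then have "\<forall>\<pi>\<in>B. \<pi> dvd x" using ndB monic_primes_dvd_mult prime_setD(2)[OF B] by blast
    then show ?thesis using prod_dvd_iff[OF prime_setD[OF B]] by blast
  qed
  have inj: "inj_on ?h (polys_below ?a \<times> polys_below ?b)"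
  proof (rule inj_onI, clarify)
    fix x y x' y' :: "'a poly" assume h: "x \<in> polys_below ?a" "y \<in> polys_below ?b" "x' \<in> polys_below ?a" "y' \<in> polys_below ?b"
      and e: "x * ?Q + y * ?P = x' * ?Q + y' * ?P"
    have e1: "(x - x') * ?Q = ?P * (y' - y)" and e2: "(y - y') * ?P = ?Q * (x' - x)"
      using e by (simp_all add: algebra_simps)
    have "?P dvd x - x'" "?Q dvd y - y'"
      using cancelA[of "x - x'"] cancelB[of "y - y'"] unfolding e1 e2 by auto
    then show "x = x' \<and> y = y'"
      using polys_below_cong_eq[of x ?P x'] polys_below_cong_eq[of y ?Q y'] h dP dQ by simp
  qed
  have "?h ` (polys_below ?a \<times> polys_below ?b) \<subseteq> polys_below r"
  proof clarify
    fix x y :: "'a poly" assume h: "x \<in> polys_below ?a" "y \<in> polys_below ?b"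
    have "x * ?Q \<in> polys_below r" "y * ?P \<in> polys_below r"
      using h degree_mult_le[of x ?Q] degree_mult_le[of y ?P] dP dQ r_def by (auto simp: polys_below_iff)
    then show "x * ?Q + y * ?P \<in> polys_below r" by (rule polys_below_add)
  qed
  then have "?h ` (polys_below ?a \<times> polys_below ?b) = polys_below r"
    by (intro card_seteq) (simp_all add: card_image[OF inj] card_cartesian_product card_polys_below r_def power_add)
  then have bij: "bij_betw ?h (polys_below ?a \<times> polys_below ?b) (polys_below r)"
    using inj by (simp add: bij_betw_def)
  have f: "?f (x * ?Q + y * ?P) = psym \<chi> A x * cnj (psym \<chi> B y)" for x y
  proof -
    have "psym \<chi> A (x * ?Q + y * ?P) = psym \<chi> A (x * ?Q)"
      by (rule psym_cong[OF A]) (use A prime_setD in \<open>auto intro!: dvd_mult dvd_prodI\<close>)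
    moreover have "psym \<chi> B (x * ?Q + y * ?P) = psym \<chi> B (y * ?P)"
      by (rule psym_cong[OF B]) (use B prime_setD in \<open>auto intro!: dvd_mult dvd_prodI\<close>)
    moreover have "psym \<chi> A ?Q * cnj (psym \<chi> B ?P) = 1"
      unfolding psym_reciprocity[OF B A] using psym_norm[OF A, of ?Q] ndA
      by (intro unit_norm_cnj) auto
    ultimately show ?thesis using psym_mult[OF A] psym_mult[OF B]
      by (simp add: pair_char_def mult.assoc)
  qed
  have e: "echar \<psi> ?R (x * ?Q + y * ?P) = echar \<psi> ?P x * echar \<psi> ?Q y" for x y
    unfolding echar_add[OF psi] PQ using echar_mult_monic[OF psi P Q, of x] echar_mult_monic[OF psi Q P, of y]
    by (simp add: mult.commute[of ?P])
  \<comment> \<open>Conjugation puts \<open>- y\<close> into the additive character, and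
    \<open>psym_uminus\<close> removes the sign from the symbol.\<close>
  have g: "cnj (gauss_sum \<chi> \<psi> B) = (\<Sum>y\<in>polys_below ?b. cnj (psym \<chi> B y) * echar \<psi> ?Q y)"
  proof -
    have "cnj (gauss_sum \<chi> \<psi> B) = (\<Sum>y\<in>polys_below ?b. cnj (psym \<chi> B (- y)) * echar \<psi> ?Q (- y))"
      by (simp add: gauss_sum_def psym_uminus[OF B] echar_uminus[OF psi])
    also have "\<dots> = (\<Sum>y\<in>polys_below ?b. cnj (psym \<chi> B y) * echar \<psi> ?Q y)"
      by (rule sum.reindex_bij_witness[of _ uminus uminus]) (auto intro: polys_below_uminus)
    finally show ?thesis .
  qed
  have "(\<Sum>a\<in>polys_below r. ?f a * echar \<psi> ?R a) =
      (\<Sum>z\<in>polys_below ?a \<times> polys_below ?b. ?f (?h z) * echar \<psi> ?R (?h z))"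
    by (rule sum.reindex_bij_betw[OF bij, symmetric])
  also have "\<dots> = (\<Sum>x\<in>polys_below ?a. \<Sum>y\<in>polys_below ?b.
      (psym \<chi> A x * echar \<psi> ?P x) * (cnj (psym \<chi> B y) * echar \<psi> ?Q y))"
    unfolding sum.cartesian_product by (intro sum.cong refl) (auto simp: f e)
  also have "\<dots> = gauss_sum \<chi> \<psi> A * cnj (gauss_sum \<chi> \<psi> B)"
    unfolding g by (simp add: gauss_sum_def sum_product)
  finally show ?thesis .
qed

text \<open>Fourier inversion: with respect to \<open>\<psi> (res (a b / R))\<close> the annihilator of \<open>polys_below m\<close> is
  \<open>polys_below (r - m)\<close>.\<close>

lemma functional_equation:
  assumes deg: "pdeg A = pdeg B" and ne: "A \<union> B \<noteq> {}"
  shows "(\<Sum>M\<in>monic_polys m. pair_char \<chi> A B M) =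
    of_nat CARD('a) ^ m / of_nat CARD('a) ^ r * (gauss_sum \<chi> \<psi> A * cnj (gauss_sum \<chi> \<psi> B)) *
      (\<Sum>k<r - m. dual_weight \<psi> (r - m) k * (\<Sum>N\<in>monic_polys k. cnj (pair_char \<chi> A B N)))"
proof (cases "r \<le> m")
  case True
  \<comment> \<open>The dual sum is empty here, and the left side is a sum over complete residue
    systems.\<close>
  then show ?thesis using sum_pair_char_eq_0[OF ne True, of 1] by simp
next
  case False
  let ?R = "\<Prod>(A \<union> B)" and ?f = "pair_char \<chi> A B" and ?q = "of_nat CARD('a) :: complex"
  define s where "s = r - m"
  have s: "s \<le> r" "r - s = m" "0 < s" "m < r" using False by (auto simp: s_def)
  \<comment> \<open>Monic polynomials of degree \<open>m\<close> form the translate of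
    \<open>polys_below m\<close> by \<open>t^m\<close>; the translation becomes the phase
    \<open>echar \<psi> ?R (- (?t * b))\<close> on the dual side.\<close>
  let ?t = "monom 1 m :: 'a poly"
  have tr: "?t \<in> polys_below r" using s by (auto simp: polys_below_iff degree_monom_eq)
  have "\<exists>\<pi>\<in>A \<union> B. \<pi> dvd 0" using ne by auto
  then have f0: "?f 0 = 0" using pair_char_norm[OF A B, of 0] by simp
  have monic: "(a \<in> monic_polys m) = (a - ?t \<in> polys_below m)" for a
  proof
    assume "a - ?t \<in> polys_below m"
    then show "a \<in> monic_polys m" unfolding monic_polys_eq by (intro image_eqI[of _ _ "a - ?t"]) auto
  qed (auto simp: monic_polys_eq)
  have sub: "monic_polys m \<subseteq> polys_below r"
    using s by (auto simp: monic_polys_def polys_below_iff)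
  \<comment> \<open>The phase depends only on the coefficient of \<open>t^(r - 1)\<close> in
    \<open>t^m * (c N)\<close>, that is of \<open>t^(s - 1)\<close> in \<open>c N\<close>: it is
    \<open>c\<close> in the top degree and \<open>0\<close> below.\<close>
  have e: "echar \<psi> ?R (- (?t * smult c N)) = \<psi> (- (if k = s - 1 then c else 0))"
    if c: "c \<noteq> 0" and N: "N \<in> monic_polys k" and k: "k < s" for c k N
  proof -
    have dN: "degree N = k" "coeff N k = 1" using N by (auto simp: monic_polys_def)
    have "degree (?t * smult c N) \<le> m + k"
      using degree_mult_le[of ?t "smult c N"] dN by (simp add: degree_monom_eq c)
    then have "?t * smult c N \<in> polys_below r" using k s by (auto simp: polys_below_iff)
    then have m: "(- (?t * smult c N)) mod ?R = - (?t * smult c N)"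
      using polys_below_uminus degree_modulus by (intro mod_polys_below) auto
    have "coeff (?t * smult c N) (m + (s - 1)) = coeff ?t m * coeff (smult c N) (s - 1)"
      using dN k by (intro coeff_mult_degree_le_sum) (auto simp: degree_monom_eq)
    moreover have "coeff N (s - 1) = (if k = s - 1 then 1 else 0)"
      using dN k by (auto intro: coeff_eq_0)
    ultimately have "coeff (?t * smult c N) (r - 1) = (if k = s - 1 then c else 0)"
      using s by (auto simp: s_def)
    then show ?thesis unfolding echar_def m degree_modulus by simp
  qed
  have "(\<Sum>b\<in>polys_below s. echar \<psi> ?R (- (?t * b)) * cnj (?f b)) =
      (\<Sum>k<s. \<Sum>c\<in>UNIV - {0}. \<Sum>N\<in>monic_polys k. echar \<psi> ?R (- (?t * smult c N)) * cnj (?f (smult c N)))"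
    by (rule sum_polys_below_by_leading_term) (simp add: f0)
  also have "\<dots> = (\<Sum>k<s. dual_weight \<psi> s k * (\<Sum>N\<in>monic_polys k. cnj (?f N)))"
    unfolding dual_weight_def sum_product
    by (intro sum.cong refl) (auto simp: e[unfolded mult_smult_right] pair_char_smult[OF A B deg])
  finally have dual: "(\<Sum>b\<in>polys_below s. echar \<psi> ?R (- (?t * b)) * cnj (?f b)) = \<dots>" .
  \<comment> \<open>By \<open>sum_echar\<close> the inner sum is \<open>q^s\<close> times the
    indicator of \<open>a - t^m \<in> polys_below m\<close>.\<close>
  have "?q ^ s * (\<Sum>M\<in>monic_polys m. ?f M) = (\<Sum>a\<in>polys_below r. ?f a * (\<Sum>b\<in>polys_below s. echar \<psi> ?R ((a - ?t) * b)))"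
  proof -
    have "(\<Sum>a\<in>polys_below r. ?f a * (\<Sum>b\<in>polys_below s. echar \<psi> ?R ((a - ?t) * b))) =
      (\<Sum>a\<in>polys_below r. if a \<in> monic_polys m then ?f a * ?q ^ s else 0)"
      using s by (intro sum.cong refl)
        (simp add: sum_echar[OF psi modulus_monic s(1)] polys_below_diff tr monic)
    also have "\<dots> = (\<Sum>a\<in>polys_below r \<inter> monic_polys m. ?f a * ?q ^ s)"
      by (simp add: sum.inter_restrict)
    also have "polys_below r \<inter> monic_polys m = (monic_polys m :: 'a poly set)" using sub by blast
    finally show ?thesis by (simp only: sum_distrib_left mult.commute)
  qed
  also have "\<dots> = (\<Sum>b\<in>polys_below s. echar \<psi> ?R (- (?t * b)) * (\<Sum>a\<in>polys_below r. ?f a * echar \<psi> ?R (a * b)))"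
  proof -
    have "echar \<psi> ?R ((a - ?t) * b) = echar \<psi> ?R (- (?t * b)) * echar \<psi> ?R (a * b)" for a b
      unfolding echar_add[OF psi, symmetric] by (simp add: algebra_simps)
    then show ?thesis unfolding sum_distrib_left by (subst sum.swap) (simp add: ac_simps)
  qed
  also have "\<dots> = (gauss_sum \<chi> \<psi> A * cnj (gauss_sum \<chi> \<psi> B)) *
      (\<Sum>b\<in>polys_below s. echar \<psi> ?R (- (?t * b)) * cnj (?f b))"
    unfolding twisted_sum twisted_sum_factor sum_distrib_left by (intro sum.cong refl) (simp add: ac_simps)
  finally have main: "?q ^ s * (\<Sum>M\<in>monic_polys m. ?f M) = (gauss_sum \<chi> \<psi> A * cnj (gauss_sum \<chi> \<psi> B)) *
      (\<Sum>k<s. dual_weight \<psi> s k * (\<Sum>N\<in>monic_polys k. cnj (?f N)))" unfolding dual .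
  have q0: "?q \<noteq> 0" by simp
  have "?q ^ r = ?q ^ m * ?q ^ s" using s by (simp add: s_def flip: power_add)
  then have "(\<Sum>M\<in>monic_polys m. ?f M) = ?q ^ m / ?q ^ r * (?q ^ s * (\<Sum>M\<in>monic_polys m. ?f M))"
    using q0 by simp
  then show ?thesis unfolding main s_def[symmetric] by simp
qed

end

text \<open>The second moment of the twisted sums over all \<open>b\<close> is computed twice, by
  separability and by orthogonality of \<open>echar\<close>. Both results contain the factor
  \<open>\<Phi>\<close>, the number of units modulo \<open>\<Prod>S\<close>.\<close>

lemma gauss_sum_norm:
  assumes psi: "additive_character \<psi>" and S: "prime_set S"
  shows "(cmod (gauss_sum \<chi> \<psi> S))\<^sup>2 = real CARD('a) ^ pdeg S"
proof -
  let ?r = "pdeg S" and ?q = "of_nat CARD('a) :: complex"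
  \<comment> \<open>With an empty second set \<open>pair_char \<chi> S {}\<close> is
    \<open>psym \<chi> S\<close>, so the results on pairs apply.\<close>
  have E: "prime_set ({} :: 'a poly set)" by (simp add: prime_set_def)
  have rd: "?r = pdeg S + pdeg ({} :: 'a poly set)" by (simp add: pdeg_def)
  define R where "R = \<Prod>S"
  have R: "R \<in> monic_polys ?r" unfolding R_def by (rule prod_monic_primes[OF prime_setD[OF S]])
  let ?f = "psym \<chi> S" and ?V = "polys_below ?r :: 'a poly set" and ?g = "gauss_sum \<chi> \<psi> S"
  have f: "pair_char \<chi> S {} a = ?f a" for a by (simp add: pair_char_def)
  define G where "G b = (\<Sum>a\<in>?V. ?f a * echar \<psi> R (a * b))" for b
  define \<Phi> where "\<Phi> = (\<Sum>a\<in>?V. (cmod (?f a))\<^sup>2)"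
  have G: "G b = cnj (?f b) * ?g" for b
    using twisted_sum[OF psi S E _ rd, of b] by (simp add: f G_def R_def gauss_sum_def)
  have 1: "(\<Sum>b\<in>?V. (cmod (G b))\<^sup>2) = \<Phi> * (cmod ?g)\<^sup>2"
    by (simp add: G \<Phi>_def norm_mult power_mult_distrib sum_distrib_right)
  have "of_real (\<Sum>b\<in>?V. (cmod (G b))\<^sup>2) = (\<Sum>b\<in>?V. G b * cnj (G b))"
    by (simp only: of_real_sum complex_norm_square)
  also have "\<dots> = (\<Sum>b\<in>?V. \<Sum>a\<in>?V. \<Sum>a'\<in>?V. ?f a * cnj (?f a') * echar \<psi> R ((a - a') * b))"
  proof (intro sum.cong refl)
    fix b
    have "echar \<psi> R ((a - a') * b) = echar \<psi> R (a * b) * cnj (echar \<psi> R (a' * b))" for a a'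
      unfolding echar_uminus[OF psi, symmetric] echar_add[OF psi, symmetric] by (simp add: algebra_simps)
    then show "G b * cnj (G b) = (\<Sum>a\<in>?V. \<Sum>a'\<in>?V. ?f a * cnj (?f a') * echar \<psi> R ((a - a') * b))"
      by (simp add: G_def sum_product ac_simps)
  qed
  also have "\<dots> = (\<Sum>a\<in>?V. \<Sum>a'\<in>?V. ?f a * cnj (?f a') * (\<Sum>b\<in>?V. echar \<psi> R ((a - a') * b)))"
    unfolding sum_distrib_left by (rule trans[OF sum.swap], rule sum.cong[OF refl], rule sum.swap)
  also have "\<dots> = (\<Sum>a\<in>?V. \<Sum>a'\<in>?V. if a = a' then ?f a * cnj (?f a') * ?q ^ ?r else 0)"
    by (intro sum.cong refl) (simp add: sum_echar[OF psi R] polys_below_diff)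
  also have "\<dots> = of_real (\<Phi> * real CARD('a) ^ ?r)"
    by (simp add: \<Phi>_def sum_distrib_right complex_norm_square[simplified])
  finally have "\<Phi> * (cmod ?g)\<^sup>2 = \<Phi> * real CARD('a) ^ ?r" unfolding 1 of_real_eq_iff .
  moreover have "\<Phi> > 0"
  proof -
    have R0: "R \<noteq> 0" using R monic_polys_nz by blast
    \<comment> \<open>\<open>1 mod R\<close> instead of \<open>1\<close>: for \<open>S = {}\<close>
      the modulus is \<open>1\<close> and the only residue is \<open>0\<close>.\<close>
    have in_V: "1 mod R \<in> ?V" using mod_in_polys_below[OF R0, of 1] R by (simp add: monic_polys_def)
    have "R dvd 1 - 1 mod R" by (simp add: minus_mod_eq_mult_div)
    then have "\<forall>\<pi>\<in>S. \<pi> dvd 1 - 1 mod R" unfolding R_def using prod_dvd_iff[OF prime_setD[OF S]] by blast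
    then have "?f 1 = ?f (1 mod R)" by (intro psym_cong[OF S]) blast
    then have "(cmod (?f (1 mod R)))\<^sup>2 = 1" using psym_1[OF S] by simp
    moreover have "(cmod (?f (1 mod R)))\<^sup>2 \<le> \<Phi>" unfolding \<Phi>_def using in_V by (intro member_le_sum) auto
    ultimately show ?thesis by linarith
  qed
  ultimately show ?thesis by simp
qed

end

lemma dual_weight_norm:
  fixes \<psi> :: "'a::{field,finite} \<Rightarrow> complex"
  assumes "additive_character \<psi>"
  shows "cmod (dual_weight \<psi> s k) \<le> real CARD('a)"
proof -
  have "cmod (dual_weight \<psi> s k) \<le> (\<Sum>c\<in>UNIV - {0 :: 'a}. 1)"
    unfolding dual_weight_def by (intro sum_norm_le) (simp add: psi_norm[OF assms])
  also have "\<dots> \<le> real CARD('a)" by (simp add: card_Diff_singleton)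
  finally show ?thesis .
qed

section \<open>Large sieve inequalities\<close>

lemma sum_alternating_Pow:
  assumes "finite A"
  shows "(\<Sum>Y\<in>Pow A. (-1) ^ card Y) = (if A = {} then 1 else 0 :: complex)"
  using prod_add[OF assms, of "\<lambda>_. -1 :: complex" "\<lambda>_. 1"] assms
  by (cases "A = {}") (simp_all add: zero_power card_gt_0_iff)

lemma complex_Cauchy_Schwarz:
  fixes x y :: "'i \<Rightarrow> complex"
  shows "(cmod (\<Sum>i\<in>I. x i * y i))\<^sup>2 \<le> (\<Sum>i\<in>I. (cmod (x i))\<^sup>2) * (\<Sum>i\<in>I. (cmod (y i))\<^sup>2)"
proof -
  have "cmod (\<Sum>i\<in>I. x i * y i) \<le> (\<Sum>i\<in>I. \<bar>cmod (x i)\<bar> * \<bar>cmod (y i)\<bar>)"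
    by (rule sum_norm_le) (simp add: norm_mult)
  also have "\<dots> \<le> L2_set (\<lambda>i. cmod (x i)) I * L2_set (\<lambda>i. cmod (y i)) I"
    by (rule L2_set_mult_ineq)
  finally have "(cmod (\<Sum>i\<in>I. x i * y i))\<^sup>2 \<le> (L2_set (\<lambda>i. cmod (x i)) I * L2_set (\<lambda>i. cmod (y i)) I)\<^sup>2"
    by (intro power_mono) auto
  then show ?thesis by (simp add: power_mult_distrib L2_set_def sum_nonneg)
qed

text \<open>Used with \<open>u j = cnj (y j)\<close>, the hypothesis and Cauchy-Schwarz give
  \<open>T^2 \<le> K * B * T\<close> for the left side \<open>T\<close>; division by
  \<open>T\<close> finishes.\<close>

lemma large_sieve_duality:
  fixes a :: "'i \<Rightarrow> 'j \<Rightarrow> complex"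
  assumes "B \<ge> 0"
    and ls: "\<And>u. (\<Sum>i\<in>I. (cmod (\<Sum>j\<in>J. u j * a i j))\<^sup>2) \<le> B * (\<Sum>j\<in>J. (cmod (u j))\<^sup>2)"
  shows "(\<Sum>j\<in>J. (cmod (\<Sum>i\<in>I. v i * a i j))\<^sup>2) \<le> B * (\<Sum>i\<in>I. (cmod (v i))\<^sup>2)"
proof -
  define y where "y j = (\<Sum>i\<in>I. v i * a i j)" for j
  define T where "T = (\<Sum>j\<in>J. (cmod (y j))\<^sup>2)"
  define K where "K = (\<Sum>i\<in>I. (cmod (v i))\<^sup>2)"
  have T0: "T \<ge> 0" "K \<ge> 0" by (simp_all add: T_def K_def sum_nonneg)
  have "of_real T = (\<Sum>j\<in>J. y j * cnj (y j))" unfolding T_def of_real_sum complex_norm_square ..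
  also have "\<dots> = (\<Sum>j\<in>J. \<Sum>i\<in>I. v i * (cnj (y j) * a i j))"
    by (intro sum.cong refl) (simp add: y_def sum_distrib_right ac_simps)
  also have "\<dots> = (\<Sum>i\<in>I. v i * (\<Sum>j\<in>J. cnj (y j) * a i j))"
    by (subst sum.swap) (simp add: sum_distrib_left)
  finally have e: "of_real T = (\<Sum>i\<in>I. v i * (\<Sum>j\<in>J. cnj (y j) * a i j))" .
  have "T\<^sup>2 = (cmod (of_real T))\<^sup>2" by simp
  also have "\<dots> \<le> K * (\<Sum>i\<in>I. (cmod (\<Sum>j\<in>J. cnj (y j) * a i j))\<^sup>2)"
    unfolding e K_def by (rule complex_Cauchy_Schwarz)
  also have "\<dots> \<le> K * (B * T)"
    using ls[of "\<lambda>j. cnj (y j)"] T0 by (intro mult_left_mono) (auto simp: T_def)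
  finally have "T * T \<le> (B * K) * T" by (simp add: power2_eq_square ac_simps)
  then have "T \<le> B * K" using T0 \<open>B \<ge> 0\<close> by (cases "T = 0") auto
  then show ?thesis by (simp add: T_def y_def K_def)
qed

lemma sum_norm_square_expand:
  fixes a :: "'i \<Rightarrow> 'j \<Rightarrow> complex"
  shows "of_real (\<Sum>i\<in>I. (cmod (\<Sum>j\<in>J. u j * a i j))\<^sup>2) =
    (\<Sum>j\<in>J. \<Sum>j'\<in>J. u j * cnj (u j') * (\<Sum>i\<in>I. a i j * cnj (a i j')))"
proof -
  have "of_real (\<Sum>i\<in>I. (cmod (\<Sum>j\<in>J. u j * a i j))\<^sup>2) =
      (\<Sum>i\<in>I. \<Sum>j\<in>J. \<Sum>j'\<in>J. u j * cnj (u j') * (a i j * cnj (a i j')))"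
    unfolding of_real_sum complex_norm_square by (simp add: sum_product ac_simps)
  also have "\<dots> = (\<Sum>j\<in>J. \<Sum>i\<in>I. \<Sum>j'\<in>J. u j * cnj (u j') * (a i j * cnj (a i j')))"
    by (rule sum.swap)
  also have "\<dots> = (\<Sum>j\<in>J. \<Sum>j'\<in>J. \<Sum>i\<in>I. u j * cnj (u j') * (a i j * cnj (a i j')))"
    by (rule sum.cong[OF refl], rule sum.swap)
  finally show ?thesis by (simp add: sum_distrib_left)
qed

lemma large_sieve_orthogonal:
  fixes a :: "'i \<Rightarrow> 'j \<Rightarrow> complex"
  assumes J: "finite J"
    and orth: "\<And>j j'. j \<in> J \<Longrightarrow> j' \<in> J \<Longrightarrow> j \<noteq> j' \<Longrightarrow> (\<Sum>i\<in>I. a i j * cnj (a i j')) = 0"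
    and K: "\<And>j. j \<in> J \<Longrightarrow> (\<Sum>i\<in>I. (cmod (a i j))\<^sup>2) \<le> K"
  shows "(\<Sum>i\<in>I. (cmod (\<Sum>j\<in>J. u j * a i j))\<^sup>2) \<le> K * (\<Sum>j\<in>J. (cmod (u j))\<^sup>2)"
proof -
  have "of_real (\<Sum>i\<in>I. (cmod (\<Sum>j\<in>J. u j * a i j))\<^sup>2) =
      (\<Sum>j\<in>J. \<Sum>j'\<in>J. if j = j' then u j * cnj (u j') * (\<Sum>i\<in>I. a i j * cnj (a i j')) else 0)"
    unfolding sum_norm_square_expand by (intro sum.cong refl) (auto simp: orth)
  also have "\<dots> = (\<Sum>j\<in>J. of_real ((cmod (u j))\<^sup>2 * (\<Sum>i\<in>I. (cmod (a i j))\<^sup>2)))"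
    using J by (simp only: sum.delta' if_True of_real_mult of_real_sum complex_norm_square cong: sum.cong)
  finally have "(\<Sum>i\<in>I. (cmod (\<Sum>j\<in>J. u j * a i j))\<^sup>2) = (\<Sum>j\<in>J. (cmod (u j))\<^sup>2 * (\<Sum>i\<in>I. (cmod (a i j))\<^sup>2))"
    by (simp only: of_real_sum[symmetric] of_real_eq_iff)
  also have "\<dots> \<le> (\<Sum>j\<in>J. (cmod (u j))\<^sup>2 * K)" by (intro sum_mono mult_left_mono K) auto
  finally show ?thesis by (simp add: sum_distrib_left mult.commute)
qed

section \<open>Sieve constants and correlations of symbols\<close>

definition large_sieve ::
    "('a::{field,finite} poly \<Rightarrow> 'a poly \<Rightarrow> complex) \<Rightarrow> nat \<Rightarrow> nat \<Rightarrow> real \<Rightarrow> bool" where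
  "large_sieve \<chi> m n B \<longleftrightarrow> (\<forall>u. (\<Sum>M\<in>monic_polys m. (cmod (\<Sum>S\<in>psets n. u S * psym \<chi> S M))\<^sup>2)
     \<le> B * (\<Sum>S\<in>psets n. (cmod (u S))\<^sup>2))"

text \<open>With both variables square-free the kernel \<open>psym \<chi> S (\<Prod>T)\<close> is
  symmetric by reciprocity, so that duality exchanges \<open>m\<close> and \<open>n\<close>.\<close>

definition squarefree_sieve ::
    "('a::{field,finite} poly \<Rightarrow> 'a poly \<Rightarrow> complex) \<Rightarrow> nat \<Rightarrow> nat \<Rightarrow> real \<Rightarrow> bool" where
  "squarefree_sieve \<chi> m n B \<longleftrightarrow> (\<forall>u. (\<Sum>T\<in>psets m. (cmod (\<Sum>S\<in>psets n. u S * psym \<chi> S (\<Prod>T)))\<^sup>2)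
     \<le> B * (\<Sum>S\<in>psets n. (cmod (u S))\<^sup>2))"

lemma large_sieve_mono: "large_sieve \<chi> m n B \<Longrightarrow> B \<le> B' \<Longrightarrow> large_sieve \<chi> m n B'"
  unfolding large_sieve_def by (meson mult_right_mono order_trans sum_nonneg zero_le_power2)

lemma psets_prime_set: "S \<in> psets n \<Longrightarrow> prime_set S" and psets_pdeg: "S \<in> psets n \<Longrightarrow> pdeg S = n"
  by (auto simp: psets_def prime_set_def)

lemma prime_set_psets: "prime_set S \<Longrightarrow> S \<in> psets (pdeg S)"
  by (auto simp: psets_def prime_set_def)

lemma sum_psets_le_sum_monic_polys:
  fixes f :: "'a::{field,finite} poly \<Rightarrow> real"
  assumes "\<And>M. 0 \<le> f M"
  shows "(\<Sum>T\<in>psets m. f (\<Prod>T)) \<le> (\<Sum>M\<in>monic_polys m. f M)"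
proof -
  have "(\<Sum>T\<in>psets m. f (\<Prod>T)) = (\<Sum>M\<in>(\<lambda>S. \<Prod>S) ` psets m. f M)"
    by (simp add: sum.reindex[OF inj_on_prod_psets])
  also have "\<dots> \<le> (\<Sum>M\<in>monic_polys m. f M)"
    using prod_psets assms by (intro sum_mono2) auto
  finally show ?thesis .
qed

lemma card_psets_le: "real (card (psets n :: 'a::{field,finite} poly set set)) \<le> real CARD('a) ^ n"
  using sum_psets_le_sum_monic_polys[of "\<lambda>_ :: 'a poly. 1" n] by (simp add: card_monic_polys)

lemma large_sieve_imp_squarefree_sieve: "large_sieve \<chi> m n B \<Longrightarrow> squarefree_sieve \<chi> m n B"
  unfolding large_sieve_def squarefree_sieve_def
  by (intro allI order_trans[OF sum_psets_le_sum_monic_polys]) auto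

lemma prime_set_Int: "prime_set S \<Longrightarrow> prime_set (S \<inter> T)"
  and prime_set_Diff: "prime_set S \<Longrightarrow> prime_set (S - T)"
  by (auto simp: prime_set_def)

lemma pdeg_mono: "prime_set S \<Longrightarrow> E \<subseteq> S \<Longrightarrow> pdeg E \<le> pdeg S"
  unfolding pdeg_def by (intro sum_mono2) (auto simp: prime_set_def)

lemma pdeg_Diff: "prime_set S \<Longrightarrow> D \<subseteq> S \<Longrightarrow> pdeg (S - D) = pdeg S - pdeg D"
  unfolding pdeg_def by (intro sum_diff_nat) (auto simp: prime_set_def intro: finite_subset)

text \<open>Moebius inversion: the \<open>E \<subseteq> D\<close> with \<open>\<Prod>E dvd M\<close>
  are the subsets of the set of primes in \<open>D\<close> dividing \<open>M\<close>, and their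
  alternating sum vanishes unless that set is empty.\<close>

lemma sum_coprime:
  fixes F :: "'a::{field,finite} poly \<Rightarrow> complex"
  assumes D: "prime_set D"
  shows "(\<Sum>M\<in>monic_polys m. (if \<forall>\<pi>\<in>D. \<not> \<pi> dvd M then F M else 0)) =
    (\<Sum>E | E \<subseteq> D \<and> pdeg E \<le> m. (-1) ^ card E * (\<Sum>N\<in>monic_polys (m - pdeg E). F (\<Prod>E * N)))"
proof -
  have fin: "finite D" using prime_setD[OF D] by blast
  have "(\<Sum>M\<in>monic_polys m. (if \<forall>\<pi>\<in>D. \<not> \<pi> dvd M then F M else 0)) =
      (\<Sum>M\<in>monic_polys m. \<Sum>E\<in>Pow D. if \<Prod>E dvd M then (-1) ^ card E * F M else 0)"
  proof (intro sum.cong refl)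
    fix M :: "'a poly"
    define D' where "D' = {\<pi>\<in>D. \<pi> dvd M}"
    have "\<Prod>E dvd M \<longleftrightarrow> E \<subseteq> D'" if "E \<subseteq> D" for E
      using prod_dvd_iff[OF prime_setD[OF prime_set_subset[OF D that]], of M] that by (auto simp: D'_def)
    then have "(\<Sum>E\<in>Pow D. if \<Prod>E dvd M then (-1) ^ card E * F M else 0) =
        (\<Sum>E\<in>Pow D. if E \<in> Pow D' then (-1) ^ card E * F M else 0)"
      by (intro sum.cong refl) auto
    also have "\<dots> = (\<Sum>E\<in>Pow D \<inter> Pow D'. (-1) ^ card E * F M)"
      using fin by (simp add: sum.inter_restrict)
    also have "Pow D \<inter> Pow D' = Pow D'" by (auto simp: D'_def)
    also have "(\<Sum>E\<in>Pow D'. (-1) ^ card E * F M) = (if D' = {} then 1 else 0) * F M"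
      using fin sum_alternating_Pow[of D'] by (simp add: D'_def flip: sum_distrib_right)
    also have "\<dots> = (if \<forall>\<pi>\<in>D. \<not> \<pi> dvd M then F M else 0)" by (auto simp: D'_def)
    finally show "(if \<forall>\<pi>\<in>D. \<not> \<pi> dvd M then F M else 0) = (\<Sum>E\<in>Pow D. if \<Prod>E dvd M then (-1) ^ card E * F M else 0)" ..
  qed
  also have "\<dots> = (\<Sum>E\<in>Pow D. (-1) ^ card E * (\<Sum>M | M \<in> monic_polys m \<and> \<Prod>E dvd M. F M))"
    by (rule trans[OF sum.swap], rule sum.cong[OF refl])
      (simp add: sum_distrib_left sum.inter_filter, intro sum.cong refl, simp)
  also have "\<dots> = (\<Sum>E\<in>Pow D. if pdeg E \<le> m then (-1) ^ card E * (\<Sum>N\<in>monic_polys (m - pdeg E). F (\<Prod>E * N)) else 0)"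
  proof (intro sum.cong refl)
    fix E assume "E \<in> Pow D"
    then have "prime_set E" using prime_set_subset[OF D] by simp
    then have E: "\<Prod>E \<in> monic_polys (pdeg E)" by (intro prod_monic_primes prime_setD)
    have E0: "\<Prod>E \<noteq> 0" using E monic_polys_nz by blast
    have "(\<Sum>M | M \<in> monic_polys m \<and> \<Prod>E dvd M. F M) = (if pdeg E \<le> m then \<Sum>N\<in>monic_polys (m - pdeg E). F (\<Prod>E * N) else 0)"
    proof (cases "pdeg E \<le> m")
      case True
      have "(\<Sum>N\<in>monic_polys (m - pdeg E). F (\<Prod>E * N)) = (\<Sum>M\<in>(*) (\<Prod>E) ` monic_polys (m - pdeg E). F M)"
        using E0 by (subst sum.reindex) (auto simp: inj_on_def)
      also have "(*) (\<Prod>E) ` monic_polys (m - pdeg E) = {M. M \<in> monic_polys m \<and> \<Prod>E dvd M}"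
        using monic_polys_mult[OF E, of _ "m - pdeg E"] True monic_polys_dvd_cofactor[OF E]
        by (auto simp: image_iff elim!: dvdE)
      finally show ?thesis using True by simp
    next
      case False
      then have empty: "{M. M \<in> monic_polys m \<and> \<Prod>E dvd M} = {}"
        using monic_polys_dvd_cofactor[OF E] by (auto elim!: dvdE)
      show ?thesis unfolding empty using False by simp
    qed
    then show "(-1) ^ card E * (\<Sum>M | M \<in> monic_polys m \<and> \<Prod>E dvd M. F M) =
        (if pdeg E \<le> m then (-1) ^ card E * (\<Sum>N\<in>monic_polys (m - pdeg E). F (\<Prod>E * N)) else 0)" by simp
  qed
  also have "\<dots> = (\<Sum>E\<in>{E\<in>Pow D. pdeg E \<le> m}. (-1) ^ card E * (\<Sum>N\<in>monic_polys (m - pdeg E). F (\<Prod>E * N)))"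
    using fin by (intro sum.inter_filter[symmetric]) simp
  finally show ?thesis by (simp add: Pow_def)
qed

context
  fixes \<chi> :: "'a::{field,finite} poly \<Rightarrow> 'a poly \<Rightarrow> complex"
  assumes sys: "symbol_system \<chi>"
begin

lemma squarefree_sieve_sym:
  assumes "B \<ge> 0" "squarefree_sieve \<chi> m n B"
  shows "squarefree_sieve \<chi> n m B"
  unfolding squarefree_sieve_def
proof
  fix v :: "'a poly set \<Rightarrow> complex"
  have "(\<Sum>S\<in>psets n. (cmod (\<Sum>T\<in>psets m. v T * psym \<chi> S (\<Prod>T)))\<^sup>2) \<le> B * (\<Sum>T\<in>psets m. (cmod (v T))\<^sup>2)"
    by (rule large_sieve_duality[OF assms(1)]) (use assms(2) in \<open>simp add: squarefree_sieve_def\<close>)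
  moreover have "(\<Sum>T\<in>psets m. v T * psym \<chi> S (\<Prod>T)) = (\<Sum>T\<in>psets m. v T * psym \<chi> T (\<Prod>S))" if "S \<in> psets n" for S
    using that by (intro sum.cong refl) (simp add: psym_reciprocity[OF sys psets_prime_set psets_prime_set])
  ultimately show "(\<Sum>S\<in>psets n. (cmod (\<Sum>T\<in>psets m. v T * psym \<chi> T (\<Prod>S)))\<^sup>2) \<le> B * (\<Sum>T\<in>psets m. (cmod (v T))\<^sup>2)"
    by simp
qed

text \<open>On the common primes the symbol meets its own conjugate, which leaves the coprimality
  condition alone.\<close>

lemma psym_pair:
  assumes S: "prime_set S" and T: "prime_set T"
  shows "psym \<chi> S M * cnj (psym \<chi> T M) =
    (if \<forall>\<pi>\<in>S \<inter> T. \<not> \<pi> dvd M then pair_char \<chi> (S - T) (T - S) M else 0)"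
proof -
  have D: "prime_set (S \<inter> T)" "prime_set (S - T)" "prime_set (T - S)"
    using S T by (auto intro: prime_set_Int prime_set_Diff)
  have "psym \<chi> S M = psym \<chi> ((S \<inter> T) \<union> (S - T)) M" "psym \<chi> T M = psym \<chi> ((S \<inter> T) \<union> (T - S)) M"
    by (auto intro!: arg_cong[of _ _ "\<lambda>S. psym \<chi> S M"])
  then have "psym \<chi> S M = psym \<chi> (S \<inter> T) M * psym \<chi> (S - T) M"
    "psym \<chi> T M = psym \<chi> (S \<inter> T) M * psym \<chi> (T - S) M"
    using psym_Un[OF sys D(1,2)] psym_Un[OF sys D(1,3)] by auto
  then have e: "psym \<chi> S M * cnj (psym \<chi> T M) =
      (psym \<chi> (S \<inter> T) M * cnj (psym \<chi> (S \<inter> T) M)) * pair_char \<chi> (S - T) (T - S) M"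
    by (simp add: pair_char_def)
  have n: "cmod (psym \<chi> (S \<inter> T) M) = (if \<exists>\<pi>\<in>S \<inter> T. \<pi> dvd M then 0 else 1)"
    by (rule psym_norm[OF sys D(1)])
  show ?thesis
  proof (cases "\<exists>\<pi>\<in>S \<inter> T. \<pi> dvd M")
    case True
    then show ?thesis unfolding e using n by auto
  next
    case False
    then have "psym \<chi> (S \<inter> T) M * cnj (psym \<chi> (S \<inter> T) M) = 1" using n by (intro unit_norm_cnj) simp
    then show ?thesis unfolding e using False by auto
  qed
qed

lemma sum_psym_pair:
  assumes S: "prime_set S" and T: "prime_set T" and k: "k > 0"
  shows "(\<Sum>M\<in>monic_polys m. (psym \<chi> S M * cnj (psym \<chi> T M)) ^ k) =
    (\<Sum>E | E \<subseteq> S \<inter> T \<and> pdeg E \<le> m. (-1) ^ card E * pair_char \<chi> (S - T) (T - S) (\<Prod>E) ^ k *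
        (\<Sum>N\<in>monic_polys (m - pdeg E). pair_char \<chi> (S - T) (T - S) N ^ k))"
proof -
  have D: "prime_set (S \<inter> T)" "prime_set (S - T)" "prime_set (T - S)"
    using S T by (auto intro: prime_set_Int prime_set_Diff)
  have "(\<Sum>M\<in>monic_polys m. (psym \<chi> S M * cnj (psym \<chi> T M)) ^ k) =
      (\<Sum>M\<in>monic_polys m. if \<forall>\<pi>\<in>S \<inter> T. \<not> \<pi> dvd M then pair_char \<chi> (S - T) (T - S) M ^ k else 0)"
    using k by (intro sum.cong refl) (auto simp: psym_pair[OF S T])
  also have "\<dots> = (\<Sum>E | E \<subseteq> S \<inter> T \<and> pdeg E \<le> m. (-1) ^ card E *
        (\<Sum>N\<in>monic_polys (m - pdeg E). pair_char \<chi> (S - T) (T - S) (\<Prod>E * N) ^ k))"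
    by (rule sum_coprime[OF D(1)])
  also have "\<dots> = (\<Sum>E | E \<subseteq> S \<inter> T \<and> pdeg E \<le> m. (-1) ^ card E * pair_char \<chi> (S - T) (T - S) (\<Prod>E) ^ k *
        (\<Sum>N\<in>monic_polys (m - pdeg E). pair_char \<chi> (S - T) (T - S) N ^ k))"
    by (simp add: pair_char_mult[OF sys D(2,3)] power_mult_distrib sum_distrib_left mult.assoc)
  finally show ?thesis .
qed

text \<open>After duality the squared symbols modulo \<open>T\<close> and \<open>T'\<close> are
  compared over all monic polynomials of degree \<open>n\<close>. With
  \<open>g = pdeg (T \<inter> T')\<close> the modulus has degree
  \<open>2 (b - g) \<le> n - g \<le> n - pdeg E\<close>, so every sum is complete and
  vanishes.\<close>

lemma square_symbol_sieve:
  assumes "2 * b \<le> n"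
  shows "(\<Sum>T\<in>psets b. (cmod (\<Sum>S\<in>psets n. u S * psym \<chi> S (\<Prod>T) ^ 2))\<^sup>2)
     \<le> real CARD('a) ^ n * (\<Sum>S\<in>psets n. (cmod (u S))\<^sup>2)"
proof (rule large_sieve_duality)
  fix v :: "'a poly set \<Rightarrow> complex"
  obtain \<psi> :: "'a \<Rightarrow> complex" where psi: "additive_character \<psi>" using exists_additive_character by blast
  have "(\<Sum>S\<in>psets n. (cmod (\<Sum>T\<in>psets b. v T * psym \<chi> S (\<Prod>T) ^ 2))\<^sup>2) =
      (\<Sum>S\<in>psets n. (cmod (\<Sum>T\<in>psets b. v T * psym \<chi> T (\<Prod>S) ^ 2))\<^sup>2)"
    by (intro sum.cong refl arg_cong[of _ _ "\<lambda>x. (cmod x)\<^sup>2"])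
      (simp add: psym_reciprocity[OF sys psets_prime_set psets_prime_set])
  \<comment> \<open>By positivity the square-free \<open>\<Prod>S\<close> may be extended to all
    monic polynomials, over which complete sums are available.\<close>
  also have "\<dots> \<le> (\<Sum>N\<in>monic_polys n. (cmod (\<Sum>T\<in>psets b. v T * psym \<chi> T N ^ 2))\<^sup>2)"
    by (rule sum_psets_le_sum_monic_polys) simp
  also have "\<dots> \<le> real CARD('a) ^ n * (\<Sum>T\<in>psets b. (cmod (v T))\<^sup>2)"
  proof (rule large_sieve_orthogonal)
    fix T assume T: "T \<in> (psets b :: 'a poly set set)"
    have "(\<Sum>N\<in>monic_polys n. (cmod (psym \<chi> T N ^ 2))\<^sup>2) \<le> (\<Sum>N\<in>(monic_polys n :: 'a poly set). 1)"
      using psym_norm_le_1[OF sys psets_prime_set[OF T]]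
      by (intro sum_mono) (simp add: norm_power power_le_one)
    then show "(\<Sum>N\<in>monic_polys n. (cmod (psym \<chi> T N ^ 2))\<^sup>2) \<le> real CARD('a) ^ n"
      by (simp add: card_monic_polys)
  next
    fix T T' assume T: "T \<in> (psets b :: 'a poly set set)" "T' \<in> psets b" "T \<noteq> T'"
    have P: "prime_set T" "prime_set T'" using T psets_prime_set by auto
    have D: "prime_set (T - T')" "prime_set (T' - T)" "prime_set (T \<inter> T')" using P by (auto intro: prime_set_Int prime_set_Diff)
    have ne: "(T - T') \<union> (T' - T) \<noteq> {}" using T by auto
    have "(\<Sum>N\<in>monic_polys (n - pdeg E). pair_char \<chi> (T - T') (T' - T) N ^ 2) = 0"
      if E: "E \<subseteq> T \<inter> T'" "pdeg E \<le> n" for E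
    proof (rule sum_pair_char_eq_0[OF sys psi D(1,2) _ refl ne])
      have "pdeg E \<le> pdeg (T \<inter> T')" by (rule pdeg_mono[OF D(3) E(1)])
      moreover have "pdeg (T - T') = b - pdeg (T \<inter> T')" "pdeg (T' - T) = b - pdeg (T \<inter> T')"
        using pdeg_Diff[OF P(1), of "T \<inter> T'"] pdeg_Diff[OF P(2), of "T \<inter> T'"] psets_pdeg[OF T(1)] psets_pdeg[OF T(2)]
        by (simp_all add: Diff_Int)
      moreover have "pdeg (T \<inter> T') \<le> b" using pdeg_mono[OF P(1), of "T \<inter> T'"] psets_pdeg[OF T(1)] by auto
      ultimately show "pdeg (T - T') + pdeg (T' - T) \<le> n - pdeg E" using assms by linarith
    qed auto
    then have "(\<Sum>M\<in>monic_polys n. (psym \<chi> T M * cnj (psym \<chi> T' M)) ^ 2) = 0"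
      unfolding sum_psym_pair[OF P zero_less_numeral] by (intro sum.neutral) auto
    then show "(\<Sum>N\<in>monic_polys n. psym \<chi> T N ^ 2 * cnj (psym \<chi> T' N ^ 2)) = 0"
      by (simp add: power_mult_distrib)
  qed simp
  finally show "(\<Sum>S\<in>psets n. (cmod (\<Sum>T\<in>psets b. v T * psym \<chi> S (\<Prod>T) ^ 2))\<^sup>2) \<le>
      real CARD('a) ^ n * (\<Sum>T\<in>psets b. (cmod (v T))\<^sup>2)" .
qed simp

end

section \<open>Splitting the outer variable, and shifting its degree\<close>

context
  fixes \<chi> :: "'a::{field,finite} poly \<Rightarrow> 'a poly \<Rightarrow> complex"
  assumes sys: "symbol_system \<chi>"
begin

lemma norm_mult_square_le: "cmod w \<le> 1 \<Longrightarrow> (cmod (u * w))\<^sup>2 \<le> (cmod u)\<^sup>2"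
  by (simp add: norm_mult power_mult_distrib mult_left_le power_le_one)

text \<open>For each triple of degrees the assumption on \<open>K\<close> offers two ways to freeze
  variables: \<open>B, T\<close>, leaving a square-free sieve over \<open>A\<close>, or
  \<open>A, T\<close>, leaving squared symbols over \<open>B\<close>. Symbols of frozen variables
  have modulus at most \<open>1\<close> and join the coefficients; frozen variables are counted
  trivially. The factor \<open>(real k + 1) ^ 3\<close> bounds the number of triples.\<close>

lemma large_sieve_from_squarefree:
  assumes "k \<le> n"
    and sf: "\<And>a. a \<le> k \<Longrightarrow> squarefree_sieve \<chi> a n (\<beta> a)" and beta0: "\<And>a. \<beta> a \<ge> 0"
    and K: "\<And>a b c. a + 2 * b + 3 * c = k \<Longrightarrow>
        real CARD('a) ^ (b + c) * \<beta> a \<le> K \<or> real CARD('a) ^ (a + c) * real CARD('a) ^ n \<le> K"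
  shows "large_sieve \<chi> k n ((real k + 1) ^ 3 * K)"
  unfolding large_sieve_def
proof
  fix u :: "'a poly set \<Rightarrow> complex"
  let ?q = "real CARD('a)"
  define L where "L = (\<Sum>S\<in>psets n. (cmod (u S))\<^sup>2)"
  define \<phi> where "\<phi> M = (cmod (\<Sum>S\<in>psets n. u S * psym \<chi> S M))\<^sup>2" for M
  have L0: "L \<ge> 0" and phi0: "\<And>M. \<phi> M \<ge> 0" by (simp_all add: L_def \<phi>_def sum_nonneg)
  \<comment> \<open>The triple \<open>(k, 0, 0)\<close> shows that \<open>K\<close> is
    non-negative.\<close>
  have "real CARD('a) ^ (0 + 0) * \<beta> k \<le> K \<or> real CARD('a) ^ (k + 0) * real CARD('a) ^ n \<le> K" by (rule K) simp
  then have K0: "K \<ge> 0" using beta0[of k] by (auto intro: order_trans[rotated])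
  define J where "J = {(a, b, c). a + 2 * b + 3 * c = k}"
  have J_sub: "J \<subseteq> {..k} \<times> {..k} \<times> {..k}" by (auto simp: J_def)
  then have J_fin: "finite J" by (rule finite_subset) simp
  have "card J \<le> (k + 1) ^ 3"
    using card_mono[OF _ J_sub] by (simp add: card_cartesian_product power3_eq_cube algebra_simps)
  then have cJ: "real (card J) \<le> (real k + 1) ^ 3"
    by (metis of_nat_1 of_nat_add of_nat_le_iff of_nat_power)
  define f where "f = (\<lambda>(j :: nat \<times> nat \<times> nat, A, B, T :: 'a poly). \<Prod>A * (\<Prod>B)\<^sup>2 * T ^ 3)"
  define I where "I = (SIGMA j:J. case j of (a, b, c) \<Rightarrow> (psets a :: 'a poly set set) \<times> (psets b :: 'a poly set set) \<times> (monic_polys c :: 'a poly set))"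
  have I_fin: "finite I" unfolding I_def by (rule finite_SigmaI[OF J_fin]) (auto simp: case_prod_unfold)
  have "monic_polys k \<subseteq> f ` I"
  proof
    fix M :: "'a poly" assume "M \<in> monic_polys k"
    then obtain a b c N1 N2 T where h: "a + 2 * b + 3 * c = k" "N1 \<in> squarefree_monic_polys a"
      "N2 \<in> squarefree_monic_polys b" "T \<in> monic_polys c" "M = N1 * N2\<^sup>2 * T ^ 3"
      using cube_decomposition by metis
    obtain A B where AB: "A \<in> psets a" "N1 = \<Prod>A" "B \<in> psets b" "N2 = \<Prod>B"
      using h(2,3) bij_betw_imp_surj_on[OF bij_betw_prod_psets[where 'a='a]] by blast
    show "M \<in> f ` I"
      using h AB by (intro image_eqI[of _ _ "((a,b,c),A,B,T)"]) (auto simp: f_def I_def J_def)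
  qed
  \<comment> \<open>Every \<open>M\<close> is of the form \<open>f x\<close> at least once, and the
    terms are non-negative.\<close>
  then have "(\<Sum>M\<in>monic_polys k. \<phi> M) \<le> (\<Sum>M\<in>f ` I. \<phi> M)"
    using I_fin phi0 by (intro sum_mono2) auto
  also have "\<dots> \<le> (\<Sum>x\<in>I. \<phi> (f x))"
    using sum_image_le[of I \<phi> f] I_fin phi0 by (simp add: o_def)
  also have "\<dots> = (\<Sum>j\<in>J. \<Sum>x\<in>(case j of (a, b, c) \<Rightarrow> (psets a :: 'a poly set set) \<times> (psets b :: 'a poly set set) \<times> (monic_polys c :: 'a poly set)). \<phi> (f (j, x)))"
    unfolding I_def using J_fin by (subst sum.Sigma) (auto simp: case_prod_unfold)
  also have "\<dots> \<le> (\<Sum>j\<in>J. K * L)"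
  proof (intro sum_mono)
    fix j assume "j \<in> J"
    then obtain a b c where j: "j = (a, b, c)" "a + 2 * b + 3 * c = k" by (auto simp: J_def)
    have e: "(\<Sum>x\<in>(case j of (a, b, c) \<Rightarrow> (psets a :: 'a poly set set) \<times> (psets b :: 'a poly set set) \<times> (monic_polys c :: 'a poly set)). \<phi> (f (j, x))) =
        (\<Sum>A\<in>psets a. \<Sum>B\<in>psets b. \<Sum>T\<in>monic_polys c. \<phi> (\<Prod>A * (\<Prod>B)\<^sup>2 * T ^ 3))"
      by (simp add: j f_def sum.cartesian_product case_prod_unfold)
    consider "?q ^ (b + c) * \<beta> a \<le> K" | "?q ^ (a + c) * ?q ^ n \<le> K" using K[OF j(2)] by blast
    then have "(\<Sum>A\<in>psets a. \<Sum>B\<in>psets b. \<Sum>T\<in>monic_polys c. \<phi> (\<Prod>A * (\<Prod>B)\<^sup>2 * T ^ 3)) \<le> K * L"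
    proof cases
      case 1
      have "(\<Sum>A\<in>psets a. \<phi> (\<Prod>A * (\<Prod>B)\<^sup>2 * T ^ 3)) \<le> \<beta> a * L" for B T
      proof -
        define w where "w S = psym \<chi> S ((\<Prod>B)\<^sup>2 * T ^ 3)" for S
        have "\<phi> (\<Prod>A * (\<Prod>B)\<^sup>2 * T ^ 3) = (cmod (\<Sum>S\<in>psets n. (u S * w S) * psym \<chi> S (\<Prod>A)))\<^sup>2" for A
          unfolding \<phi>_def w_def mult.assoc[of "\<Prod>A"]
          by (intro arg_cong[of _ _ "\<lambda>x. (cmod x)\<^sup>2"] sum.cong refl)
            (simp add: psym_mult[OF sys psets_prime_set])
        then have "(\<Sum>A\<in>psets a. \<phi> (\<Prod>A * (\<Prod>B)\<^sup>2 * T ^ 3)) \<le> \<beta> a * (\<Sum>S\<in>psets n. (cmod (u S * w S))\<^sup>2)"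
          using sf[of a] j(2) unfolding squarefree_sieve_def by simp
        also have "\<dots> \<le> \<beta> a * L" unfolding L_def
          using beta0 psym_norm_le_1[OF sys psets_prime_set]
          by (intro mult_left_mono sum_mono norm_mult_square_le) (auto simp: w_def)
        finally show ?thesis .
      qed
      then have "(\<Sum>B\<in>psets b. \<Sum>T\<in>monic_polys c. \<Sum>A\<in>psets a. \<phi> (\<Prod>A * (\<Prod>B)\<^sup>2 * T ^ 3))
          \<le> (\<Sum>B\<in>(psets b :: 'a poly set set). \<Sum>T\<in>(monic_polys c :: 'a poly set). \<beta> a * L)"
        by (intro sum_mono)
      also have "\<dots> = real (card (psets b :: 'a poly set set)) * (?q ^ c * (\<beta> a * L))"
        by (simp add: card_monic_polys)
      also have "\<dots> \<le> ?q ^ b * (?q ^ c * (\<beta> a * L))"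
        using card_psets_le L0 beta0 by (intro mult_right_mono) auto
      also have "\<dots> = (?q ^ (b + c) * \<beta> a) * L" by (simp add: power_add)
      also have "\<dots> \<le> K * L" using 1 L0 by (intro mult_right_mono)
      moreover have "(\<Sum>A\<in>psets a. \<Sum>B\<in>psets b. \<Sum>T\<in>monic_polys c. \<phi> (\<Prod>A * (\<Prod>B)\<^sup>2 * T ^ 3)) =
          (\<Sum>B\<in>psets b. \<Sum>T\<in>monic_polys c. \<Sum>A\<in>psets a. \<phi> (\<Prod>A * (\<Prod>B)\<^sup>2 * T ^ 3))"
        by (rule trans[OF sum.swap], rule sum.cong[OF refl], rule sum.swap)
      ultimately show ?thesis by simp
    next
      case 2
      have b: "2 * b \<le> n" using j(2) \<open>k \<le> n\<close> by simp
      have "(\<Sum>B\<in>psets b. \<phi> (\<Prod>A * (\<Prod>B)\<^sup>2 * T ^ 3)) \<le> ?q ^ n * L" for A T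
      proof -
        define w where "w S = psym \<chi> S (\<Prod>A * T ^ 3)" for S
        have "\<phi> (\<Prod>A * (\<Prod>B)\<^sup>2 * T ^ 3) = (cmod (\<Sum>S\<in>psets n. (u S * w S) * psym \<chi> S (\<Prod>B) ^ 2))\<^sup>2" for B
          unfolding \<phi>_def w_def
          by (intro arg_cong[of _ _ "\<lambda>x. (cmod x)\<^sup>2"] sum.cong refl)
            (simp add: psym_mult[OF sys psets_prime_set] psym_power[OF sys psets_prime_set])
        then have "(\<Sum>B\<in>psets b. \<phi> (\<Prod>A * (\<Prod>B)\<^sup>2 * T ^ 3)) \<le> ?q ^ n * (\<Sum>S\<in>psets n. (cmod (u S * w S))\<^sup>2)"
          using square_symbol_sieve[OF sys b] by simp
        also have "\<dots> \<le> ?q ^ n * L" unfolding L_def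
          using psym_norm_le_1[OF sys psets_prime_set]
          by (intro mult_left_mono sum_mono norm_mult_square_le) (auto simp: w_def)
        finally show ?thesis .
      qed
      then have "(\<Sum>A\<in>psets a. \<Sum>T\<in>monic_polys c. \<Sum>B\<in>psets b. \<phi> (\<Prod>A * (\<Prod>B)\<^sup>2 * T ^ 3))
          \<le> (\<Sum>A\<in>(psets a :: 'a poly set set). \<Sum>T\<in>(monic_polys c :: 'a poly set). ?q ^ n * L)"
        by (intro sum_mono)
      also have "\<dots> = real (card (psets a :: 'a poly set set)) * (?q ^ c * (?q ^ n * L))"
        by (simp add: card_monic_polys)
      also have "\<dots> \<le> ?q ^ a * (?q ^ c * (?q ^ n * L))"
        using card_psets_le L0 by (intro mult_right_mono) auto
      also have "\<dots> = (?q ^ (a + c) * ?q ^ n) * L" by (simp add: power_add)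
      also have "\<dots> \<le> K * L" using 2 L0 by (intro mult_right_mono)
      moreover have "(\<Sum>A\<in>psets a. \<Sum>B\<in>psets b. \<Sum>T\<in>monic_polys c. \<phi> (\<Prod>A * (\<Prod>B)\<^sup>2 * T ^ 3)) =
          (\<Sum>A\<in>psets a. \<Sum>T\<in>monic_polys c. \<Sum>B\<in>psets b. \<phi> (\<Prod>A * (\<Prod>B)\<^sup>2 * T ^ 3))"
        by (rule sum.cong[OF refl], rule sum.swap)
      ultimately show ?thesis by simp
    qed
    then show "(\<Sum>x\<in>(case j of (a, b, c) \<Rightarrow> (psets a :: 'a poly set set) \<times> (psets b :: 'a poly set set) \<times> (monic_polys c :: 'a poly set)). \<phi> (f (j, x))) \<le> K * L"
      unfolding e .
  qed
  also have "\<dots> = real (card J) * (K * L)" by simp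
  also have "\<dots> \<le> (real k + 1) ^ 3 * (K * L)" using cJ K0 L0 by (intro mult_right_mono) auto
  finally show "(\<Sum>M\<in>monic_polys k. (cmod (\<Sum>S\<in>psets n. u S * psym \<chi> S M))\<^sup>2) \<le>
      (real k + 1) ^ 3 * K * (\<Sum>S\<in>psets n. (cmod (u S))\<^sup>2)"
    by (simp add: \<phi>_def L_def mult.assoc)
qed

text \<open>Multiplying \<open>M\<close> by \<open>t\<^sup>d\<close> embeds the sum over degree \<open>m\<close> into that over degree \<open>m + d\<close>; the
  sets \<open>S\<close> containing the prime \<open>t\<close>, whose symbol vanishes at \<open>t\<^sup>d\<close>, are treated after removing \<open>t\<close>.\<close>

lemma large_sieve_shift:
  assumes ls: "\<And>n'. n' \<le> n \<Longrightarrow> large_sieve \<chi> (m + d) n' B" and "B \<ge> 0"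
  shows "large_sieve \<chi> m n (2 * B)"
  unfolding large_sieve_def
proof
  fix u :: "'a poly set \<Rightarrow> complex"
  define t :: "'a poly" where "t = [:0, 1:]"
  have t: "t \<in> monic_primes" "degree t = 1" "t \<in> monic_polys 1"
    unfolding t_def monic_primes_def monic_polys_def using irreducible_linear_field_poly[of 1 "0::'a"] by auto
  have td: "t ^ d \<in> monic_polys d"
  proof (induction d)
    case (Suc d)
    then show ?case using monic_polys_mult[OF t(3) Suc] by simp
  qed (simp add: monic_polys_def)
  have td0: "t ^ d \<noteq> 0" using td monic_polys_nz by blast
  have key: "(\<Sum>M\<in>monic_polys m. (cmod (\<Sum>S\<in>psets n'. v S * psym \<chi> S M))\<^sup>2) \<le> B * (\<Sum>S\<in>psets n'. (cmod (v S))\<^sup>2)"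
    if v: "\<And>S. t \<in> S \<Longrightarrow> v S = 0" and n': "n' \<le> n" for v n'
  proof -
    \<comment> \<open>For \<open>t \<notin> S\<close> the symbol of \<open>t^d\<close> has modulus
      \<open>1\<close>; its conjugate in the coefficient undoes the multiplication by
      \<open>t^d\<close>.\<close>
    have "v S * psym \<chi> S M = (v S * cnj (psym \<chi> S (t ^ d))) * psym \<chi> S (M * t ^ d)" if S: "S \<in> psets n'" for S M
    proof (cases "t \<in> S")
      case False
      have "\<not> \<pi> dvd t ^ d" if "\<pi> \<in> S" for \<pi>
        using monic_primes_dvd_power monic_primes_dvd_eq t(1) False that prime_setD(2)[OF psets_prime_set[OF S]] by blast
      then have "cmod (psym \<chi> S (t ^ d)) = 1" using psym_norm[OF sys psets_prime_set[OF S]] by simp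
      then have "psym \<chi> S (t ^ d) * cnj (psym \<chi> S (t ^ d)) = 1" by (rule unit_norm_cnj)
      then show ?thesis using psym_mult[OF sys psets_prime_set[OF S]] by (simp add: mult.commute)
    qed (simp add: v)
    then have "(\<Sum>M\<in>monic_polys m. (cmod (\<Sum>S\<in>psets n'. v S * psym \<chi> S M))\<^sup>2) =
       (\<Sum>M\<in>monic_polys m. (cmod (\<Sum>S\<in>psets n'. (v S * cnj (psym \<chi> S (t ^ d))) * psym \<chi> S (M * t ^ d)))\<^sup>2)"
      by (intro sum.cong refl arg_cong[of _ _ "\<lambda>x. (cmod x)\<^sup>2"]) auto
    also have "\<dots> = (\<Sum>M\<in>(\<lambda>M. M * t ^ d) ` monic_polys m. (cmod (\<Sum>S\<in>psets n'. (v S * cnj (psym \<chi> S (t ^ d))) * psym \<chi> S M))\<^sup>2)"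
      using td0 by (subst sum.reindex) (auto simp: inj_on_def)
    also have "\<dots> \<le> (\<Sum>M\<in>monic_polys (m + d). (cmod (\<Sum>S\<in>psets n'. (v S * cnj (psym \<chi> S (t ^ d))) * psym \<chi> S M))\<^sup>2)"
      using monic_polys_mult[OF _ td] by (intro sum_mono2) auto
    also have "\<dots> \<le> B * (\<Sum>S\<in>psets n'. (cmod (v S * cnj (psym \<chi> S (t ^ d))))\<^sup>2)"
      by (rule ls[OF n', unfolded large_sieve_def, rule_format])
    also have "\<dots> \<le> B * (\<Sum>S\<in>psets n'. (cmod (v S))\<^sup>2)"
      using psym_norm_le_1[OF sys psets_prime_set] \<open>B \<ge> 0\<close>
      by (intro mult_left_mono sum_mono norm_mult_square_le) auto
    finally show ?thesis .
  qed
  define u1 where "u1 S = (if t \<in> S then 0 else u S)" for S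
  define u2 where "u2 S = (if t \<in> S then u S else 0)" for S
  define u3 where "u3 S = (if t \<in> S then 0 else u (insert t S))" for S
  have i1: "(\<Sum>M\<in>monic_polys m. (cmod (\<Sum>S\<in>psets n. u1 S * psym \<chi> S M))\<^sup>2) \<le> B * (\<Sum>S\<in>psets n. (cmod (u1 S))\<^sup>2)"
    by (rule key) (auto simp: u1_def)
  have i2: "(\<Sum>M\<in>monic_polys m. (cmod (\<Sum>S\<in>psets n. u2 S * psym \<chi> S M))\<^sup>2) \<le> B * (\<Sum>S\<in>psets n. (cmod (u2 S))\<^sup>2)"
  proof (cases "n = 0")
    case True
    have "u2 S = 0" if "S \<in> psets n" for S
    proof (rule ccontr)
      assume "u2 S \<noteq> 0"
      then have "t \<in> S" by (auto simp: u2_def split: if_splits)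
      then have "pdeg {t} \<le> pdeg S" using pdeg_mono[OF psets_prime_set[OF that]] by blast
      then show False using True psets_pdeg[OF that] t by (simp add: pdeg_def)
    qed
    then show ?thesis by simp
  next
    case False
    \<comment> \<open>Removing \<open>t\<close> lowers the degree of the modulus by
      \<open>1\<close>, which is why the hypothesis is required for all
      \<open>n' \<le> n\<close>.\<close>
    have re: "(\<Sum>S\<in>psets n. if t \<in> S then g S else 0) = (\<Sum>S\<in>psets (n - 1). if t \<in> S then 0 else g (insert t S))"
      for g :: "'a poly set \<Rightarrow> 'b::comm_monoid_add"
    proof -
      have "(\<Sum>S\<in>psets n. if t \<in> S then g S else 0) = (\<Sum>S\<in>{S\<in>psets n. t \<in> S}. g S)"
        by (simp add: sum.inter_filter)
      also have "\<dots> = (\<Sum>S\<in>{S\<in>psets (n - 1). t \<notin> S}. g (insert t S))"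
      proof (rule sum.reindex_bij_witness[of _ "insert t" "\<lambda>S. S - {t}"])
        fix S assume S: "S \<in> {S\<in>psets n. t \<in> S}"
        then have P: "prime_set S" using psets_prime_set by auto
        have "pdeg (S - {t}) = n - 1" using pdeg_Diff[OF P, of "{t}"] S psets_pdeg[of S n] t by (auto simp: pdeg_def)
        then show "S - {t} \<in> {S\<in>psets (n - 1). t \<notin> S}" using prime_set_psets[OF prime_set_Diff[OF P, of "{t}"]] by simp
      next
        fix S assume S: "S \<in> {S\<in>psets (n - 1). t \<notin> S}"
        then have P: "prime_set S" "pdeg S = n - 1" using psets_prime_set psets_pdeg by auto
        then have "prime_set (insert t S)" using t by (simp add: prime_set_def)
        moreover have "pdeg (insert t S) = n" using S P t False by (simp add: pdeg_def prime_set_def)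
        ultimately show "insert t S \<in> {S\<in>psets n. t \<in> S}" using prime_set_psets by blast
      qed (auto simp: insert_absorb)
      also have "\<dots> = (\<Sum>S\<in>psets (n - 1). if t \<notin> S then g (insert t S) else 0)"
        by (simp add: sum.inter_filter)
      also have "\<dots> = (\<Sum>S\<in>psets (n - 1). if t \<in> S then 0 else g (insert t S))"
        by (intro sum.cong refl) auto
      finally show ?thesis .
    qed
    have e: "(\<Sum>S\<in>psets n. u2 S * psym \<chi> S M) = \<chi> t M * (\<Sum>S\<in>psets (n - 1). u3 S * psym \<chi> S M)" for M
    proof -
      have "(\<Sum>S\<in>psets n. u2 S * psym \<chi> S M) = (\<Sum>S\<in>psets n. if t \<in> S then u S * psym \<chi> S M else 0)"
        by (intro sum.cong refl) (simp add: u2_def)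
      also have "\<dots> = (\<Sum>S\<in>psets (n - 1). if t \<in> S then 0 else u (insert t S) * psym \<chi> (insert t S) M)"
        by (rule re)
      also have "\<dots> = (\<Sum>S\<in>psets (n - 1). \<chi> t M * (u3 S * psym \<chi> S M))"
      proof (intro sum.cong refl)
        fix S assume "S \<in> (psets (n - 1) :: 'a poly set set)"
        then have "finite S" using prime_setD(1)[OF psets_prime_set] by blast
        then show "(if t \<in> S then 0 else u (insert t S) * psym \<chi> (insert t S) M) = \<chi> t M * (u3 S * psym \<chi> S M)"
          by (simp add: u3_def psym_def ac_simps)
      qed
      finally show ?thesis by (simp add: sum_distrib_left)
    qed
    have "(\<Sum>M\<in>monic_polys m. (cmod (\<Sum>S\<in>psets n. u2 S * psym \<chi> S M))\<^sup>2)
        \<le> (\<Sum>M\<in>monic_polys m. (cmod (\<Sum>S\<in>psets (n - 1). u3 S * psym \<chi> S M))\<^sup>2)"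
      unfolding e mult.commute[of "\<chi> t _"] using chi_norm[OF sys t(1)]
      by (intro sum_mono norm_mult_square_le) simp
    also have "\<dots> \<le> B * (\<Sum>S\<in>psets (n - 1). (cmod (u3 S))\<^sup>2)"
      by (rule key) (auto simp: u3_def)
    also have "(\<Sum>S\<in>psets (n - 1). (cmod (u3 S))\<^sup>2) = (\<Sum>S\<in>psets n. (cmod (u2 S))\<^sup>2)"
    proof -
      have "(\<Sum>S\<in>psets n. (cmod (u2 S))\<^sup>2) = (\<Sum>S\<in>psets n. if t \<in> S then (cmod (u S))\<^sup>2 else 0)"
        by (intro sum.cong refl) (simp add: u2_def)
      also have "\<dots> = (\<Sum>S\<in>psets (n - 1). if t \<in> S then 0 else (cmod (u (insert t S)))\<^sup>2)" by (rule re)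
      also have "\<dots> = (\<Sum>S\<in>psets (n - 1). (cmod (u3 S))\<^sup>2)" by (intro sum.cong refl) (simp add: u3_def)
      finally show ?thesis ..
    qed
    finally show ?thesis .
  qed
  \<comment> \<open>The origin of the factor \<open>2\<close>. Nothing more is lost, because
    \<open>u1\<close> and \<open>u2\<close> have disjoint supports.\<close>
  have sq: "(cmod (x + y))\<^sup>2 \<le> 2 * (cmod x)\<^sup>2 + 2 * (cmod y)\<^sup>2" for x y
  proof -
    have "(cmod (x + y))\<^sup>2 \<le> (cmod x + cmod y)\<^sup>2" by (intro power_mono norm_triangle_ineq) auto
    also have "\<dots> \<le> 2 * (cmod x)\<^sup>2 + 2 * (cmod y)\<^sup>2"
      using sum_squares_bound[of "cmod x" "cmod y"] by (simp add: power2_sum)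
    finally show ?thesis .
  qed
  have "(\<Sum>M\<in>monic_polys m. (cmod (\<Sum>S\<in>psets n. u S * psym \<chi> S M))\<^sup>2) \<le>
     (\<Sum>M\<in>monic_polys m. 2 * (cmod (\<Sum>S\<in>psets n. u1 S * psym \<chi> S M))\<^sup>2 + 2 * (cmod (\<Sum>S\<in>psets n. u2 S * psym \<chi> S M))\<^sup>2)"
  proof (intro sum_mono)
    fix M :: "'a poly"
    have "(\<Sum>S\<in>psets n. u S * psym \<chi> S M) = (\<Sum>S\<in>psets n. u1 S * psym \<chi> S M) + (\<Sum>S\<in>psets n. u2 S * psym \<chi> S M)"
      unfolding sum.distrib[symmetric] by (intro sum.cong refl) (simp add: u1_def u2_def)
    then show "(cmod (\<Sum>S\<in>psets n. u S * psym \<chi> S M))\<^sup>2 \<le> 2 * (cmod (\<Sum>S\<in>psets n. u1 S * psym \<chi> S M))\<^sup>2 + 2 * (cmod (\<Sum>S\<in>psets n. u2 S * psym \<chi> S M))\<^sup>2"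
      using sq by simp
  qed
  also have "\<dots> \<le> 2 * (B * (\<Sum>S\<in>psets n. (cmod (u1 S))\<^sup>2)) + 2 * (B * (\<Sum>S\<in>psets n. (cmod (u2 S))\<^sup>2))"
    using i1 i2 by (simp add: sum.distrib flip: sum_distrib_left)
  also have "\<dots> = 2 * B * (\<Sum>S\<in>psets n. (cmod (u1 S))\<^sup>2 + (cmod (u2 S))\<^sup>2)"
    by (simp add: sum.distrib algebra_simps)
  also have "\<dots> = 2 * B * (\<Sum>S\<in>psets n. (cmod (u S))\<^sup>2)"
    by (intro arg_cong[of _ _ "(*) (2 * B)"] sum.cong refl) (simp add: u1_def u2_def)
  finally show "(\<Sum>M\<in>monic_polys m. (cmod (\<Sum>S\<in>psets n. u S * psym \<chi> S M))\<^sup>2) \<le> 2 * B * (\<Sum>S\<in>psets n. (cmod (u S))\<^sup>2)" .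
qed

end

section \<open>The inequality of self-dual type\<close>

text \<open>This evaluates \<open>g\<close> at \<open>Z\<close> by means of conditions
  \<open>D \<union> F \<subseteq> Z\<close> only. For \<open>Z = S \<inter> T\<close> such a
  condition splits into one on \<open>S\<close> and one on \<open>T\<close>, which
  \<open>D = S \<inter> T\<close> does not.\<close>

lemma sum_inclusion_exclusion_eq:
  fixes g :: "'i set \<Rightarrow> complex"
  assumes U: "finite U" and Z: "Z \<subseteq> U"
  shows "(\<Sum>D\<in>Pow U. \<Sum>F\<in>Pow (U - D). if D \<union> F \<subseteq> Z then (-1) ^ card F * g D else 0) = g Z"
proof -
  have "(\<Sum>F\<in>Pow (U - D). if D \<union> F \<subseteq> Z then (-1) ^ card F * g D else 0) = (if D = Z then g D else 0)" for D
  proof (cases "D \<subseteq> Z")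
    case True
    have "(\<Sum>F\<in>Pow (U - D). if D \<union> F \<subseteq> Z then (-1) ^ card F * g D else 0) =
        (\<Sum>F\<in>Pow (U - D). if F \<in> Pow (Z - D) then (-1) ^ card F * g D else 0)"
      using True by (intro sum.cong refl) auto
    also have "\<dots> = (\<Sum>F\<in>Pow (U - D) \<inter> Pow (Z - D). (-1) ^ card F * g D)"
      using U by (simp add: sum.inter_restrict)
    also have "Pow (U - D) \<inter> Pow (Z - D) = Pow (Z - D)" using Z by auto
    also have "(\<Sum>F\<in>Pow (Z - D). (-1) ^ card F * g D) = (if Z - D = {} then 1 else 0) * g D"
      using finite_subset[OF Z U] sum_alternating_Pow[of "Z - D"] by (simp flip: sum_distrib_right)
    finally show ?thesis using True by auto
  qed (auto intro: sum.neutral)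
  then have "(\<Sum>D\<in>Pow U. \<Sum>F\<in>Pow (U - D). if D \<union> F \<subseteq> Z then (-1) ^ card F * g D else 0) =
      (\<Sum>D\<in>Pow U. if D = Z then g D else 0)" by simp
  also have "\<dots> = g Z" using U Z by (simp add: sum.delta)
  finally show ?thesis .
qed

lemma norm_sum_double:
  fixes x :: "'i \<Rightarrow> complex"
  shows "(\<Sum>S\<in>P. \<Sum>T\<in>P. x S * cnj (x T)) = of_real ((cmod (\<Sum>S\<in>P. x S))\<^sup>2)"
  unfolding complex_norm_square by (simp add: sum_product)

context
  fixes \<chi> :: "'a::{field,finite} poly \<Rightarrow> 'a poly \<Rightarrow> complex"
  assumes sys: "symbol_system \<chi>"
begin

text \<open>\<open>D\<close> is the greatest common divisor of two moduli \<open>S\<close> and \<open>T\<close>; \<open>E\<close> and \<open>F\<close> come from Moebius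
  inversion for the conditions that \<open>M\<close> is coprime to \<open>D\<close> and that the cofactors are coprime.\<close>

lemma dual_sieve_bound:
  fixes u :: "'a poly set \<Rightarrow> complex"
  assumes psi: "additive_character \<psi>"
    and ls: "large_sieve \<chi> k (n - pdeg D) B" and "B \<ge> 0" and D: "prime_set D" and E: "prime_set E"
  shows "(\<Sum>N\<in>monic_polys k. (cmod (\<Sum>S\<in>{S\<in>psets n. D \<union> F \<subseteq> S}.
      u S * (psym \<chi> (S - D) (\<Prod>E) * gauss_sum \<chi> \<psi> (S - D) * cnj (psym \<chi> (S - D) N))))\<^sup>2)
     \<le> B * real CARD('a) ^ (n - pdeg D) * (\<Sum>S\<in>{S\<in>psets n. D \<union> F \<subseteq> S}. (cmod (u S))\<^sup>2)"
proof -
  let ?Q = "{S\<in>psets n. D \<union> F \<subseteq> S}" and ?P = "psets (n - pdeg D) :: 'a poly set set"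
  \<comment> \<open>The cofactors \<open>S - D\<close> of the sets in \<open>?Q\<close>,
    parametrised so that \<open>D \<union> S\<close> recovers the original set.\<close>
  define R where "R = {S\<in>?P. D \<inter> S = {} \<and> F \<subseteq> D \<union> S \<and> D \<union> S \<in> psets n}"
  have re: "(\<Sum>S\<in>?Q. g S (S - D)) = (\<Sum>S\<in>R. g (D \<union> S) S)" for g :: "_ \<Rightarrow> _ \<Rightarrow> 'b::comm_monoid_add"
  proof (rule sum.reindex_bij_witness[of _ "\<lambda>S. D \<union> S" "\<lambda>S. S - D"])
    fix S assume S: "S \<in> ?Q"
    then have P: "prime_set S" "D \<subseteq> S" "F \<subseteq> S" "pdeg S = n" using psets_prime_set psets_pdeg by auto
    have "S - D \<in> ?P" using prime_set_psets[OF prime_set_Diff[OF P(1), of D]] pdeg_Diff[OF P(1,2)] P(4) by simp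
    moreover have "D \<union> (S - D) = S" using P by auto
    ultimately show "S - D \<in> R" using S P unfolding R_def by auto
  qed (auto simp: R_def Un_absorb1)
  \<comment> \<open>Conjugated, since the dual sum contains conjugate symbols, and extended by
    \<open>0\<close> so that the sieve over all moduli of degree \<open>n - pdeg D\<close>
    applies.\<close>
  define v where "v S = (if S \<in> R then cnj (u (D \<union> S) * (psym \<chi> S (\<Prod>E) * gauss_sum \<chi> \<psi> S)) else 0)" for S
  have R_sub: "R \<subseteq> ?P" by (auto simp: R_def)
  have inner: "(\<Sum>S\<in>?Q. u S * (psym \<chi> (S - D) (\<Prod>E) * gauss_sum \<chi> \<psi> (S - D) * cnj (psym \<chi> (S - D) N))) =
      cnj (\<Sum>S\<in>?P. v S * psym \<chi> S N)" for N
  proof -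
    have "(\<Sum>S\<in>?Q. u S * (psym \<chi> (S - D) (\<Prod>E) * gauss_sum \<chi> \<psi> (S - D) * cnj (psym \<chi> (S - D) N))) =
        (\<Sum>S\<in>R. u (D \<union> S) * (psym \<chi> S (\<Prod>E) * gauss_sum \<chi> \<psi> S * cnj (psym \<chi> S N)))" by (rule re)
    also have "\<dots> = (\<Sum>S\<in>R. cnj (v S * psym \<chi> S N))"
      by (intro sum.cong refl) (simp add: v_def)
    also have "\<dots> = (\<Sum>S\<in>?P. cnj (v S * psym \<chi> S N))"
      using R_sub by (intro sum.mono_neutral_left) (auto simp: v_def)
    finally show ?thesis by simp
  qed
  have "(\<Sum>N\<in>monic_polys k. (cmod (\<Sum>S\<in>?P. v S * psym \<chi> S N))\<^sup>2) \<le> B * (\<Sum>S\<in>?P. (cmod (v S))\<^sup>2)"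
    by (rule ls[unfolded large_sieve_def, rule_format])
  also have "(\<Sum>S\<in>?P. (cmod (v S))\<^sup>2) = (\<Sum>S\<in>R. (cmod (v S))\<^sup>2)"
    using R_sub by (intro sum.mono_neutral_right) (auto simp: v_def)
  also have "B * (\<Sum>S\<in>R. (cmod (v S))\<^sup>2) \<le> B * (\<Sum>S\<in>R. (cmod (u (D \<union> S)))\<^sup>2 * real CARD('a) ^ (n - pdeg D))"
  proof (intro mult_left_mono sum_mono \<open>B \<ge> 0\<close>)
    fix S assume S: "S \<in> R"
    then have P: "prime_set S" "pdeg S = n - pdeg D" using psets_prime_set psets_pdeg by (auto simp: R_def)
    have "(cmod (v S))\<^sup>2 = (cmod (u (D \<union> S)))\<^sup>2 * ((cmod (psym \<chi> S (\<Prod>E)))\<^sup>2 * (cmod (gauss_sum \<chi> \<psi> S))\<^sup>2)"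
      using S by (simp add: v_def norm_mult power_mult_distrib)
    also have "\<dots> \<le> (cmod (u (D \<union> S)))\<^sup>2 * (1 * real CARD('a) ^ (n - pdeg D))"
      using psym_norm_le_1[OF sys P(1)] gauss_sum_norm[OF sys psi P(1)] P(2)
      by (intro mult_left_mono mult_mono) (auto simp: power_le_one)
    finally show "(cmod (v S))\<^sup>2 \<le> (cmod (u (D \<union> S)))\<^sup>2 * real CARD('a) ^ (n - pdeg D)" by simp
  qed
  also have "(\<Sum>S\<in>R. (cmod (u (D \<union> S)))\<^sup>2 * real CARD('a) ^ (n - pdeg D)) =
      (\<Sum>S\<in>?Q. (cmod (u S))\<^sup>2 * real CARD('a) ^ (n - pdeg D))"
    by (rule re[of "\<lambda>S _. (cmod (u S))\<^sup>2 * real CARD('a) ^ (n - pdeg D)", symmetric])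
  finally show ?thesis unfolding inner complex_mod_cnj
    by (simp add: sum_distrib_right[symmetric] ac_simps)
qed

text \<open>The diagonal contributes \<open>q^m\<close>. The assumption on dual sums is scaled such
  that the sieve constant, the squared Gauss sums \<open>q^(n - d)\<close> and the factor
  \<open>q^(m - e) / q^(2 (n - d))\<close> of the functional equation multiply to at most
  \<open>V\<close>. There remain at most \<open>2 n\<close> dual degrees, the factor
  \<open>q\<close> from \<open>dual_weight\<close>, and \<open>W\<close> for the triples
  \<open>D, E, F \<subseteq> S\<close>.\<close>

lemma large_sieve_dual:
  assumes V0: "V \<ge> 0"
    and ls: "\<And>d k. d \<le> n \<Longrightarrow> k + m + d < 2 * n \<Longrightarrow>
        large_sieve \<chi> k (n - d) (V * real CARD('a) ^ (n - d) / real CARD('a) ^ m)"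
    and W: "\<And>S. S \<in> (psets n :: 'a poly set set) \<Longrightarrow> 8 ^ card S \<le> W"
  shows "large_sieve \<chi> m n (real CARD('a) ^ m + 2 * real n * real CARD('a) * W * V)"
  unfolding large_sieve_def
proof
  fix u :: "'a poly set \<Rightarrow> complex"
  let ?q = "real CARD('a)" and ?qc = "of_nat CARD('a) :: complex" and ?P = "psets n :: 'a poly set set"
  have q1: "?q \<ge> 1" by (simp add: Suc_leI)
  obtain \<psi> :: "'a \<Rightarrow> complex" where psi: "additive_character \<psi>" using exists_additive_character by blast
  define L where "L = (\<Sum>S\<in>?P. (cmod (u S))\<^sup>2)"
  define U where "U = {\<pi> :: 'a poly. \<pi> \<in> monic_primes \<and> degree \<pi> \<le> n}"
  have "U \<subseteq> (\<Union>d\<in>{..n}. monic_polys d)" by (auto simp: U_def monic_primes_def monic_polys_def)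
  then have U_fin: "finite U" by (rule finite_subset) auto
  have PU: "S \<subseteq> U" if "S \<in> ?P" for S
  proof
    fix \<pi> assume pi: "\<pi> \<in> S"
    then have "pdeg {\<pi>} \<le> pdeg S" using pdeg_mono[OF psets_prime_set[OF that]] by blast
    then show "\<pi> \<in> U" using pi psets_pdeg[OF that] prime_setD(2)[OF psets_prime_set[OF that]] by (auto simp: U_def pdeg_def)
  qed
  have PU': "prime_set D" if "D \<subseteq> U" for D
    using that U_fin by (auto simp: prime_set_def U_def intro: finite_subset)
  \<comment> \<open>\<open>h\<close> gathers everything that depends on one modulus, Gauss sum
    included; for fixed \<open>D\<close> and \<open>E\<close> the correlation is then a combination
    of products \<open>h D E N S * cnj (h D E N T)\<close>.\<close>
  define h where "h D E N S = psym \<chi> (S - D) (\<Prod>E) * gauss_sum \<chi> \<psi> (S - D) * cnj (psym \<chi> (S - D) N)" for D E N S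
  define s where "s D E = 2 * (n - pdeg D) - (m - pdeg E)" for D E :: "'a poly set"
  define c where "c D E = (-1) ^ card E * (?qc ^ (m - pdeg E) / ?qc ^ (2 * (n - pdeg D)))" for D E :: "'a poly set"
  define t where "t D E S T = c D E * (\<Sum>k<s D E. dual_weight \<psi> (s D E) k *
      (\<Sum>N\<in>monic_polys k. h D E N S * cnj (h D E N T)))" for D E S T
  define G where "G S T = (\<Sum>M\<in>monic_polys m. psym \<chi> S M * cnj (psym \<chi> T M))" for S T
  have G_offdiag: "G S T = (\<Sum>E | E \<subseteq> S \<inter> T \<and> pdeg E \<le> m. t (S \<inter> T) E S T)"
    if ST: "S \<in> ?P" "T \<in> ?P" "S \<noteq> T" for S T
  proof -
    have P: "prime_set S" "prime_set T" "pdeg S = n" "pdeg T = n" using ST psets_prime_set psets_pdeg by auto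
    have D: "prime_set (S - T)" "prime_set (T - S)" using P prime_set_Diff by auto
    let ?d = "n - pdeg (S \<inter> T)" and ?f = "pair_char \<chi> (S - T) (T - S)"
    have dd: "pdeg (S - T) = ?d" "pdeg (T - S) = ?d"
      using pdeg_Diff[OF P(1), of "S \<inter> T"] pdeg_Diff[OF P(2), of "S \<inter> T"] P by (simp_all add: Diff_Int)
    have ne: "(S - T) \<union> (T - S) \<noteq> {}" and disj: "(S - T) \<inter> (T - S) = {}" using ST by auto
    have diff: "S - S \<inter> T = S - T" "T - S \<inter> T = T - S" by auto
    have "G S T = (\<Sum>E | E \<subseteq> S \<inter> T \<and> pdeg E \<le> m. (-1) ^ card E * ?f (\<Prod>E) *
        (\<Sum>N\<in>monic_polys (m - pdeg E). ?f N))"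
      using sum_psym_pair[OF sys P(1,2), of 1] unfolding G_def by simp
    also have "\<dots> = (\<Sum>E | E \<subseteq> S \<inter> T \<and> pdeg E \<le> m. t (S \<inter> T) E S T)"
    proof (intro sum.cong refl)
      fix E assume "E \<in> {E. E \<subseteq> S \<inter> T \<and> pdeg E \<le> m}"
      have "(\<Sum>N\<in>monic_polys (m - pdeg E). ?f N) =
        ?qc ^ (m - pdeg E) / ?qc ^ (2 * ?d) * (gauss_sum \<chi> \<psi> (S - T) * cnj (gauss_sum \<chi> \<psi> (T - S))) *
        (\<Sum>k<s (S \<inter> T) E. dual_weight \<psi> (s (S \<inter> T) E) k * (\<Sum>N\<in>monic_polys k. cnj (?f N)))"
        using functional_equation[OF sys psi D disj, of "2 * ?d" "m - pdeg E"] ne dd by (simp add: s_def)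
      note fe = this
      define x where "x = (\<Sum>k<s (S \<inter> T) E. dual_weight \<psi> (s (S \<inter> T) E) k * (\<Sum>N\<in>monic_polys k. cnj (?f N)))"
      define p where "p = ?f (\<Prod>E) * (gauss_sum \<chi> \<psi> (S - T) * cnj (gauss_sum \<chi> \<psi> (T - S)))"
      have "h (S \<inter> T) E N S * cnj (h (S \<inter> T) E N T) = p * cnj (?f N)" for N
        unfolding h_def diff pair_char_def p_def by (simp add: ac_simps)
      then have "t (S \<inter> T) E S T = c (S \<inter> T) E * (p * x)"
        unfolding t_def x_def by (simp add: sum_distrib_left ac_simps)
      then show "(-1) ^ card E * ?f (\<Prod>E) * (\<Sum>N\<in>monic_polys (m - pdeg E). ?f N) = t (S \<inter> T) E S T"
        unfolding fe x_def[symmetric] c_def p_def by (simp add: ac_simps)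
    qed
    finally show ?thesis .
  qed
  \<comment> \<open>For \<open>S = T\<close> the common divisor has degree \<open>n\<close>, so
    \<open>s\<close> is \<open>0\<close> and the dual terms vanish by themselves. The double sum
    therefore needs no restriction to \<open>S \<noteq> T\<close>.\<close>
  have G_eq: "G S T = (if S = T then G S S else 0) + (\<Sum>E | E \<subseteq> S \<inter> T \<and> pdeg E \<le> m. t (S \<inter> T) E S T)"
    if ST: "S \<in> ?P" "T \<in> ?P" for S T
  proof (cases "S = T")
    case True
    have "t (S \<inter> T) E S T = 0" for E unfolding t_def using True psets_pdeg[OF ST(1)] by (simp add: s_def)
    then show ?thesis using True by simp
  qed (use G_offdiag ST in simp)
  define Tr where "Tr = (SIGMA D:Pow U. Pow (U - D) \<times> {E. E \<subseteq> D \<and> pdeg E \<le> m})"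
  have E_fin: "finite {E. E \<subseteq> D \<and> pdeg E \<le> m}" if "D \<subseteq> U" for D
    using that U_fin by (auto intro!: finite_subset[of _ "Pow U"])
  have Tr_fin: "finite Tr" unfolding Tr_def using U_fin E_fin by auto
  have split: "(\<Sum>E | E \<subseteq> S \<inter> T \<and> pdeg E \<le> m. t (S \<inter> T) E S T) =
      (\<Sum>(D, F, E)\<in>Tr. if D \<union> F \<subseteq> S \<inter> T then (-1) ^ card F * t D E S T else 0)"
    if ST: "S \<in> ?P" "T \<in> ?P" for S T
  proof -
    have "(\<Sum>E | E \<subseteq> S \<inter> T \<and> pdeg E \<le> m. t (S \<inter> T) E S T) =
      (\<Sum>D\<in>Pow U. \<Sum>F\<in>Pow (U - D). if D \<union> F \<subseteq> S \<inter> T then (-1) ^ card F * (\<Sum>E | E \<subseteq> D \<and> pdeg E \<le> m. t D E S T) else 0)"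
      using PU[OF ST(1)]
      by (intro sum_inclusion_exclusion_eq[OF U_fin, of "S \<inter> T" "\<lambda>D. \<Sum>E | E \<subseteq> D \<and> pdeg E \<le> m. t D E S T", symmetric]) auto
    also have "\<dots> = (\<Sum>D\<in>Pow U. \<Sum>F\<in>Pow (U - D). \<Sum>E | E \<subseteq> D \<and> pdeg E \<le> m. if D \<union> F \<subseteq> S \<inter> T then (-1) ^ card F * t D E S T else 0)"
    proof -
      have "(if b then x * sum f I else 0) = (\<Sum>i\<in>I. if b then x * f i else 0)"
        for b and x :: complex and f and I :: "'a poly set set"
        by (cases b) (simp_all add: sum_distrib_left)
      then show ?thesis by simp
    qed
    also have "\<dots> = (\<Sum>(D, F, E)\<in>Tr. if D \<union> F \<subseteq> S \<inter> T then (-1) ^ card F * t D E S T else 0)"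
      unfolding Tr_def using U_fin E_fin
      by (subst sum.Sigma[symmetric]) (auto simp: sum.cartesian_product case_prod_unfold intro!: finite_cartesian_product)
    finally show ?thesis .
  qed
  define Z where "Z D F = (\<Sum>S\<in>{S\<in>?P. D \<union> F \<subseteq> S}. (cmod (u S))\<^sup>2)" for D F
  have Z0: "Z D F \<ge> 0" for D F by (simp add: Z_def sum_nonneg)
  \<comment> \<open>For a fixed triple the conditions on \<open>S\<close> and \<open>T\<close> are
    independent, so the sum over both is a combination of squared absolute values.\<close>
  define Y where "Y D F E = (\<Sum>S\<in>?P. \<Sum>T\<in>?P. if D \<union> F \<subseteq> S \<inter> T then u S * cnj (u T) * t D E S T else 0)" for D F E
  have Y_bound: "cmod (Y D F E) \<le> 2 * real n * ?q * V * Z D F"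
    if "(D, F, E) \<in> Tr" for D F E
  proof -
    have sub: "D \<subseteq> U" "E \<subseteq> D" "pdeg E \<le> m" using that by (auto simp: Tr_def)
    let ?Q = "{S\<in>?P. D \<union> F \<subseteq> S}"
    have Y: "Y D F E = c D E * (\<Sum>k<s D E. dual_weight \<psi> (s D E) k *
      of_real (\<Sum>N\<in>monic_polys k. (cmod (\<Sum>S\<in>?Q. u S * h D E N S))\<^sup>2))"
    proof -
      have "Y D F E = (\<Sum>S\<in>?Q. \<Sum>T\<in>?Q. u S * cnj (u T) * t D E S T)"
      proof -
        have "Y D F E = (\<Sum>S\<in>?P. if D \<union> F \<subseteq> S then (\<Sum>T\<in>?P. if D \<union> F \<subseteq> T then u S * cnj (u T) * t D E S T else 0) else 0)"
          unfolding Y_def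
        proof (intro sum.cong refl)
          fix S
          show "(\<Sum>T\<in>?P. if D \<union> F \<subseteq> S \<inter> T then u S * cnj (u T) * t D E S T else 0) =
              (if D \<union> F \<subseteq> S then (\<Sum>T\<in>?P. if D \<union> F \<subseteq> T then u S * cnj (u T) * t D E S T else 0) else 0)"
          proof (cases "D \<union> F \<subseteq> S")
            case False
            then have "(D \<union> F \<subseteq> S \<inter> T) = False" for T by auto
            then show ?thesis using False by (simp only: if_False sum.neutral_const)
          qed simp
        qed
        then show ?thesis by (simp only: sum.inter_filter finite_psets)
      qed
      also have "\<dots> = (\<Sum>S\<in>?Q. \<Sum>T\<in>?Q. c D E * (\<Sum>k<s D E. dual_weight \<psi> (s D E) k *
          (\<Sum>N\<in>monic_polys k. (u S * h D E N S) * cnj (u T * h D E N T))))"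
        unfolding t_def by (intro sum.cong refl) (simp add: sum_distrib_left ac_simps)
      also have "\<dots> = c D E * (\<Sum>k<s D E. dual_weight \<psi> (s D E) k *
          (\<Sum>N\<in>monic_polys k. \<Sum>S\<in>?Q. \<Sum>T\<in>?Q. (u S * h D E N S) * cnj (u T * h D E N T)))"
      proof -
        have sw: "(\<Sum>S\<in>?Q. \<Sum>T\<in>?Q. a * (\<Sum>i\<in>I. x i S T)) = a * (\<Sum>i\<in>I. \<Sum>S\<in>?Q. \<Sum>T\<in>?Q. x i S T)"
          for a :: complex and I :: "'i set" and x
        proof -
          have "(\<Sum>S\<in>?Q. \<Sum>T\<in>?Q. \<Sum>i\<in>I. x i S T) = (\<Sum>S\<in>?Q. \<Sum>i\<in>I. \<Sum>T\<in>?Q. x i S T)"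
            by (rule sum.cong[OF refl], rule sum.swap)
          also have "\<dots> = (\<Sum>i\<in>I. \<Sum>S\<in>?Q. \<Sum>T\<in>?Q. x i S T)" by (rule sum.swap)
          finally show ?thesis by (simp flip: sum_distrib_left)
        qed
        show ?thesis unfolding sw ..
      qed
      finally show ?thesis unfolding norm_sum_double of_real_sum .
    qed
    show ?thesis
    proof (cases "?Q = {}")
      case True
      then have e: "(\<Sum>S\<in>?Q. g S) = 0" for g :: "_ \<Rightarrow> 'b::comm_monoid_add" by (simp only: sum.empty)
      have "Y D F E = 0" unfolding Y e by simp
      moreover have "0 \<le> 2 * real n * ?q * V * Z D F" using Z0 V0 by simp
      ultimately show ?thesis by simp
    next
      case False
      then obtain S where "S \<in> ?P" "D \<subseteq> S" by auto
      then have dn: "pdeg D \<le> n" using pdeg_mono[OF psets_prime_set[of S n], of D] psets_pdeg[of S n] by simp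
      have ed: "pdeg E \<le> pdeg D" using pdeg_mono[OF PU'[OF sub(1)] sub(2)] .
      let ?d = "pdeg D" and ?e = "pdeg E"
      have s2: "s D E \<le> 2 * n" by (simp add: s_def)
      have term_le: "cmod (dual_weight \<psi> (s D E) k * of_real (\<Sum>N\<in>monic_polys k. (cmod (\<Sum>S\<in>?Q. u S * h D E N S))\<^sup>2))
          \<le> ?q * (V * ?q ^ (n - ?d) / ?q ^ m * ?q ^ (n - ?d) * Z D F)" if k: "k < s D E" for k
      proof -
        \<comment> \<open>From \<open>k < 2 (n - d) - (m - e)\<close> and \<open>e \<le> d\<close>,
          where \<open>d\<close> and \<open>e\<close> are the degrees of \<open>D\<close> and
          \<open>E\<close>.\<close>
        have "k + m + ?d < 2 * n" using k ed dn sub(3) unfolding s_def by linarith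
        then have "large_sieve \<chi> k (n - ?d) (V * ?q ^ (n - ?d) / ?q ^ m)" by (rule ls[OF dn])
        then have "(\<Sum>N\<in>monic_polys k. (cmod (\<Sum>S\<in>?Q. u S * h D E N S))\<^sup>2) \<le> V * ?q ^ (n - ?d) / ?q ^ m * ?q ^ (n - ?d) * Z D F"
          unfolding h_def Z_def using V0 PU' sub by (intro dual_sieve_bound[OF psi]) auto
        then show ?thesis unfolding norm_mult norm_of_real using dual_weight_norm[OF psi, of "s D E" k]
          by (intro mult_mono) (simp_all add: sum_nonneg)
      qed
      have cD: "cmod (c D E) = ?q ^ (m - ?e) / ?q ^ (2 * (n - ?d))"
        by (simp add: c_def norm_mult norm_power norm_divide)
      have "cmod (Y D F E) \<le> cmod (c D E) * (\<Sum>k<s D E. ?q * (V * ?q ^ (n - ?d) / ?q ^ m * ?q ^ (n - ?d) * Z D F))"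
        unfolding Y norm_mult[of "c D E"] by (intro mult_left_mono sum_norm_le term_le) auto
      also have "\<dots> = cmod (c D E) * (?q ^ (n - ?d) * ?q ^ (n - ?d) / ?q ^ m) * (real (s D E) * (?q * V * Z D F))"
        by simp
      also have "\<dots> \<le> 1 * (real (2 * n) * (?q * V * Z D F))"
      proof (rule mult_mono)
        have "?q ^ (m - ?e) \<le> ?q ^ m" using q1 by (intro power_increasing) auto
        moreover have "?q ^ (2 * (n - ?d)) = ?q ^ (n - ?d) * ?q ^ (n - ?d)" by (simp add: mult_2 power_add)
        ultimately show "cmod (c D E) * (?q ^ (n - ?d) * ?q ^ (n - ?d) / ?q ^ m) \<le> 1"
          unfolding cD by (simp add: field_simps)
        show "real (s D E) * (?q * V * Z D F) \<le> real (2 * n) * (?q * V * Z D F)"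
          using s2 Z0 V0 by (intro mult_right_mono) auto
      qed (use Z0 V0 in auto)
      finally show ?thesis by (simp add: ac_simps)
    qed
  qed
  have G_diag: "cmod (G S S) \<le> ?q ^ m" if "S \<in> ?P" for S
  proof -
    have "cmod (G S S) \<le> (\<Sum>M\<in>(monic_polys m :: 'a poly set). 1)"
      unfolding G_def using psym_norm_le_1[OF sys psets_prime_set[OF that]]
      by (intro sum_norm_le) (simp add: norm_mult mult_le_one)
    then show ?thesis by (simp add: card_monic_polys)
  qed
  have "of_real (\<Sum>M\<in>monic_polys m. (cmod (\<Sum>S\<in>?P. u S * psym \<chi> S M))\<^sup>2) =
      (\<Sum>S\<in>?P. \<Sum>T\<in>?P. u S * cnj (u T) * G S T)"
    unfolding G_def by (rule sum_norm_square_expand)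
  also have "\<dots> = (\<Sum>S\<in>?P. \<Sum>T\<in>?P. (if S = T then u S * cnj (u T) * G S S else 0) +
      (\<Sum>(D, F, E)\<in>Tr. (-1) ^ card F * (if D \<union> F \<subseteq> S \<inter> T then u S * cnj (u T) * t D E S T else 0)))"
  proof (intro sum.cong refl)
    fix S T assume ST: "S \<in> ?P" "T \<in> ?P"
    have "u S * cnj (u T) * G S T = u S * cnj (u T) * (if S = T then G S S else 0) +
        (\<Sum>(D, F, E)\<in>Tr. u S * cnj (u T) * (if D \<union> F \<subseteq> S \<inter> T then (-1) ^ card F * t D E S T else 0))"
      unfolding G_eq[OF ST] split[OF ST] distrib_left sum_distrib_left by (simp add: case_prod_unfold)
    also have "\<dots> = (if S = T then u S * cnj (u T) * G S S else 0) +
      (\<Sum>(D, F, E)\<in>Tr. (-1) ^ card F * (if D \<union> F \<subseteq> S \<inter> T then u S * cnj (u T) * t D E S T else 0))"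
      by (intro arg_cong2[of _ _ _ _ "(+)"] sum.cong refl) (auto simp: case_prod_unfold)
    finally show "u S * cnj (u T) * G S T = \<dots>" .
  qed
  also have "\<dots> = (\<Sum>S\<in>?P. u S * cnj (u S) * G S S) + (\<Sum>(D, F, E)\<in>Tr. (-1) ^ card F * Y D F E)"
  proof -
    have "(\<Sum>S\<in>?P. \<Sum>T\<in>?P. \<Sum>x\<in>Tr. a x S T) = (\<Sum>x\<in>Tr. \<Sum>S\<in>?P. \<Sum>T\<in>?P. a x S T)" for a :: "_ \<Rightarrow> _ \<Rightarrow> _ \<Rightarrow> complex"
    proof -
      have "(\<Sum>S\<in>?P. \<Sum>T\<in>?P. \<Sum>x\<in>Tr. a x S T) = (\<Sum>S\<in>?P. \<Sum>x\<in>Tr. \<Sum>T\<in>?P. a x S T)"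
        by (rule sum.cong[OF refl], rule sum.swap)
      also have "\<dots> = (\<Sum>x\<in>Tr. \<Sum>S\<in>?P. \<Sum>T\<in>?P. a x S T)" by (rule sum.swap)
      finally show ?thesis .
    qed
    then show ?thesis unfolding sum.distrib Y_def
      by (simp add: case_prod_unfold sum_distrib_left)
  qed
  finally have main: "of_real (\<Sum>M\<in>monic_polys m. (cmod (\<Sum>S\<in>?P. u S * psym \<chi> S M))\<^sup>2) =
      (\<Sum>S\<in>?P. u S * cnj (u S) * G S S) + (\<Sum>(D, F, E)\<in>Tr. (-1) ^ card F * Y D F E)" .
  have b1: "cmod (\<Sum>S\<in>?P. u S * cnj (u S) * G S S) \<le> ?q ^ m * L"
  proof -
    have "cmod (\<Sum>S\<in>?P. u S * cnj (u S) * G S S) \<le> (\<Sum>S\<in>?P. (cmod (u S))\<^sup>2 * ?q ^ m)"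
      by (intro sum_norm_le) (auto simp: norm_mult power2_eq_square intro!: mult_left_mono G_diag)
    then show ?thesis by (simp add: L_def sum_distrib_left mult.commute)
  qed
  have b2: "cmod (\<Sum>(D, F, E)\<in>Tr. (-1) ^ card F * Y D F E) \<le> 2 * real n * ?q * V * (W * L)"
  proof -
    have "cmod (\<Sum>(D, F, E)\<in>Tr. (-1) ^ card F * Y D F E) \<le> (\<Sum>(D, F, E)\<in>Tr. 2 * real n * ?q * V * Z D F)"
      by (intro sum_norm_le) (auto simp: norm_mult norm_power intro: Y_bound)
    also have "\<dots> = 2 * real n * ?q * V * (\<Sum>(D, F, E)\<in>Tr. Z D F)"
      by (simp add: sum_distrib_left case_prod_unfold)
    also have "\<dots> \<le> 2 * real n * ?q * V * (W * L)"
    proof (rule mult_left_mono)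
      have "(\<Sum>(D, F, E)\<in>Tr. Z D F) = (\<Sum>x\<in>Tr. \<Sum>S\<in>?P. if fst x \<union> fst (snd x) \<subseteq> S then (cmod (u S))\<^sup>2 else 0)"
        unfolding Z_def case_prod_unfold by (intro sum.cong refl sum.inter_filter) simp
      also have "\<dots> = (\<Sum>S\<in>?P. \<Sum>x\<in>Tr. if fst x \<union> fst (snd x) \<subseteq> S then (cmod (u S))\<^sup>2 else 0)" by (rule sum.swap)
      \<comment> \<open>After exchanging the sums, the coefficient at \<open>S\<close> is counted
        once for each admissible triple of subsets of \<open>S\<close>, of which there are at most
        \<open>8 ^ card S\<close>.\<close>
      also have "\<dots> \<le> (\<Sum>S\<in>?P. W * (cmod (u S))\<^sup>2)"
      proof (intro sum_mono)
        fix S assume S: "S \<in> ?P"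
        have fS: "finite S" using prime_setD(1)[OF psets_prime_set[OF S]] .
        have "(\<Sum>x\<in>Tr. if fst x \<union> fst (snd x) \<subseteq> S then (cmod (u S))\<^sup>2 else 0) =
            (\<Sum>x\<in>{x\<in>Tr. fst x \<union> fst (snd x) \<subseteq> S}. (cmod (u S))\<^sup>2)"
          using Tr_fin by (rule sum.inter_filter[symmetric])
        also have "\<dots> \<le> (\<Sum>x\<in>Pow S \<times> Pow S \<times> Pow S. (cmod (u S))\<^sup>2)"
          using fS by (intro sum_mono2) (auto simp: Tr_def, blast)
        also have "\<dots> = 8 ^ card S * (cmod (u S))\<^sup>2"
          using fS by (simp add: card_cartesian_product card_Pow power_mult_distrib[symmetric])
        also have "\<dots> \<le> W * (cmod (u S))\<^sup>2" by (intro mult_right_mono W[OF S]) simp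
        finally show "(\<Sum>x\<in>Tr. if fst x \<union> fst (snd x) \<subseteq> S then (cmod (u S))\<^sup>2 else 0) \<le> W * (cmod (u S))\<^sup>2" .
      qed
      finally show "(\<Sum>(D, F, E)\<in>Tr. Z D F) \<le> W * L" by (simp add: L_def sum_distrib_left)
    qed (use V0 in simp)
    finally show ?thesis .
  qed
  have "(\<Sum>M\<in>monic_polys m. (cmod (\<Sum>S\<in>?P. u S * psym \<chi> S M))\<^sup>2) =
      cmod (of_real (\<Sum>M\<in>monic_polys m. (cmod (\<Sum>S\<in>?P. u S * psym \<chi> S M))\<^sup>2))"
    unfolding norm_of_real by (rule abs_of_nonneg[symmetric], rule sum_nonneg) simp
  also have "\<dots> \<le> ?q ^ m * L + 2 * real n * ?q * V * (W * L)"
    unfolding main by (rule order_trans[OF norm_triangle_ineq add_mono[OF b1 b2]])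
  finally show "(\<Sum>M\<in>monic_polys m. (cmod (\<Sum>S\<in>?P. u S * psym \<chi> S M))\<^sup>2) \<le>
      (?q ^ m + 2 * real n * ?q * W * V) * (\<Sum>S\<in>?P. (cmod (u S))\<^sup>2)"
    by (simp add: L_def algebra_simps)
qed

end

section \<open>Iteration of the duality\<close>

lemma cube_le_powr:
  assumes "Q > 1" "\<epsilon> > (0::real)"
  shows "\<exists>C>0. \<forall>k::nat. (real k + 1) ^ 3 \<le> C * Q powr (\<epsilon> * real k)"
proof -
  \<comment> \<open>With this choice \<open>1 + x \<le> exp x\<close> yields
    \<open>\<delta> (k + 1) \<le> Q^(\<epsilon> k / 3)\<close>, whose cube is the claim.\<close>
  define \<delta> where "\<delta> = min 1 (\<epsilon> / 3 * ln Q)"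
  have d: "\<delta> > 0" "\<delta> \<le> 1" "\<delta> \<le> \<epsilon> / 3 * ln Q" using assms by (auto simp: \<delta>_def)
  have "(real k + 1) ^ 3 \<le> (1 / \<delta>) ^ 3 * Q powr (\<epsilon> * real k)" for k :: nat
  proof -
    have "\<delta> * (real k + 1) \<le> 1 + \<epsilon> / 3 * ln Q * real k"
      using mult_right_mono[OF d(3), of "real k"] d(2) by (simp add: algebra_simps)
    also have "\<dots> \<le> exp (\<epsilon> / 3 * ln Q * real k)" by (rule exp_ge_add_one_self)
    also have "\<dots> = Q powr (\<epsilon> / 3 * real k)" using assms by (simp add: powr_def ac_simps)
    finally have "real k + 1 \<le> (1 / \<delta>) * Q powr (\<epsilon> / 3 * real k)" using d by (simp add: field_simps)
    then have "(real k + 1) ^ 3 \<le> ((1 / \<delta>) * Q powr (\<epsilon> / 3 * real k)) ^ 3" by (intro power_mono) auto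
    also have "\<dots> = (1 / \<delta>) ^ 3 * (Q powr (\<epsilon> / 3 * real k)) ^ 3" by (rule power_mult_distrib)
    also have "(Q powr (\<epsilon> / 3 * real k)) ^ 3 = Q powr (\<epsilon> * real k)" using assms by (subst powr_power) auto
    finally show ?thesis .
  qed
  then show ?thesis using d by (intro exI[of _ "(1 / \<delta>) ^ 3"]) auto
qed

text \<open>The primes of large degree contribute at most \<open>q\<^sup>\<epsilon>\<close> to the power of their degree each, and
  the others number \<open>O(1)\<close>.\<close>

lemma subset_triples_le_powr:
  assumes "\<epsilon> > 0"
  shows "\<exists>C>0. \<forall>n. \<forall>S\<in>(psets n :: 'a::{field,finite} poly set set). 8 ^ card S \<le> C * real CARD('a) powr (\<epsilon> * real n)"
proof -
  let ?Q = "real CARD('a)"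
  have Q: "?Q > 1" using card_field_ge_2[where 'a='a] by linarith
  \<comment> \<open>From degree \<open>K\<close> on, a prime satisfies
    \<open>8 \<le> Q^(\<epsilon> d)\<close> for its degree \<open>d\<close>.\<close>
  define K where "K = nat \<lceil>ln 8 / (\<epsilon> * ln ?Q)\<rceil>"
  have "ln 8 / (\<epsilon> * ln ?Q) \<le> real K" unfolding K_def by linarith
  then have "ln 8 \<le> \<epsilon> * ln ?Q * real K" using Q assms by (simp add: field_simps)
  then have K8: "8 \<le> ?Q powr (\<epsilon> * real d)" if "K \<le> d" for d
  proof -
    assume h: "ln 8 \<le> \<epsilon> * ln ?Q * real K"
    have "\<epsilon> * ln ?Q * real K \<le> \<epsilon> * ln ?Q * real d" using that Q assms by (intro mult_left_mono) auto
    then have "ln 8 \<le> \<epsilon> * ln ?Q * real d" using h by linarith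
    then have "exp (ln 8) \<le> exp (\<epsilon> * ln ?Q * real d)" by (simp only: exp_le_cancel_iff)
    then show ?thesis using Q by (simp add: powr_def ac_simps)
  qed
  define U where "U = {\<pi> :: 'a poly. \<pi> \<in> monic_primes \<and> degree \<pi> < K}"
  have "U \<subseteq> (\<Union>d\<in>{..<K}. monic_polys d)" by (auto simp: U_def monic_primes_def monic_polys_def)
  then have U_fin: "finite U" by (rule finite_subset) auto
  have "8 ^ card S \<le> 8 ^ card U * ?Q powr (\<epsilon> * real n)" if S: "S \<in> (psets n :: 'a poly set set)" for S n
  proof -
    have fS: "finite S" "S \<subseteq> monic_primes" using prime_setD[OF psets_prime_set[OF S]] by auto
    have "card (S \<inter> U) \<le> card U" using U_fin by (intro card_mono) auto
    then have 1: "(8::real) ^ card (S \<inter> U) \<le> 8 ^ card U" by (intro power_increasing) auto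
    have "(8::real) ^ card (S - U) = (\<Prod>\<pi>\<in>S - U. 8)" by simp
    also have "\<dots> \<le> (\<Prod>\<pi>\<in>S - U. ?Q powr (\<epsilon> * real (degree \<pi>)))"
      using fS by (intro prod_mono) (auto simp: U_def not_less intro!: K8)
    also have "\<dots> = ?Q powr (\<epsilon> * real (pdeg (S - U)))"
      using Q by (simp add: powr_sum[symmetric] pdeg_def sum_distrib_left)
    also have "\<dots> \<le> ?Q powr (\<epsilon> * real n)"
      using pdeg_mono[OF psets_prime_set[OF S], of "S - U"] psets_pdeg[OF S] Q assms
      by (intro powr_mono mult_left_mono) auto
    finally have 2: "(8::real) ^ card (S - U) \<le> ?Q powr (\<epsilon> * real n)" .
    have "card S = card (S \<inter> U) + card (S - U)" using fS by (metis card_Int_Diff)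
    then have "(8::real) ^ card S = 8 ^ card (S \<inter> U) * 8 ^ card (S - U)" by (simp add: power_add)
    also have "\<dots> \<le> 8 ^ card U * ?Q powr (\<epsilon> * real n)" using 1 2 by (intro mult_mono) auto
    finally show ?thesis .
  qed
  then show ?thesis by (intro exI[of _ "8 ^ card U"]) auto
qed

text \<open>\<open>P\<close> is the range of \<open>(m, n)\<close> covered. The constant precedes
  \<open>\<chi>\<close>, hence is uniform over symbol systems; \<open>\<epsilon>\<close> is
  quantified inside because each round of the iteration uses up part of it.\<close>

definition sieve_bound :: "'a::{field,finite} itself \<Rightarrow> (nat \<Rightarrow> nat \<Rightarrow> bool) \<Rightarrow> bool" where
  "sieve_bound _ P \<longleftrightarrow> (\<forall>\<epsilon>>0. \<exists>C>0. \<forall>\<chi> :: 'a poly \<Rightarrow> 'a poly \<Rightarrow> complex. symbol_system \<chi> \<longrightarrow>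
     (\<forall>m n. P m n \<longrightarrow> large_sieve \<chi> m n (C * real CARD('a) powr (\<epsilon> * (real m + real n)) *
        (real CARD('a) ^ m + real CARD('a) powr (2 * (real m + real n) / 3)))))"

text \<open>\<open>P\<close> is used with exchanged roles, as \<open>P n a\<close>: the square-free
  sieve over degree \<open>a\<close> with moduli of degree \<open>n\<close> is traded for the sieve
  over degree \<open>n\<close> with moduli of degree \<open>a\<close>.\<close>

lemma sieve_bound_short:
  assumes bd: "sieve_bound TYPE('a::{field,finite}) P" and eps: "\<epsilon> > 0"
  shows "\<exists>C>0. \<forall>\<chi> :: 'a poly \<Rightarrow> 'a poly \<Rightarrow> complex. symbol_system \<chi> \<longrightarrow>
     (\<forall>k n. k \<le> n \<and> (\<forall>a\<le>k. P n a) \<longrightarrow>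
        large_sieve \<chi> k n (C * real CARD('a) powr (\<epsilon> * (real k + real n)) * real CARD('a) powr (real n + real k / 3)))"
proof -
  define Q where "Q = real CARD('a)"
  have Q: "Q > 1" unfolding Q_def using card_field_ge_2[where 'a='a] by linarith
  have "\<epsilon> / 2 > 0" using eps by simp
  then obtain C where C: "C > 0" "\<And>(\<chi> :: 'a poly \<Rightarrow> 'a poly \<Rightarrow> complex) m n. symbol_system \<chi> \<Longrightarrow> P m n \<Longrightarrow>
     large_sieve \<chi> m n (C * Q powr (\<epsilon> / 2 * (real m + real n)) * (Q ^ m + Q powr (2 * (real m + real n) / 3)))"
    using bd unfolding sieve_bound_def Q_def by meson
  obtain C2 where C2: "C2 > 0" "\<And>k::nat. (real k + 1) ^ 3 \<le> C2 * Q powr (\<epsilon> / 2 * real k)"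
    using cube_le_powr[OF Q \<open>\<epsilon> / 2 > 0\<close>] by auto
  define C' where "C' = C2 * (2 * (C + 1))"
  have "large_sieve \<chi> k n (C' * Q powr (\<epsilon> * (real k + real n)) * Q powr (real n + real k / 3))"
    if sys: "symbol_system \<chi>" and k: "k \<le> n" and P: "\<And>a. a \<le> k \<Longrightarrow> P n a"
    for \<chi> :: "'a poly \<Rightarrow> 'a poly \<Rightarrow> complex" and k n
  proof -
    define e where "e = Q powr (\<epsilon> / 2 * (real k + real n))"
    define \<beta> where "\<beta> a = C * e * (Q ^ n + Q powr (2 * (real n + real a) / 3))" for a :: nat
    define K where "K = 2 * (C + 1) * e * Q powr (real n + real k / 3)"
    have e1: "e \<ge> 1" unfolding e_def using Q eps by (intro ge_one_powr_ge_zero) auto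
    have beta0: "\<beta> a \<ge> 0" for a using C(1) Q e1 by (simp add: \<beta>_def)
    have "large_sieve \<chi> k n ((real k + 1) ^ 3 * K)"
    proof (rule large_sieve_from_squarefree[OF sys k])
      show "squarefree_sieve \<chi> a n (\<beta> a)" if a: "a \<le> k" for a
      proof (rule squarefree_sieve_sym[OF sys beta0])
        have "large_sieve \<chi> n a (C * Q powr (\<epsilon> / 2 * (real n + real a)) * (Q ^ n + Q powr (2 * (real n + real a) / 3)))"
          by (rule C(2)[OF sys P[OF a]])
        then have "large_sieve \<chi> n a (\<beta> a)"
        proof (rule large_sieve_mono)
          have "Q powr (\<epsilon> / 2 * (real n + real a)) \<le> e" unfolding e_def using Q eps a
            by (intro powr_mono mult_left_mono) auto
          then show "C * Q powr (\<epsilon> / 2 * (real n + real a)) * (Q ^ n + Q powr (2 * (real n + real a) / 3)) \<le> \<beta> a"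
            unfolding \<beta>_def using C(1) Q by (intro mult_right_mono mult_left_mono) auto
        qed
        then show "squarefree_sieve \<chi> n a (\<beta> a)" by (rule large_sieve_imp_squarefree_sieve)
      qed
    next
      fix a b c :: nat assume abc: "a + 2 * b + 3 * c = k"
      then have kr: "real k = real a + 2 * real b + 3 * real c" by (metis of_nat_add of_nat_mult of_nat_numeral)
      have kn: "real k \<le> real n" using k by simp
      have Qn: "Q ^ j = Q powr real j" for j using Q by (simp add: powr_realpow)
      \<comment> \<open>Since \<open>a + 2 b + 3 c = k\<close>, the smaller of \<open>a\<close> and
        \<open>b\<close>, increased by \<open>c\<close>, is at most \<open>k / 3\<close>.\<close>
      have "Q ^ (b + c) * \<beta> a \<le> K \<or> Q ^ (a + c) * Q ^ n \<le> K"
      proof (cases "b \<le> a")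
        case True
        then have ba: "real b \<le> real a" by simp
        have "Q ^ (b + c) * \<beta> a = C * e * (Q powr (real b + real c + real n) + Q powr (real b + real c + 2 * (real n + real a) / 3))"
          unfolding \<beta>_def Qn by (simp add: powr_add algebra_simps)
        also have "\<dots> \<le> C * e * (Q powr (real n + real k / 3) + Q powr (real n + real k / 3))"
        proof -
          have "Q powr (real b + real c + real n) \<le> Q powr (real n + real k / 3)"
            by (rule powr_mono) (use Q kr kn ba in auto)
          \<comment> \<open>Cleared of common terms this reads \<open>a + b \<le> n\<close>, which
            follows from \<open>k \<le> n\<close>.\<close>
          moreover have "Q powr (real b + real c + 2 * (real n + real a) / 3) \<le> Q powr (real n + real k / 3)"
            by (rule powr_mono) (use Q kr kn ba in \<open>auto simp: field_simps\<close>)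
          ultimately show ?thesis using C(1) e1 by (intro mult_left_mono add_mono) auto
        qed
        also have "\<dots> = 2 * C * e * Q powr (real n + real k / 3)" by simp
        also have "\<dots> \<le> K" unfolding K_def using C(1) e1 Q by (intro mult_right_mono) auto
        finally show ?thesis by blast
      next
        case False
        then have ab: "real a \<le> real b" by simp
        have "Q ^ (a + c) * Q ^ n = Q powr (real a + real c + real n)" unfolding Qn by (simp add: powr_add)
        also have "\<dots> \<le> 1 * Q powr (real n + real k / 3)" unfolding mult_1 by (rule powr_mono) (use Q kr ab in auto)
        also have "\<dots> \<le> K" unfolding K_def
        proof (rule mult_right_mono)
          have "1 * 1 \<le> (2 * (C + 1)) * e" using C(1) e1 by (intro mult_mono) auto
          then show "1 \<le> 2 * (C + 1) * e" by simp
        qed auto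
        finally show ?thesis by blast
      qed
      then show "real CARD('a) ^ (b + c) * \<beta> a \<le> K \<or> real CARD('a) ^ (a + c) * real CARD('a) ^ n \<le> K"
        unfolding Q_def .
    qed (rule beta0)
    then show ?thesis
    proof (rule large_sieve_mono)
      have "C2 * Q powr (\<epsilon> / 2 * real k) \<le> C2 * e" unfolding e_def using Q eps C2
        by (intro mult_left_mono powr_mono) auto
      then have "(real k + 1) ^ 3 \<le> C2 * e" using C2(2)[of k] by linarith
      then have "(real k + 1) ^ 3 * K \<le> C2 * e * K" unfolding K_def using C(1) e1 Q
        by (intro mult_right_mono) auto
      also have "\<dots> = C' * (e * e) * Q powr (real n + real k / 3)" by (simp add: C'_def K_def)
      also have "e * e = Q powr (\<epsilon> * (real k + real n))" unfolding e_def by (simp add: algebra_simps flip: powr_add)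
      finally show "(real k + 1) ^ 3 * K \<le> C' * Q powr (\<epsilon> * (real k + real n)) * Q powr (real n + real k / 3)" .
    qed
  qed
  moreover have "C' > 0" using C C2 by (simp add: C'_def)
  ultimately show ?thesis unfolding Q_def by blast
qed

text \<open>The range forces \<open>n = 0\<close>, the limiting case of an infinite ratio
  \<open>m / n\<close>. No \<open>k\<close> satisfies \<open>k + m + d < 0\<close>, so the duality
  holds with \<open>V = 0\<close>.\<close>

lemma sieve_bound_0: "sieve_bound TYPE('a::{field,finite}) (\<lambda>m n. Suc 0 * n \<le> 0 * m)"
  unfolding sieve_bound_def
proof (intro allI impI)
  fix \<epsilon> :: real assume eps: "\<epsilon> > 0"
  define Q where "Q = real CARD('a)"
  have Q: "Q > 1" unfolding Q_def using card_field_ge_2[where 'a='a] by linarith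
  have "large_sieve \<chi> m n (1 * Q powr (\<epsilon> * (real m + real n)) * (Q ^ m + Q powr (2 * (real m + real n) / 3)))"
    if sys: "symbol_system \<chi>" and n: "Suc 0 * n \<le> 0 * m" for \<chi> :: "'a poly \<Rightarrow> 'a poly \<Rightarrow> complex" and m n
  proof -
    have n0: "n = 0" using n by simp
    obtain W where W: "\<And>n (S :: 'a poly set). S \<in> psets n \<Longrightarrow> 8 ^ card S \<le> W * Q powr (1 * real n)"
      using subset_triples_le_powr[where 'a='a, of 1] unfolding Q_def by auto
    have "large_sieve \<chi> m n (real CARD('a) ^ m + 2 * real n * real CARD('a) * (W * Q powr (1 * real n)) * 0)"
      by (rule large_sieve_dual[OF sys order_refl _ W]) (use n0 in simp_all)
    then show ?thesis
    proof (rule large_sieve_mono)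
      have "1 * Q ^ m \<le> Q powr (\<epsilon> * (real m + real n)) * (Q ^ m + Q powr (2 * (real m + real n) / 3))"
        using Q eps by (intro mult_mono ge_one_powr_ge_zero) auto
      then show "real CARD('a) ^ m + 2 * real n * real CARD('a) * (W * Q powr (1 * real n)) * 0
          \<le> 1 * Q powr (\<epsilon> * (real m + real n)) * (Q ^ m + Q powr (2 * (real m + real n) / 3))"
        by (simp add: Q_def)
    qed
  qed
  then show "\<exists>C>0. \<forall>\<chi> :: 'a poly \<Rightarrow> 'a poly \<Rightarrow> complex. symbol_system \<chi> \<longrightarrow>
     (\<forall>m n. Suc 0 * n \<le> 0 * m \<longrightarrow> large_sieve \<chi> m n (C * real CARD('a) powr (\<epsilon> * (real m + real n)) *
        (real CARD('a) ^ m + real CARD('a) powr (2 * (real m + real n) / 3))))"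
    unfolding Q_def by (intro exI[of _ 1]) auto
qed

text \<open>The dual sums have length \<open>k < 2 n - m - d\<close> for moduli of degree \<open>n - d\<close>, so that
  \<open>m / n \<ge> (j + 2) / (j + 1)\<close> implies \<open>(n - d) / k \<ge> (j + 1) / j\<close>.\<close>

lemma sieve_bound_Suc:
  assumes bd: "sieve_bound TYPE('a::{field,finite}) (\<lambda>m n. Suc j * n \<le> j * m)"
  shows "sieve_bound TYPE('a) (\<lambda>m n. Suc (Suc j) * n \<le> Suc j * m)"
  unfolding sieve_bound_def
proof (intro allI impI)
  fix \<epsilon> :: real assume eps: "\<epsilon> > 0"
  define Q where "Q = real CARD('a)"
  have Q: "Q > 1" unfolding Q_def using card_field_ge_2[where 'a='a] by linarith
  \<comment> \<open>Three factors of size \<open>q^(\<delta> (m + n))\<close> occur: from the bound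
    for short dual sums, from the count of triples, and from the factor \<open>n\<close>.\<close>
  define \<delta> where "\<delta> = \<epsilon> / 3"
  have d0: "\<delta> > 0" using eps by (simp add: \<delta>_def)
  obtain C1 where C1: "C1 > 0" "\<And>(\<chi> :: 'a poly \<Rightarrow> 'a poly \<Rightarrow> complex) k n. symbol_system \<chi> \<Longrightarrow> k \<le> n \<Longrightarrow>
      (\<And>a. a \<le> k \<Longrightarrow> Suc j * a \<le> j * n) \<Longrightarrow>
      large_sieve \<chi> k n (C1 * Q powr (\<delta> * (real k + real n)) * Q powr (real n + real k / 3))"
    using sieve_bound_short[OF bd d0] unfolding Q_def by meson
  obtain C2 where C2: "C2 > 0" "\<And>n (S :: 'a poly set). S \<in> psets n \<Longrightarrow> 8 ^ card S \<le> C2 * Q powr (\<delta> * real n)"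
    using subset_triples_le_powr[where 'a='a, OF d0] unfolding Q_def by auto
  obtain C3 where C3: "C3 > 0" "\<And>k::nat. (real k + 1) ^ 3 \<le> C3 * Q powr (\<delta> * real k)"
    using cube_le_powr[OF Q d0] by auto
  define C where "C = 1 + 2 * Q * C3 * C2 * C1"
  have C0: "C \<ge> 1" using C1(1) C2(1) C3(1) Q by (simp add: C_def)
  have "large_sieve \<chi> m n (C * Q powr (\<epsilon> * (real m + real n)) * (Q ^ m + Q powr (2 * (real m + real n) / 3)))"
    if sys: "symbol_system \<chi>" and mn: "Suc (Suc j) * n \<le> Suc j * m" for \<chi> :: "'a poly \<Rightarrow> 'a poly \<Rightarrow> complex" and m n
  proof -
    have "Suc j * n \<le> Suc j * m" using mn by simp
    then have nm: "n \<le> m" by (simp only: Suc_mult_le_cancel1)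
    define f where "f = Q powr (\<delta> * (real m + real n))"
    define T where "T = Q powr (2 * (real m + real n) / 3)"
    define V where "V = C1 * f * T"
    have f1: "f \<ge> 1" unfolding f_def using Q d0 by (intro ge_one_powr_ge_zero) auto
    have T0: "T \<ge> 0" by (simp add: T_def)
    have V0: "V \<ge> 0" using C1(1) f1 T0 by (simp add: V_def)
    have "large_sieve \<chi> m n (real CARD('a) ^ m + 2 * real n * real CARD('a) * (C2 * Q powr (\<delta> * real n)) * V)"
    proof (rule large_sieve_dual[OF sys V0])
      fix d k assume d: "d \<le> n" and k: "k + m + d < 2 * n"
      have kd: "k \<le> n - d" using k nm by linarith
      have P: "Suc j * a \<le> j * (n - d)" if "a \<le> k" for a
      proof -
        have i: "int a + int m + int d \<le> 2 * int n" using k that by linarith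
        have "(int j + 1) * (int a + int m + int d) \<le> (int j + 1) * (2 * int n)" using i by (intro mult_left_mono) auto
        moreover have "(int j + 2) * int n \<le> (int j + 1) * int m"
        proof -
          have "int (Suc (Suc j) * n) \<le> int (Suc j * m)" using mn by (simp only: of_nat_le_iff)
          then show ?thesis by (simp add: algebra_simps)
        qed
        ultimately have "(int j + 1) * int a \<le> int j * (int n - int d)"
          by (simp add: algebra_simps)
        then have "int (Suc j * a) \<le> int (j * (n - d))" using d by (simp add: of_nat_diff algebra_simps)
        then show ?thesis by (simp only: of_nat_le_iff)
      qed
      have "large_sieve \<chi> k (n - d) (C1 * Q powr (\<delta> * (real k + real (n - d))) * Q powr (real (n - d) + real k / 3))"
        by (rule C1(2)[OF sys kd P])
      then have "large_sieve \<chi> k (n - d) (V * Q ^ (n - d) / Q ^ m)"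
      proof (rule large_sieve_mono)
        \<comment> \<open>Moving \<open>Q ^ m\<close> across leaves the exponent
          \<open>k / 3 + m\<close>, and \<open>k \<le> 2 n - m\<close> makes it at most
          \<open>2 (m + n) / 3\<close>.\<close>
        have "C1 * Q powr (\<delta> * (real k + real (n - d))) * Q powr (real (n - d) + real k / 3) * Q ^ m =
            C1 * Q powr (\<delta> * (real k + real (n - d))) * Q powr (real k / 3 + real m) * Q ^ (n - d)"
          using Q by (simp add: powr_add powr_realpow)
        also have "\<dots> \<le> C1 * f * T * Q ^ (n - d)"
        proof -
          have "real k + real (n - d) \<le> real m + real n" using kd nm by linarith
          then have "Q powr (\<delta> * (real k + real (n - d))) \<le> f" unfolding f_def using Q d0
            by (intro powr_mono mult_left_mono) auto
          moreover have "real k + real m \<le> 2 * real n" using k by linarith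
          then have "3 * (real k / 3 + real m) \<le> 3 * (2 * (real m + real n) / 3)"
            by (simp add: distrib_left)
          then have "real k / 3 + real m \<le> 2 * (real m + real n) / 3" by (rule mult_left_le_imp_le) simp
          then have "Q powr (real k / 3 + real m) \<le> T" unfolding T_def using Q by (intro powr_mono) auto
          ultimately show ?thesis using C1(1) Q f1 T0 by (intro mult_right_mono mult_mono mult_left_mono) auto
        qed
        finally show "C1 * Q powr (\<delta> * (real k + real (n - d))) * Q powr (real (n - d) + real k / 3) \<le> V * Q ^ (n - d) / Q ^ m"
          using Q by (simp add: V_def pos_le_divide_eq)
      qed
      then show "large_sieve \<chi> k (n - d) (V * real CARD('a) ^ (n - d) / real CARD('a) ^ m)" unfolding Q_def .
    qed (rule C2(2))
    then show ?thesis
    proof (rule large_sieve_mono)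
      have fm: "Q powr (\<delta> * real n) \<le> f" unfolding f_def using Q d0 by (intro powr_mono mult_left_mono) auto
      have "real n \<le> (real n + 1) ^ 3" using self_le_power[of "real n + 1" 3] by simp
      also have "\<dots> \<le> C3 * Q powr (\<delta> * real n)" by (rule C3(2))
      also have "\<dots> \<le> C3 * f" using fm C3 by (intro mult_left_mono) auto
      finally have nf: "real n \<le> C3 * f" .
      have fff: "f * f * f = Q powr (\<epsilon> * (real m + real n))"
        unfolding f_def \<delta>_def by (simp add: field_simps flip: powr_add)
      have "2 * real n * Q * (C2 * Q powr (\<delta> * real n)) * V \<le> 2 * (C3 * f) * Q * (C2 * f) * V"
        using nf fm V0 Q C2(1) C3(1) f1 by (intro mult_mono mult_nonneg_nonneg) auto
      also have "\<dots> = 2 * Q * C3 * C2 * C1 * (f * f * f) * T" by (simp add: V_def)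
      finally have b: "2 * real n * Q * (C2 * Q powr (\<delta> * real n)) * V \<le> (2 * Q * C3 * C2 * C1) * (f * f * f) * T" .
      have F1: "f * f * f \<ge> 1" unfolding fff using Q eps by (intro ge_one_powr_ge_zero) auto
      have "1 * 1 \<le> C * (f * f * f)" using C0 F1 by (intro mult_mono) auto
      then have "1 * Q ^ m \<le> C * (f * f * f) * Q ^ m" using Q by (intro mult_right_mono) auto
      moreover have "(2 * Q * C3 * C2 * C1) * (f * f * f) * T \<le> C * (f * f * f) * T"
        using F1 T0 by (intro mult_right_mono) (auto simp: C_def)
      ultimately show "real CARD('a) ^ m + 2 * real n * real CARD('a) * (C2 * Q powr (\<delta> * real n)) * V
          \<le> C * Q powr (\<epsilon> * (real m + real n)) * (Q ^ m + Q powr (2 * (real m + real n) / 3))"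
        using b unfolding Q_def[symmetric] T_def[symmetric] fff[symmetric] by (simp add: distrib_left)
    qed
  qed
  then show "\<exists>C>0. \<forall>\<chi> :: 'a poly \<Rightarrow> 'a poly \<Rightarrow> complex. symbol_system \<chi> \<longrightarrow>
     (\<forall>m n. Suc (Suc j) * n \<le> Suc j * m \<longrightarrow> large_sieve \<chi> m n (C * real CARD('a) powr (\<epsilon> * (real m + real n)) *
        (real CARD('a) ^ m + real CARD('a) powr (2 * (real m + real n) / 3))))"
    using C0 unfolding Q_def by (intro exI[of _ C]) auto
qed

lemma sieve_bound_ratio: "sieve_bound TYPE('a::{field,finite}) (\<lambda>m n. Suc j * n \<le> j * m)"
  by (induction j) (use sieve_bound_0 sieve_bound_Suc in blast)+

text \<open>Raising \<open>m\<close> by some \<open>d\<close> with \<open>n \<le> j * d\<close>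
  brings \<open>n \<le> m\<close> into the range of ratio \<open>(j + 1) / j\<close>. The cost is
  essentially \<open>q^(2 d)\<close>, and \<open>d\<close> is about \<open>n / j\<close>, so a large
  \<open>j\<close> hides it in \<open>q^\<epsilon>\<close>.\<close>

lemma sieve_bound_long: "sieve_bound TYPE('a::{field,finite}) (\<lambda>m n. n \<le> m)"
  unfolding sieve_bound_def
proof (intro allI impI)
  fix \<epsilon> :: real assume eps: "\<epsilon> > 0"
  define Q where "Q = real CARD('a)"
  have Q: "Q > 1" unfolding Q_def using card_field_ge_2[where 'a='a] by linarith
  \<comment> \<open>The bound by \<open>1\<close> keeps the loss \<open>\<delta> d\<close> caused by
    the shift below \<open>d\<close>; the bound by \<open>\<epsilon> / 2\<close> leaves half of the
    exponent for the shift itself.\<close>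
  define \<delta> where "\<delta> = min 1 (\<epsilon> / 2)"
  have d0: "\<delta> > 0" "\<delta> \<le> 1" "\<delta> \<le> \<epsilon> / 2" using eps by (auto simp: \<delta>_def)
  \<comment> \<open>Chosen so that \<open>1 / j \<le> \<epsilon> / 4\<close>, which gives
    \<open>d \<le> \<epsilon> n / 4 + 1\<close>.\<close>
  define j where "j = Suc (nat \<lceil>4 / \<epsilon>\<rceil>)"
  have "4 / \<epsilon> \<le> real j" unfolding j_def by linarith
  then have j: "j > 0" "4 \<le> \<epsilon> * real j" using eps by (auto simp: j_def field_simps)
  obtain C1 where C1: "C1 > 0" "\<And>(\<chi> :: 'a poly \<Rightarrow> 'a poly \<Rightarrow> complex) m n. symbol_system \<chi> \<Longrightarrow> Suc j * n \<le> j * m \<Longrightarrow>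
     large_sieve \<chi> m n (C1 * Q powr (\<delta> * (real m + real n)) * (Q ^ m + Q powr (2 * (real m + real n) / 3)))"
    using sieve_bound_ratio[where 'a='a, of j] d0(1) unfolding sieve_bound_def Q_def by meson
  have "large_sieve \<chi> m n (2 * C1 * Q powr 2 * Q powr (\<epsilon> * (real m + real n)) * (Q ^ m + Q powr (2 * (real m + real n) / 3)))"
    if sys: "symbol_system \<chi>" and nm: "n \<le> m" for \<chi> :: "'a poly \<Rightarrow> 'a poly \<Rightarrow> complex" and m n
  proof -
    define d where "d = n div j + 1"
    have "n = j * (n div j) + n mod j" by simp
    moreover have "n mod j < j" using j by simp
    moreover have "j * d = j * (n div j) + j" by (simp add: d_def)
    ultimately have jd: "n \<le> j * d" by linarith
    have "real (n div j) * real j \<le> real n" by (metis div_times_less_eq_dividend of_nat_le_iff of_nat_mult)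
    then have "real (n div j) * (real j * \<epsilon>) \<le> real n * \<epsilon>" using eps mult_right_mono[of _ _ \<epsilon>] by (simp add: mult.assoc)
    moreover have "real (n div j) * 4 \<le> real (n div j) * (real j * \<epsilon>)"
      using j by (intro mult_left_mono) (auto simp: mult.commute)
    ultimately have "real (n div j) * 4 \<le> real n * \<epsilon>" by (rule order_trans[rotated])
    then have dle: "real d \<le> \<epsilon> / 4 * real n + 1" by (simp add: d_def mult.commute)
    define T where "T = Q ^ m + Q powr (2 * (real m + real n) / 3)"
    define B where "B = C1 * Q powr (\<delta> * (real m + real d + real n)) * (Q powr real d * T)"
    have T0: "T \<ge> 0" using Q by (simp add: T_def)
    have "large_sieve \<chi> m n (2 * B)"
    proof (rule large_sieve_shift[OF sys, where d = d])
      fix n' assume n': "n' \<le> n"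
      have "Suc j * n' \<le> j * (m + d)"
      proof -
        have "j * n' \<le> j * m" using n' nm by (intro mult_left_mono) auto
        then show ?thesis using n' jd unfolding mult_Suc distrib_left by linarith
      qed
      then have "large_sieve \<chi> (m + d) n' (C1 * Q powr (\<delta> * (real (m + d) + real n')) * (Q ^ (m + d) + Q powr (2 * (real (m + d) + real n') / 3)))"
        by (rule C1(2)[OF sys])
      then show "large_sieve \<chi> (m + d) n' B"
      proof (rule large_sieve_mono)
        have "2 * (real (m + d) + real n') / 3 \<le> (3 * real d + 2 * (real m + real n)) / 3"
          using n' by (intro divide_right_mono) auto
        also have "\<dots> = real d + 2 * (real m + real n) / 3" by (simp add: add_divide_distrib)
        finally have "Q powr (2 * (real (m + d) + real n') / 3) \<le> Q powr (real d + 2 * (real m + real n) / 3)"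
          using Q by (intro powr_mono) auto
        moreover have "Q ^ (m + d) = Q powr real d * Q ^ m" using Q by (simp add: power_add powr_realpow)
        ultimately have "Q ^ (m + d) + Q powr (2 * (real (m + d) + real n') / 3) \<le> Q powr real d * T"
          by (simp add: T_def distrib_left powr_add)
        moreover have "Q powr (\<delta> * (real (m + d) + real n')) \<le> Q powr (\<delta> * (real m + real d + real n))"
          using Q d0 n' by (intro powr_mono mult_left_mono) auto
        ultimately show "C1 * Q powr (\<delta> * (real (m + d) + real n')) * (Q ^ (m + d) + Q powr (2 * (real (m + d) + real n') / 3)) \<le> B"
          unfolding B_def using C1(1) Q T0 by (intro mult_mono mult_left_mono) auto
      qed
    qed (use C1 T0 in \<open>simp add: B_def\<close>)
    then show ?thesis
    proof (rule large_sieve_mono)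
      have "\<delta> * real d \<le> 1 * real d" using d0 by (intro mult_right_mono) auto
      moreover have "\<delta> * (real m + real n) \<le> \<epsilon> / 2 * (real m + real n)" using d0 by (intro mult_right_mono) auto
      moreover have "\<epsilon> / 2 * real n \<le> \<epsilon> / 2 * (real m + real n)" using eps by (intro mult_left_mono) auto
      \<comment> \<open>Twice the bound for \<open>d\<close> contributes
        \<open>\<epsilon> n / 2 + 2\<close>; the summand \<open>2\<close> is the origin of
        \<open>Q powr 2\<close> in the constant.\<close>
      ultimately have ex: "\<delta> * (real m + real d + real n) + real d \<le> 2 + \<epsilon> * (real m + real n)"
        using dle by (simp add: algebra_simps)
      have "2 * B = 2 * C1 * Q powr (\<delta> * (real m + real d + real n) + real d) * T" by (simp add: B_def powr_add)
      also have "\<dots> \<le> 2 * C1 * Q powr (2 + \<epsilon> * (real m + real n)) * T"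
        using ex C1(1) Q T0 by (intro mult_right_mono mult_left_mono powr_mono) auto
      finally show "2 * B \<le> 2 * C1 * Q powr 2 * Q powr (\<epsilon> * (real m + real n)) * (Q ^ m + Q powr (2 * (real m + real n) / 3))"
        by (simp add: T_def powr_add mult.assoc)
    qed
  qed
  then show "\<exists>C>0. \<forall>\<chi> :: 'a poly \<Rightarrow> 'a poly \<Rightarrow> complex. symbol_system \<chi> \<longrightarrow>
     (\<forall>m n. n \<le> m \<longrightarrow> large_sieve \<chi> m n (C * real CARD('a) powr (\<epsilon> * (real m + real n)) *
        (real CARD('a) ^ m + real CARD('a) powr (2 * (real m + real n) / 3))))"
    using C1(1) Q unfolding Q_def by (intro exI[of _ "2 * C1 * real CARD('a) powr 2"]) auto
qed

text \<open>For \<open>m < n\<close> the decomposition is fed with the range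
  \<open>n \<le> m\<close> itself: the exchanged condition becomes \<open>a \<le> n\<close>, which
  holds for all \<open>a \<le> m\<close>.\<close>

lemma large_sieve_symbol_system:
  assumes eps: "\<epsilon> > 0"
  shows "\<exists>C>0. \<forall>\<chi> :: 'a::{field,finite} poly \<Rightarrow> 'a poly \<Rightarrow> complex. symbol_system \<chi> \<longrightarrow>
     (\<forall>m n. large_sieve \<chi> m n (C * real CARD('a) powr (\<epsilon> * (real m + real n)) *
        (real CARD('a) ^ m + real CARD('a) powr (real n + real m / 3) + real CARD('a) powr (2 * (real m + real n) / 3))))"
proof -
  define Q where "Q = real CARD('a)"
  have Q: "Q > 1" unfolding Q_def using card_field_ge_2[where 'a='a] by linarith
  obtain C1 where C1: "C1 > 0" "\<And>(\<chi> :: 'a poly \<Rightarrow> 'a poly \<Rightarrow> complex) m n. symbol_system \<chi> \<Longrightarrow> n \<le> m \<Longrightarrow>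
     large_sieve \<chi> m n (C1 * Q powr (\<epsilon> * (real m + real n)) * (Q ^ m + Q powr (2 * (real m + real n) / 3)))"
    using sieve_bound_long[where 'a='a] eps unfolding sieve_bound_def Q_def by meson
  obtain C2 where C2: "C2 > 0" "\<And>(\<chi> :: 'a poly \<Rightarrow> 'a poly \<Rightarrow> complex) m n. symbol_system \<chi> \<Longrightarrow> m \<le> n \<Longrightarrow>
      (\<And>a. a \<le> m \<Longrightarrow> a \<le> n) \<Longrightarrow>
     large_sieve \<chi> m n (C2 * Q powr (\<epsilon> * (real m + real n)) * Q powr (real n + real m / 3))"
    using sieve_bound_short[OF sieve_bound_long[where 'a='a] eps] unfolding Q_def by meson
  have "large_sieve \<chi> m n ((C1 + C2) * Q powr (\<epsilon> * (real m + real n)) *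
        (Q ^ m + Q powr (real n + real m / 3) + Q powr (2 * (real m + real n) / 3)))"
    if sys: "symbol_system \<chi>" for \<chi> :: "'a poly \<Rightarrow> 'a poly \<Rightarrow> complex" and m n
  proof (cases "n \<le> m")
    case True
    show ?thesis using C1(2)[OF sys True]
      by (rule large_sieve_mono) (use C1(1) C2(1) Q in \<open>intro mult_mono; simp\<close>)
  next
    case False
    have "large_sieve \<chi> m n (C2 * Q powr (\<epsilon> * (real m + real n)) * Q powr (real n + real m / 3))"
      by (rule C2(2)[OF sys]) (use False in auto)
    then show ?thesis
      by (rule large_sieve_mono) (use C1(1) C2(1) Q in \<open>intro mult_mono; simp\<close>)
  qed
  then show ?thesis using C1(1) C2(1) unfolding Q_def by (intro exI[of _ "C1 + C2"]) auto
qed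

section \<open>Transfer to the residue symbol\<close>

text \<open>As \<open>\<Prod>S\<close> is square-free, the exponents dividing it are
  \<open>0\<close> and \<open>1\<close> for each prime in \<open>S\<close>, so all multiplicities in
  the symbol equal \<open>1\<close>.\<close>

lemma residue_symbol_prod:
  fixes S :: "'a::{field,finite} poly set"
  assumes S: "S \<in> psets n"
  shows "residue_symbol l \<Omega> M (\<Prod>S) = psym (\<lambda>\<pi> a. prime_residue_symbol l \<Omega> a \<pi>) S M"
proof -
  have P: "finite S" "S \<subseteq> monic_primes" using S by (auto simp: psets_def)
  have "{\<pi>. lead_coeff \<pi> = 1 \<and> irreducible \<pi> \<and> \<pi> dvd \<Prod>S} = {\<pi>\<in>monic_primes. \<pi> dvd \<Prod>S}"
    by (auto simp: monic_primes_def)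
  also have "\<dots> = S" using monic_primes_dvd_prod_iff[OF P] P(2) by auto
  finally have e: "{\<pi>. lead_coeff \<pi> = 1 \<and> irreducible \<pi> \<and> \<pi> dvd \<Prod>S} = S" .
  have "poly_multiplicity \<pi> (\<Prod>S) = 1" if p: "\<pi> \<in> S" for \<pi>
  proof -
    have pm: "\<pi> \<in> monic_primes" using p P by auto
    have "squarefree (\<Prod>S)"
      using bij_betwE[OF bij_betw_prod_psets[of n]] S by (auto simp: squarefree_monic_polys_def)
    then have "\<not> \<pi> ^ 2 dvd \<Prod>S" using monic_primes_not_unit[OF pm] by (auto simp: squarefree_def)
    then have "\<not> \<pi> ^ k dvd \<Prod>S" if "k \<ge> 2" for k using le_imp_power_dvd[OF that] dvd_trans by blast
    moreover have "\<pi> dvd \<Prod>S" using monic_primes_dvd_prod_iff[OF P pm] p by blast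
    ultimately have "{k. \<pi> ^ k dvd \<Prod>S} = {0, 1}"
      by (auto simp: numeral_2_eq_2 not_less_eq_eq[symmetric] le_Suc_eq)
    then show ?thesis by (simp add: poly_multiplicity_def)
  qed
  then show ?thesis unfolding residue_symbol_def e psym_def by simp
qed

theorem theorem1p5:
  fixes l q :: nat and \<epsilon> :: real
  assumes "l \<ge> 3"
    and "CARD('a::{field,finite}) = q"
    and "[q = 1] (mod 2 * l)"
    and "\<epsilon> > 0"
  shows "\<exists>C>0. \<forall>\<Omega> :: 'a \<Rightarrow> complex. unity_roots_iso l \<Omega> \<longrightarrow>
    (\<forall>(m::nat) (n::nat) (coef :: 'a poly \<Rightarrow> complex).
      (\<Sum>M\<in>monic_polys m.
         (cmod (\<Sum>N\<in>squarefree_monic_polys n. coef N * residue_symbol l \<Omega> M N))\<^sup>2)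
      \<le> C * real q powr (\<epsilon> * (real m + real n)) *
         (real q ^ m + real q powr (real n + real m / 3)
            + real q powr (2 * (real m + real n) / 3)) *
         (\<Sum>N\<in>squarefree_monic_polys n. (cmod (coef N))\<^sup>2))"
proof -
  obtain C where C: "C > 0" "\<And>(\<chi> :: 'a poly \<Rightarrow> 'a poly \<Rightarrow> complex) m n. symbol_system \<chi> \<Longrightarrow>
     large_sieve \<chi> m n (C * real q powr (\<epsilon> * (real m + real n)) *
        (real q ^ m + real q powr (real n + real m / 3) + real q powr (2 * (real m + real n) / 3)))"
    using large_sieve_symbol_system[where 'a='a, OF \<open>\<epsilon> > 0\<close>] unfolding assms(2) by meson
  have "(\<Sum>M\<in>monic_polys m.
         (cmod (\<Sum>N\<in>squarefree_monic_polys n. coef N * residue_symbol l \<Omega> M N))\<^sup>2)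
      \<le> C * real q powr (\<epsilon> * (real m + real n)) *
         (real q ^ m + real q powr (real n + real m / 3)
            + real q powr (2 * (real m + real n) / 3)) *
         (\<Sum>N\<in>squarefree_monic_polys n. (cmod (coef N))\<^sup>2)"
    if iso: "unity_roots_iso l \<Omega>" for \<Omega> :: "'a \<Rightarrow> complex" and m n and coef :: "'a poly \<Rightarrow> complex"
  proof -
    let ?\<chi> = "\<lambda>\<pi> a. prime_residue_symbol l \<Omega> a \<pi>"
    have sys: "symbol_system ?\<chi>"
      by (rule symbol_system_prime_residue_symbol[OF assms(1) _ iso refl]) (use assms(2,3) in simp)
    have re: "(\<Sum>N\<in>squarefree_monic_polys n. g N) = (\<Sum>S\<in>psets n. g (\<Prod>S))"
      for g :: "'a poly \<Rightarrow> 'b::comm_monoid_add"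
      by (rule sum.reindex_bij_betw[OF bij_betw_prod_psets, symmetric])
    have "(\<Sum>N\<in>squarefree_monic_polys n. coef N * residue_symbol l \<Omega> M N) =
        (\<Sum>S\<in>psets n. coef (\<Prod>S) * psym ?\<chi> S M)" for M
      unfolding re by (intro sum.cong refl) (simp add: residue_symbol_prod)
    then show ?thesis unfolding re
      using C(2)[OF sys, of m n, unfolded large_sieve_def, rule_format, of "\<lambda>S. coef (\<Prod>S)"] by simp
  qed
  then show ?thesis using C(1) by (intro exI[of _ C]) blast
qed

end
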